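(* Let $K=\mathbb{Q}(\rho)$, where $\rho$ is a root of $x^3-ax^2-(a+3)x-1$ with $a\equiv 3$ or $21\pmod{27}$, $a>12$ and $\frac{a^2+3a+9}{27}$ square-free. Put $g_1=1$, $g_2=\rho$, $g_3=\frac{1+\rho+\rho^2}{3}$ (these form an integral basis of $K$). Up to multiplication by totally positive units, the indecomposable integers in $K$ are $1$ and \begin{itemize} \item[(i)] $g_3$, \item[(ii)] $-g_1-(r+1)g_2+3g_3=-r\rho+\rho^2$ where $1\leq r\leq\frac{a}{3}$, \item[(iii)] $-(2v+1)g_1-(v(a+3)+2)g_2+3(v+1)g_3=-v-(v(a+2)+1)\rho+(v+1)\rho^2$ where $\frac{2a}{3}+1\leq v\leq a$, \item[(iv)] $-(2v+1)g_1-(v+1)(a+2)g_2+3(v+1)g_3=-v-(v(a+2)+a-v+1)\rho+(v+1)\rho^2$ where $0\leq v\leq \frac{a}{3}-1$, \item[(v)] $-(2v+1)g_1-(v(a+3)+r+1)g_2+(3v+2)g_3$ where $0\leq v\leq\frac{a}{3}-1$ and $\frac{a}{3}+1\leq r\leq\frac{2a}{3}-v$, \item[(vi)] $-(r+1)g_2+g_3$ where $0\leq r\leq\frac{a}{3}-1$, \item[(vii)] $-(2v+2)g_1-(v(a+3)+\frac{2a}{3}+3)g_2+(3v+4)g_3$ where $0\leq v\leq\frac{a}{3}-1$, \item[(viii)] $-(2v+2)g_1-(v(a+3)+\frac{4a}{3}-v+3)g_2+(3v+4)g_3$ where $\frac{a}{3}\leq v\leq\frac{2a}{3}-1$. \end{itemize}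 The elements in (ii)--(iv) have minimal trace $2$, while those in (i) and (v)--(viii) have minimal trace $1$. The total number of indecomposables in $K$ up to multiplication by totally positive units is $\frac{a^2+3a}{18}+2a+2$.
   Context: An element of $K$ is totally positive if all its images under the three real embeddings are positive. An indecomposable integer is a totally positive $\alpha\in\mathcal{O}_K$ that cannot be written as a sum of two totally positive elements of $\mathcal{O}_K$. The codifferent is $\mathcal{O}_K^{\vee}=\{\delta\in K:\mathrm{Tr}(\delta\alpha)\in\mathbb{Z}\ \forall\alpha\in\mathcal{O}_K\}$, and the minimal trace of a totally positive $\alpha\in\mathcal{O}_K$ is $\min\{\mathrm{Tr}(\delta\alpha):\delta\in\mathcal{O}_K^{\vee}\text{ totally positive}\}$. "Up to multiplication by totally positive units" means every indecomposable is a totally positive unit times one of the listed elements. *)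

theory Defs
  imports "HOL-Computational_Algebra.Polynomial" "HOL-Computational_Algebra.Squarefree" Complex_Main
begin

text \<open>The field K = Q(rho), rho a root of x^3 - a x^2 - (a+3) x - 1, is modelled by
  coordinate triples (c0,c1,c2) in Q^3 standing for c0 + c1 rho + c2 rho^2.
  The three real embeddings send rho to the three real roots r of the polynomial.\<close>

type_synonym Kel = "rat \<times> rat \<times> rat"

definition roots :: "int \<Rightarrow> real set" where
  "roots a = {r::real. r^3 - of_int a * r^2 - (of_int a + 3) * r - 1 = 0}"

definition emb :: "real \<Rightarrow> Kel \<Rightarrow> real" where
  "emb r c = (case c of (c0, c1, c2) \<Rightarrow> of_rat c0 + of_rat c1 * r + of_rat c2 * r^2)"

definition addK :: "Kel \<Rightarrow> Kel \<Rightarrow> Kel" where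
  "addK x y = (case x of (x0, x1, x2) \<Rightarrow> case y of (y0, y1, y2) \<Rightarrow> (x0 + y0, x1 + y1, x2 + y2))"

definition alg_int :: "real \<Rightarrow> bool" where
  "alg_int x \<longleftrightarrow> (\<exists>p :: int poly. lead_coeff p = 1 \<and> poly (map_poly of_int p) x = 0)"

definition OK :: "int \<Rightarrow> Kel \<Rightarrow> bool" where
  "OK a c \<longleftrightarrow> (\<forall>r\<in>roots a. alg_int (emb r c))"

definition totpos :: "int \<Rightarrow> Kel \<Rightarrow> bool" where
  "totpos a c \<longleftrightarrow> (\<forall>r\<in>roots a. emb r c > 0)"

definition trprod :: "int \<Rightarrow> Kel \<Rightarrow> Kel \<Rightarrow> real" where
  "trprod a d c = (\<Sum>r\<in>roots a. emb r d * emb r c)"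

definition codiff :: "int \<Rightarrow> Kel \<Rightarrow> bool" where
  "codiff a d \<longleftrightarrow> (\<forall>c. OK a c \<longrightarrow> trprod a d c \<in> \<int>)"

definition has_min_trace :: "int \<Rightarrow> Kel \<Rightarrow> real \<Rightarrow> bool" where
  "has_min_trace a c m \<longleftrightarrow>
     (\<exists>d. codiff a d \<and> totpos a d \<and> trprod a d c = m) \<and>
     (\<forall>d. codiff a d \<and> totpos a d \<longrightarrow> m \<le> trprod a d c)"

definition indec :: "int \<Rightarrow> Kel \<Rightarrow> bool" where
  "indec a c \<longleftrightarrow> OK a c \<and> totpos a c \<and>
     \<not> (\<exists>b g. OK a b \<and> OK a g \<and> totpos a b \<and> totpos a g \<and> c = addK b g)"

definition unitK :: "int \<Rightarrow> Kel \<Rightarrow> bool" where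
  "unitK a e \<longleftrightarrow> OK a e \<and> (\<exists>h. OK a h \<and> (\<forall>r\<in>roots a. emb r e * emb r h = 1))"

definition tp_unit :: "int \<Rightarrow> Kel \<Rightarrow> bool" where
  "tp_unit a e \<longleftrightarrow> unitK a e \<and> totpos a e"

definition tp_assoc :: "int \<Rightarrow> Kel \<Rightarrow> Kel \<Rightarrow> bool" where
  "tp_assoc a c b \<longleftrightarrow> (\<exists>e. tp_unit a e \<and> (\<forall>r\<in>roots a. emb r c = emb r e * emb r b))"

text \<open>x g1 + y g2 + z g3 with g1 = 1, g2 = rho, g3 = (1 + rho + rho^2)/3.\<close>
definition gb :: "int \<Rightarrow> int \<Rightarrow> int \<Rightarrow> Kel" where
  "gb x y z = (of_int x + of_int z / 3, of_int y + of_int z / 3, of_int z / 3)"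

definition L2 :: "int \<Rightarrow> Kel set" where
  "L2 a =
     {gb (-1) (-(r+1)) 3 | r. 1 \<le> r \<and> r \<le> a div 3}
   \<union> {gb (-(2*v+1)) (-(v*(a+3)+2)) (3*(v+1)) | v. 2*a div 3 + 1 \<le> v \<and> v \<le> a}
   \<union> {gb (-(2*v+1)) (-((v+1)*(a+2))) (3*(v+1)) | v. 0 \<le> v \<and> v \<le> a div 3 - 1}"

definition L1 :: "int \<Rightarrow> Kel set" where
  "L1 a =
     {gb 0 0 1}
   \<union> {gb (-(2*v+1)) (-(v*(a+3)+r+1)) (3*v+2) | v r.
        0 \<le> v \<and> v \<le> a div 3 - 1 \<and> a div 3 + 1 \<le> r \<and> r \<le> 2*a div 3 - v}
   \<union> {gb 0 (-(r+1)) 1 | r. 0 \<le> r \<and> r \<le> a div 3 - 1}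
   \<union> {gb (-(2*v+2)) (-(v*(a+3) + 2*a div 3 + 3)) (3*v+4) | v. 0 \<le> v \<and> v \<le> a div 3 - 1}
   \<union> {gb (-(2*v+2)) (-(v*(a+3) + 4*a div 3 - v + 3)) (3*v+4) | v.
        a div 3 \<le> v \<and> v \<le> 2*a div 3 - 1}"

end

theory Submission
  imports Defs "Jordan_Normal_Form.Char_Poly"
begin

text \<open>Write a = 3 b. The ring of integers is the lattice spanned by 1, rho and (1 + rho + rho^2) / 3:
  squarefreeness of (a^2 + 3 a + 9) / 27 bounds the denominators by a power of 3, and the norm form
  modulo 27 removes that power. In coordinates h, X, Y, Z with X + Y + Z = (b - 1) h, conjugation
  followed by multiplication with a totally positive unit permutes X, Y, Z cyclically.

  A fundamental domain for the totally positive units consists of the simplicial cones on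
  1, rho^2, (1 + rho)^2 and on 1, rho^2, rho'^(-2). Each has a linear functional equal to 1 on its
  generators, and minimising these functionals over an orbit moves any totally positive integer
  into one of the two cones. The first cone is subdivided by (1 + rho + rho^2) / 3, the second
  one by the listed elements, into unimodular cones, so every indecomposable is associated to a
  generator of one of them.

  Conversely an element on which some totally positive element of the codifferent has trace 1 is
  indecomposable; for the elements of level 3 the trace 2 leaves only decompositions into levels
  1 and 2, which further functionals exclude. Totally positive units have level at least 3, so an element in
  the interior of the second cone has smaller level than all its other associates; hence
  the listed elements are pairwise not associated.\<close>

section \<open>Algebraic integers form a ring\<close>

text \<open>The group of totally positive units is never computed. The reduction uses only
  \<open>gen1\<close>, \<open>gen2\<close> and their inverses, because comparison with the three
  neighbouring cones already yields nonnegative barycentric coordinates. Statements about an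
  arbitrary totally positive unit u come from the inequality of arithmetic and geometric means: the
  trace against the inverse of u is at least 3 on totally positive integers, with equality only at
  u, so u is not a proper convex combination of such integers. Scaled to be primitive on the ring of
  integers, the functional of the second cone is 3 on its generators and that of the first cone is 2
  on its generators. The functionals h + X, h + Y, h + Z are traces against totally positive
  elements of the codifferent, so X, Y, Z > - h on totally positive elements of level h; the listed
  elements of levels 2 and 3 other than (1 + rho + rho^2) / 3 lie near the facets of the second
  cone, on the planes X = -1, Y = -1, Z = -1.\<close>

lemma algebraic_int_if_int_matrix:
  fixes v :: "'i \<Rightarrow> 'a :: field_char_0"
  assumes "finite I"
    and rel: "\<And>i. i \<in> I \<Longrightarrow> \<exists>c :: 'i \<Rightarrow> int. \<theta> * v i = (\<Sum>j\<in>I. of_int (c j) * v j)"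
    and nz: "\<exists>i\<in>I. v i \<noteq> 0"
  shows "algebraic_int \<theta>"
proof -
  define n where "n = card I"
  obtain e where e: "bij_betw e {0..<n} I"
    using ex_bij_betw_nat_finite[OF \<open>finite I\<close>] n_def by auto
  from rel obtain C where C: "\<And>i. i \<in> I \<Longrightarrow> \<theta> * v i = (\<Sum>j\<in>I. of_int (C i j :: int) * v j)"
    by metis
  have eI: "k < n \<Longrightarrow> e k \<in> I" for k using e by (auto simp: bij_betw_def)
  define B where "B = mat n n (\<lambda>(k, l). C (e k) (e l))"
  define A where "A = map_mat (of_int :: int \<Rightarrow> 'a) B"
  \<comment> \<open>The relations say that the integer matrix B sends w to theta times w, so theta
    is a root of its monic characteristic polynomial.\<close>
  define w where "w = vec n (\<lambda>k. v (e k))"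
  have B: "B \<in> carrier_mat n n" and A: "A \<in> carrier_mat n n" and w: "w \<in> carrier_vec n"
    by (auto simp: B_def A_def w_def)
  have "A *\<^sub>v w = \<theta> \<cdot>\<^sub>v w"
  proof (rule eq_vecI)
    fix k assume "k < dim_vec (\<theta> \<cdot>\<^sub>v w)"
    then have k: "k < n" by (simp add: w_def)
    have "(A *\<^sub>v w) $ k = (\<Sum>l=0..<n. of_int (C (e k) (e l)) * v (e l))"
      using k by (auto simp: A_def B_def w_def scalar_prod_def intro!: sum.cong)
    also have "\<dots> = (\<Sum>j\<in>I. of_int (C (e k) j) * v j)"
      using sum.reindex_bij_betw[OF e, of "\<lambda>j. of_int (C (e k) j) * v j"] by simp
    also have "\<dots> = \<theta> * v (e k)" using C[OF eI[OF k]] by simp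
    finally show "(A *\<^sub>v w) $ k = (\<theta> \<cdot>\<^sub>v w) $ k" using k by (simp add: w_def)
  qed (simp add: A_def B_def w_def)
  moreover have "w \<noteq> 0\<^sub>v n"
  proof -
    obtain k where "k < n" "v (e k) \<noteq> 0"
      using nz e unfolding bij_betw_def by (metis atLeastLessThan_iff imageE)
    then show ?thesis by (metis index_vec index_zero_vec(1) w_def)
  qed
  ultimately have "eigenvalue A \<theta>"
    using A w unfolding eigenvalue_def eigenvector_def by auto
  then have "poly (char_poly A) \<theta> = 0" using eigenvalue_root_char_poly[OF A] by simp
  moreover have "char_poly A = map_poly of_int (char_poly B)"
    unfolding A_def by (rule of_int_hom.char_poly_hom[OF B])
  moreover have "lead_coeff (char_poly B) = 1" using degree_monic_char_poly[OF B] by auto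
  ultimately show ?thesis unfolding algebraic_int_altdef_ipoly by auto
qed

lemma algebraic_int_power_span:
  fixes x :: "'a :: field_char_0"
  assumes "algebraic_int x"
  obtains n where "n > 0" "\<And>i. \<exists>c :: nat \<Rightarrow> int. x ^ i = (\<Sum>k<n. of_int (c k) * x ^ k)"
proof -
  obtain p :: "int poly" where p: "poly (map_poly of_int p) x = 0" "lead_coeff p = 1"
    using assms unfolding algebraic_int_altdef_ipoly by auto
  define n where "n = degree p"
  have "n > 0"
  proof (rule ccontr)
    assume "\<not> n > 0"
    then obtain c where "p = [:c:]" using n_def by (metis degree_eq_zeroE gr0I)
    with p show False by auto
  qed
  have "0 = (\<Sum>k\<le>n. of_int (coeff p k) * x ^ k)"
    using p(1) by (simp add: poly_altdef n_def degree_map_poly coeff_map_poly)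
  also have "\<dots> = (\<Sum>k<n. of_int (coeff p k) * x ^ k) + x ^ n"
    using p(2) by (simp add: n_def flip: lessThan_Suc_atMost)
  finally have xn: "x ^ n = (\<Sum>k<n. of_int (- coeff p k) * x ^ k)"
    by (simp add: sum_negf eq_neg_iff_add_eq_0 add.commute)
  have "\<exists>c :: nat \<Rightarrow> int. x ^ i = (\<Sum>k<n. of_int (c k) * x ^ k)" for i
  proof (induction i)
    case 0
    have "(\<Sum>k<n. of_int (if k = 0 then 1 else 0) * x ^ k) = (\<Sum>k<n. if k = 0 then 1 else 0)"
      by (rule sum.cong) auto
    then have "x ^ 0 = (\<Sum>k<n. of_int (if k = 0 then 1 else 0) * x ^ k)"
      using \<open>n > 0\<close> by simp
    then show ?case by (rule exI[where x = "\<lambda>k. if k = 0 then 1 else 0"])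
  next
    case (Suc i)
    then obtain c :: "nat \<Rightarrow> int" where c: "x ^ i = (\<Sum>k<n. of_int (c k) * x ^ k)" by blast
    \<comment> \<open>Multiplication by x shifts the coefficients up by one; the overflow into x^n
      is rewritten by the equation of x.\<close>
    define c' where "c' k = (if k = 0 then 0 else c (k - 1)) - c (n - 1) * coeff p k" for k
    obtain m where m: "n = Suc m" using \<open>n > 0\<close> gr0_implies_Suc by blast
    have "x ^ Suc i = (\<Sum>k<m. of_int (c k) * x ^ Suc k) + of_int (c m) * x ^ n"
      by (simp add: c m sum_distrib_left algebra_simps)
    also have "(\<Sum>k<m. of_int (c k) * x ^ Suc k)
        = (\<Sum>k<n. of_int (if k = 0 then 0 else c (k - 1)) * x ^ k)"
      unfolding m by (simp add: sum.lessThan_Suc_shift del: sum.lessThan_Suc power_Suc)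
    also have "of_int (c m) * x ^ n = (\<Sum>k<n. of_int (- c m * coeff p k) * x ^ k)"
      unfolding xn sum_distrib_left by (simp add: algebra_simps)
    finally have "x ^ Suc i = (\<Sum>k<n. of_int (c' k) * x ^ k)"
      by (simp add: c'_def m algebra_simps flip: sum.distrib)
    then show ?case by (rule exI[where x = c'])
  qed
  with \<open>n > 0\<close> show ?thesis using that by blast
qed

text \<open>The finitely many products x^k y^l span a group stable under x and y, so x + y and x y
  act on it by integer matrices.\<close>

lemma algebraic_int_plus_times:
  fixes x y :: "'a :: field_char_0"
  assumes "algebraic_int x" "algebraic_int y"
  shows "algebraic_int (x + y)" "algebraic_int (x * y)"
proof -
  obtain n where n: "n > 0" "\<And>i. \<exists>c :: nat \<Rightarrow> int. x ^ i = (\<Sum>k<n. of_int (c k) * x ^ k)"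
    using algebraic_int_power_span[OF assms(1)] by blast
  obtain m where m: "m > 0" "\<And>i. \<exists>c :: nat \<Rightarrow> int. y ^ i = (\<Sum>k<m. of_int (c k) * y ^ k)"
    using algebraic_int_power_span[OF assms(2)] by blast
  define I where "I = {..<n} \<times> {..<m}"
  define v where "v = (\<lambda>(k, l). x ^ k * y ^ l)"
  have span: "\<exists>c :: nat \<times> nat \<Rightarrow> int. x ^ i * y ^ j = (\<Sum>k\<in>I. of_int (c k) * v k)" for i j
  proof -
    obtain c d :: "nat \<Rightarrow> int" where "x ^ i = (\<Sum>k<n. of_int (c k) * x ^ k)"
      "y ^ j = (\<Sum>k<m. of_int (d k) * y ^ k)" using n(2) m(2) by metis
    then have "x ^ i * y ^ j = (\<Sum>k\<in>I. of_int (case k of (k, l) \<Rightarrow> c k * d l) * v k)"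
      by (auto simp: I_def v_def sum_product sum.cartesian_product algebra_simps intro!: sum.cong)
    then show ?thesis by (rule exI[where x = "\<lambda>k. case k of (k, l) \<Rightarrow> c k * d l"])
  qed
  have fin: "finite I" by (simp add: I_def)
  have nz: "\<exists>i\<in>I. v i \<noteq> 0"
    using n(1) m(1) by (intro bexI[of _ "(0, 0)"]) (auto simp: I_def v_def)
  show "algebraic_int (x + y)"
  proof (rule algebraic_int_if_int_matrix[OF fin _ nz])
    fix i assume "i \<in> I"
    obtain k l where i: "i = (k, l)" by force
    obtain c d :: "nat \<times> nat \<Rightarrow> int" where
      "x ^ Suc k * y ^ l = (\<Sum>k\<in>I. of_int (c k) * v k)"
      "x ^ k * y ^ Suc l = (\<Sum>k\<in>I. of_int (d k) * v k)" using span by metis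
    then have "(x + y) * v i = (\<Sum>j\<in>I. of_int (c j + d j) * v j)"
      by (simp add: i v_def algebra_simps sum.distrib)
    then show "\<exists>c. (x + y) * v i = (\<Sum>j\<in>I. of_int (c j) * v j)"
      by (rule exI[where x = "\<lambda>j. c j + d j"])
  qed
  show "algebraic_int (x * y)"
  proof (rule algebraic_int_if_int_matrix[OF fin _ nz])
    fix i assume "i \<in> I"
    obtain k l where i: "i = (k, l)" by force
    show "\<exists>c. (x * y) * v i = (\<Sum>j\<in>I. of_int (c j) * v j)"
      using span[of "Suc k" "Suc l"] by (simp add: i v_def algebra_simps)
  qed
qed

lemmas algebraic_int_plus = algebraic_int_plus_times(1)
  and algebraic_int_times = algebraic_int_plus_times(2)

section \<open>The cubic polynomial and its roots\<close>

lemma emb_triple: "emb r (c0, c1, c2) = of_rat c0 + of_rat c1 * r + of_rat c2 * r ^ 2"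
  by (simp add: emb_def)

lemma emb_gb: "emb r (gb x y z) = of_int x + of_int y * r + of_int z * ((1 + r + r ^ 2) / 3)"
  by (simp add: emb_def gb_def of_rat_add of_rat_divide algebra_simps add_divide_distrib)

text \<open>Multiplication modulo the cubic: the factors of x1 * y2 + x2 * y1 and of x2 * y2 are the
  coordinates of rho^3 and rho^4.\<close>

definition mulK :: "int \<Rightarrow> Kel \<Rightarrow> Kel \<Rightarrow> Kel" where
  "mulK a x y = (case x of (x0, x1, x2) \<Rightarrow> case y of (y0, y1, y2) \<Rightarrow>
    (x0 * y0 + (x1 * y2 + x2 * y1) + of_int a * (x2 * y2),
     x0 * y1 + x1 * y0 + (of_int a + 3) * (x1 * y2 + x2 * y1)
       + (1 + of_int a * (of_int a + 3)) * (x2 * y2),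
     x0 * y2 + x1 * y1 + x2 * y0 + of_int a * (x1 * y2 + x2 * y1)
       + (of_int a ^ 2 + of_int a + 3) * (x2 * y2)))"

lemma emb_mulK:
  assumes "r \<in> roots a"
  shows "emb r (mulK a x y) = emb r x * emb r y"
proof -
  have r: "r ^ 3 = of_int a * r ^ 2 + (of_int a + 3) * r + 1"
    using assms by (simp add: roots_def)
  obtain x0 x1 x2 y0 y1 y2 where xy: "x = (x0, x1, x2)" "y = (y0, y1, y2)"
    by (metis prod_cases3)
  have *: "X0 * Y0 + (X1 * Y2 + X2 * Y1) + A * (X2 * Y2)
      + (X0 * Y1 + X1 * Y0 + (A + 3) * (X1 * Y2 + X2 * Y1) + (1 + A * (A + 3)) * (X2 * Y2)) * r
      + (X0 * Y2 + X1 * Y1 + X2 * Y0 + A * (X1 * Y2 + X2 * Y1) + (A ^ 2 + A + 3) * (X2 * Y2)) * r ^ 2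
      = (X0 + X1 * r + X2 * r ^ 2) * (Y0 + Y1 * r + Y2 * r ^ 2)"
    if "r ^ 3 = A * r ^ 2 + (A + 3) * r + 1" for A X0 X1 X2 Y0 Y1 Y2 :: real
  proof -
    \<comment> \<open>The first factor is the quotient of the product polynomial by the
      cubic.\<close>
    have "0 = (X1 * Y2 + X2 * Y1 + X2 * Y2 * (r + A)) * (r ^ 3 - (A * r ^ 2 + (A + 3) * r + 1))"
      using that by simp
    then show ?thesis by (simp add: power2_eq_square power3_eq_cube algebra_simps)
  qed
  show ?thesis
    unfolding xy mulK_def prod.case emb_triple
    by (simp only: of_rat_add of_rat_mult of_rat_power of_rat_of_int_eq of_rat_1 of_rat_numeral_eq)
      (rule *[OF r])
qed

lemma emb_addK: "emb r (addK x y) = emb r x + emb r y"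
  by (auto simp: emb_def addK_def of_rat_add algebra_simps split: prod.splits)

lemma gb_add: "gb (x + x') (y + y') (z + z') = addK (gb x y z) (gb x' y' z')"
  by (simp add: gb_def addK_def field_simps)

lemma alg_int_iff: "alg_int x \<longleftrightarrow> algebraic_int x"
  unfolding alg_int_def algebraic_int_altdef_ipoly by auto

lemma algebraic_int_of_int [simp]: "algebraic_int (of_int n :: 'a :: field_char_0)"
  by (rule int_imp_algebraic_int) simp

lemma algebraic_int_1 [simp]: "algebraic_int (1 :: 'a :: field_char_0)"
  using algebraic_int_of_int[of 1, where 'a = 'a] by simp

lemma algebraic_int_diff:
  fixes x y :: "'a :: field_char_0"
  assumes "algebraic_int x" "algebraic_int y"
  shows "algebraic_int (x - y)"
  using algebraic_int_plus[OF assms(1), of "- y"] assms(2) by simp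

lemma algebraic_int_power:
  fixes x :: "'a :: field_char_0"
  shows "algebraic_int x \<Longrightarrow> algebraic_int (x ^ n)"
  by (induction n) (auto intro: algebraic_int_times)

lemma algebraic_int_rat_int:
  fixes q :: rat
  assumes "algebraic_int (of_rat q :: real)"
  obtains n where "q = of_int n"
proof -
  have "(of_rat q :: real) \<in> \<int>"
    using rational_algebraic_int_is_int[OF assms] by simp
  then obtain n where "(of_rat q :: real) = of_int n" by (auto elim: Ints_cases)
  then have "(of_rat q :: real) = of_rat (of_int n)" by simp
  then show ?thesis using that of_rat_eq_iff by blast
qed

lemma squarefree_dvd_power_imp_dvd:
  fixes m k :: int
  assumes "squarefree m" "m dvd k ^ n"
  shows "m dvd k"
proof (cases "n = 0 \<or> k = 0")
  case True
  then show ?thesis using assms dvd_trans[of m 1 k] by auto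
next
  case False
  have "m \<noteq> 0" using assms(1) by auto
  show ?thesis
  proof (rule multiplicity_le_imp_dvd[OF \<open>m \<noteq> 0\<close>])
    fix p :: int assume p: "prime p"
    show "multiplicity p m \<le> multiplicity p k"
    proof (cases "p dvd m")
      case True
      then have "p dvd k" using p assms(2) prime_dvd_power by (metis dvd_trans)
      then have "multiplicity p k \<ge> 1"
        using False p by (intro multiplicity_geI) auto
      moreover have "multiplicity p m \<le> 1"
        using assms(1) p \<open>m \<noteq> 0\<close> squarefree_factorial_semiring'' by blast
      ultimately show ?thesis by simp
    qed (simp add: not_dvd_imp_multiplicity_0)
  qed
qed

text \<open>The product is symmetric in the roots, so it is first expanded in their elementary
  symmetric functions and only then specialised.\<close>

lemma norm_form:
  fixes x1 x2 x3 c0 c1 c2 a :: real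
  assumes "x1 + x2 + x3 = a" "x1 * x2 + x1 * x3 + x2 * x3 = - (a + 3)" "x1 * x2 * x3 = 1"
  shows "(c0 + c1 * x1 + c2 * x1 ^ 2) * (c0 + c1 * x2 + c2 * x2 ^ 2) * (c0 + c1 * x3 + c2 * x3 ^ 2)
    = c0 ^ 3 + a * c0 ^ 2 * c1 + (a ^ 2 + 2 * a + 6) * c0 ^ 2 * c2 - (a + 3) * c0 * c1 ^ 2
      - (a ^ 2 + 3 * a + 3) * c0 * c1 * c2 + (a ^ 2 + 4 * a + 9) * c0 * c2 ^ 2
      + c1 ^ 3 + a * c1 ^ 2 * c2 - (a + 3) * c1 * c2 ^ 2 + c2 ^ 3"
proof -
  let ?s = "x1 + x2 + x3" and ?t = "x1 * x2 + x1 * x3 + x2 * x3" and ?p = "x1 * x2 * x3"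
  have "(c0 + c1 * x1 + c2 * x1 ^ 2) * (c0 + c1 * x2 + c2 * x2 ^ 2) * (c0 + c1 * x3 + c2 * x3 ^ 2)
    = c0 ^ 3 + ?s * c0 ^ 2 * c1 + (?s ^ 2 - 2 * ?t) * c0 ^ 2 * c2 + ?t * c0 * c1 ^ 2
      + (?s * ?t - 3 * ?p) * c0 * c1 * c2 + (?t ^ 2 - 2 * ?s * ?p) * c0 * c2 ^ 2
      + ?p * c1 ^ 3 + ?s * ?p * c1 ^ 2 * c2 + ?t * ?p * c1 * c2 ^ 2 + ?p ^ 2 * c2 ^ 3"
    by (simp add: power2_eq_square power3_eq_cube algebra_simps)
  then show ?thesis
    unfolding assms by (simp add: power2_eq_square algebra_simps)
qed

text \<open>Here m = (a^2 + 3 a + 9) / 27, since a^2 + 3 a + 9 = 9 (b^2 + b + 1). The Galois action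
  is the map t -> - (1 + t) / t of order 3; it sends r1 to r2 and r3 to r1.\<close>

locale simplest_cubic =
  fixes a b m :: int and r1 r2 r3 :: real
  assumes a_eq: "a = 3 * b" and b_ge: "b \<ge> 7" and m_eq: "b ^ 2 + b + 1 = 3 * m"
    and b_mod: "b mod 9 = 1 \<or> b mod 9 = 7" and sqf: "squarefree m"
    and r1_in: "r1 \<in> roots a"
    and r1_gt: "of_int a + 1 < r1" and r1_less: "r1 < of_int a + 2"
    and r12: "r1 * r2 = - (1 + r1)" and r31: "r3 * r1 = - (1 + r3)"
begin

text \<open>The norm form in the basis 1, rho, (1 + rho + rho^2) / 3, with a eliminated in favour of
  b and m.\<close>

definition nrm :: "int \<Rightarrow> int \<Rightarrow> int \<Rightarrow> int" where
  "nrm x y z = x ^ 3 + 3 * b * x ^ 2 * y + 9 * m * x ^ 2 * z - 3 * (b + 1) * x * y ^ 2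
    - 9 * m * x * y * z + 6 * m * x * z ^ 2 + y ^ 3 - 3 * m * y * z ^ 2 + m * z ^ 3"

lemma r1_pos: "r1 > 0" "r1 > 22" using r1_gt b_ge a_eq by linarith+

lemma cubic: "r \<in> roots a \<Longrightarrow> r ^ 3 = of_int a * r ^ 2 + (of_int a + 3) * r + 1"
  by (simp add: roots_def)

lemma r2_eq: "r2 = - 1 - 1 / r1" and r3_eq: "r3 = - 1 / (1 + r1)"
  using r12 r31 r1_pos by (auto simp: field_simps)

lemma r23: "r2 * r3 = - (1 + r2)"
proof -
  have "(r2 * r3 + 1 + r2) * r1 = r3 * (r1 * r2) + r1 + r1 * r2" by (simp add: algebra_simps)
  also have "\<dots> = - (r3 * r1) - r3 - 1" unfolding r12 by (simp add: algebra_simps)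
  also have "\<dots> = 0" unfolding r31 by simp
  finally show ?thesis using r1_pos by auto
qed

lemma e3: "r1 * r2 * r3 = 1"
  unfolding r12 using r31 by (simp add: algebra_simps)

lemma e1: "r1 + r2 + r3 = of_int a"
proof -
  have "(r1 + r2 + r3 - of_int a) * r1 = r1 ^ 2 + r1 * r2 + r3 * r1 - of_int a * r1"
    by (simp add: power2_eq_square algebra_simps)
  also have "\<dots> = r1 ^ 2 - 2 - r1 - r3 - of_int a * r1" unfolding r12 r31 by simp
  finally have "(r1 + r2 + r3 - of_int a) * r1 * (1 + r1)
      = (r1 ^ 2 - 2 - r1 - r3 - of_int a * r1) * (1 + r1)"
    by simp
  also have "\<dots> = (r1 ^ 2 - 2 - r1 - of_int a * r1) * (1 + r1) - (r3 * r1 + r3)"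
    by (simp add: algebra_simps)
  also have "\<dots> = r1 ^ 3 - of_int a * r1 ^ 2 - (of_int a + 3) * r1 - 1"
    unfolding r31 by (simp add: power2_eq_square power3_eq_cube algebra_simps)
  also have "\<dots> = 0" using cubic[OF r1_in] by simp
  finally show ?thesis using r1_pos by auto
qed

lemma e2: "r1 * r2 + r1 * r3 + r2 * r3 = - (of_int a + 3)"
  using r12 r31 r23 e1 by (simp add: algebra_simps)

lemma roots_eq: "roots a = {r1, r2, r3}"
proof -
  have "r ^ 3 - of_int a * r ^ 2 - (of_int a + 3) * r - 1 = (r - r1) * (r - r2) * (r - r3)" for r
  proof -
    have "(r - r1) * (r - r2) * (r - r3)
      = r ^ 3 - (r1 + r2 + r3) * r ^ 2 + (r1 * r2 + r1 * r3 + r2 * r3) * r - r1 * r2 * r3"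
      by (simp add: power2_eq_square power3_eq_cube algebra_simps)
    then show ?thesis unfolding e1 e2 e3 by (simp add: algebra_simps)
  qed
  then show ?thesis by (auto simp: roots_def)
qed

lemma r_in: "r1 \<in> roots a" "r2 \<in> roots a" "r3 \<in> roots a" using roots_eq by auto

lemma r2_bounds: "r2 < - 1" "- 2 < r2" and r3_bounds: "r3 < 0" "- 1 / 2 < r3"
  using r1_pos unfolding r2_eq r3_eq by (auto simp: field_simps)

lemma distinct: "r1 \<noteq> r2" "r1 \<noteq> r3" "r2 \<noteq> r3"
  using r1_pos r2_bounds r3_bounds by auto

lemma ball_roots: "(\<forall>r\<in>roots a. P r) \<longleftrightarrow> P r1 \<and> P r2 \<and> P r3"
  by (simp add: roots_eq)

lemma sum_roots: "(\<Sum>r\<in>roots a. f r) = f r1 + f r2 + f r3"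
  using distinct by (simp add: roots_eq add.assoc)

lemma m_real: "of_int b ^ 2 + of_int b + 1 = 3 * (of_int m :: real)"
  using arg_cong[OF m_eq, of "of_int :: int \<Rightarrow> real"] by simp

lemma a_real: "(of_int a :: real) = 3 * of_int b" by (simp add: a_eq)

lemma m_pos: "m > 0" using m_eq b_ge by (smt (verit) zero_le_power2)

lemma norm_form_gb:
  fixes x y z :: real
  defines "f \<equiv> \<lambda>r. x + y * r + z * ((1 + r + r ^ 2) / 3)"
  shows "f r1 * f r2 * f r3 = x ^ 3 + 3 * of_int b * x ^ 2 * y + 9 * of_int m * x ^ 2 * z
    - 3 * (of_int b + 1) * x * y ^ 2 - 9 * of_int m * x * y * z + 6 * of_int m * x * z ^ 2
    + y ^ 3 - 3 * of_int m * y * z ^ 2 + of_int m * z ^ 3"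
proof -
  have eq: "f r = (x + z / 3) + (y + z / 3) * r + z / 3 * r ^ 2" for r
    by (simp add: f_def field_simps)
  have id: "c0 ^ 3 + a * c0 ^ 2 * c1 + (a ^ 2 + 2 * a + 6) * c0 ^ 2 * c2 - (a + 3) * c0 * c1 ^ 2
      - (a ^ 2 + 3 * a + 3) * c0 * c1 * c2 + (a ^ 2 + 4 * a + 9) * c0 * c2 ^ 2
      + c1 ^ 3 + a * c1 ^ 2 * c2 - (a + 3) * c1 * c2 ^ 2 + c2 ^ 3 =
     x ^ 3 + 3 * b * x ^ 2 * y + 9 * m * x ^ 2 * z - 3 * (b + 1) * x * y ^ 2
    - 9 * m * x * y * z + 6 * m * x * z ^ 2 + y ^ 3 - 3 * m * y * z ^ 2 + m * z ^ 3"
    if e: "c2 = z / 3" "c1 = y + z / 3" "c0 = x + z / 3" "a = 3 * b" and m: "m = (b ^ 2 + b + 1) / 3"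
    for a b m c0 c1 c2 :: real
    unfolding e m by (simp add: power2_eq_square power3_eq_cube field_simps)
  have mr: "(of_int m :: real) = (of_int b ^ 2 + of_int b + 1) / 3" using m_real by simp
  show ?thesis
    unfolding eq norm_form[OF e1 e2 e3] by (rule id[OF refl refl refl a_real mr])
qed

lemma norm_gb: "emb r1 (gb x y z) * emb r2 (gb x y z) * emb r3 (gb x y z) = of_int (nrm x y z)"
  unfolding emb_gb norm_form_gb nrm_def by simp

text \<open>Modulo 3 the norm form is (x + y + z)^3; it is -6 z^3 modulo 9 when 3 divides x + y + z, and
  (6 b + 3) y^3 modulo 27 when moreover 3 divides z. The long polynomials are the cofactors.\<close>

lemma nrm_dvd_27:
  assumes "27 dvd nrm x y z"
  shows "3 dvd x" "3 dvd y" "3 dvd z"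
proof -
  have p3: "prime (3 :: int)" by simp
  obtain k where k: "b = 1 + 9 * k \<and> m = 1 + 9 * k + 27 * k ^ 2
      \<or> b = 7 + 9 * k \<and> m = 19 + 45 * k + 27 * k ^ 2"
  proof -
    have "b = b mod 9 + 9 * (b div 9)" by simp
    then consider k where "b = 1 + 9 * k" | k where "b = 7 + 9 * k"
      using b_mod by metis
    then show ?thesis
    proof cases
      case (1 k)
      then have "3 * m = 3 * (1 + 9 * k + 27 * k ^ 2)"
        using m_eq by (simp add: power2_eq_square algebra_simps)
      with 1 show ?thesis using that[of k] by simp
    next
      case (2 k)
      then have "3 * m = 3 * (19 + 45 * k + 27 * k ^ 2)"
        using m_eq by (simp add: power2_eq_square algebra_simps)
      with 2 show ?thesis using that[of k] by simp
    qed
  qed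
  then obtain l where l: "m = 1 + 3 * l"
  proof
    assume "b = 1 + 9 * k \<and> m = 1 + 9 * k + 27 * k ^ 2"
    then show ?thesis using that[of "3 * k + 9 * k ^ 2"] by simp
  next
    assume "b = 7 + 9 * k \<and> m = 19 + 45 * k + 27 * k ^ 2"
    then show ?thesis using that[of "6 + 15 * k + 9 * k ^ 2"] by simp
  qed
  have "nrm x y z = (x + y + z) ^ 3 + 3 * (b * x ^ 2 * y + 3 * m * x ^ 2 * z - (b + 1) * x * y ^ 2
    - 3 * m * x * y * z + 2 * m * x * z ^ 2 - m * y * z ^ 2 + l * z ^ 3
    - x ^ 2 * y - x ^ 2 * z - x * y ^ 2 - y ^ 2 * z - x * z ^ 2 - y * z ^ 2 - 2 * x * y * z)"
    unfolding nrm_def unfolding l by (simp add: power2_eq_square power3_eq_cube algebra_simps)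
  moreover have "3 dvd nrm x y z" using assms by (rule dvd_trans[rotated]) simp
  ultimately have "3 dvd (x + y + z) ^ 3" by (simp add: dvd_add_left_iff)
  then have "3 dvd x + y + z" using p3 prime_dvd_power by blast
  then obtain w where "x + y + z = 3 * w" by auto
  then have x: "x = 3 * w - y - z" by simp
  have "9 dvd nrm x y z + 6 * z ^ 3"
    using k
  proof
    assume bm: "b = 1 + 9 * k \<and> m = 1 + 9 * k + 27 * k ^ 2"
    have "nrm x y z + 6 * z ^ 3 = 9 * ((243)*k^2*w^2*z + (-243)*k^2*w*y*z + (-108)*k^2*w*z^2
      + (54)*k^2*y^2*z + (54)*k^2*y*z^2 + (12)*k^2*z^3 + (27)*k*w^2*y + (81)*k*w^2*z + (-27)*k*w*y^2
      + (-99)*k*w*y*z + (-36)*k*w*z^2 + (6)*k*y^3 + (27)*k*y^2*z + (21)*k*y*z^2 + (4)*k*z^3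
      + (3)*w^3 + (6)*w^2*z + (-3)*w*y^2 + (-9)*w*y*z + (-3)*w*z^2 + (1)*y^3 + (3)*y^2*z + (2)*y*z^2
      + (1)*z^3)"
      unfolding nrm_def unfolding x conjunct1[OF bm] conjunct2[OF bm]
      by (simp add: power2_eq_square power3_eq_cube algebra_simps)
    then show ?thesis by (rule dvdI)
  next
    assume bm: "b = 7 + 9 * k \<and> m = 19 + 45 * k + 27 * k ^ 2"
    have "nrm x y z + 6 * z ^ 3 = 9 * ((243)*k^2*w^2*z + (-243)*k^2*w*y*z + (-108)*k^2*w*z^2
      + (54)*k^2*y^2*z + (54)*k^2*y*z^2 + (12)*k^2*z^3 + (27)*k*w^2*y + (405)*k*w^2*z
      + (-27)*k*w*y^2 + (-423)*k*w*y*z + (-180)*k*w*z^2 + (6)*k*y^3 + (99)*k*y^2*z + (93)*k*y*z^2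
      + (20)*k*z^3 + (3)*w^3 + (18)*w^2*y + (168)*w^2*z + (-21)*w*y^2 + (-183)*w*y*z + (-75)*w*z^2
      + (5)*y^3 + (45)*y^2*z + (40)*y*z^2 + (9)*z^3)"
      unfolding nrm_def unfolding x conjunct1[OF bm] conjunct2[OF bm]
      by (simp add: power2_eq_square power3_eq_cube algebra_simps)
    then show ?thesis by (rule dvdI)
  qed
  moreover have "9 dvd nrm x y z" using assms by (rule dvd_trans[rotated]) simp
  ultimately have "3 * 3 dvd 3 * (2 * z ^ 3)" by (simp add: dvd_add_right_iff)
  then have "3 dvd 2 * z ^ 3" by (subst (asm) dvd_mult_cancel_left) simp
  then have "3 dvd z ^ 3" using coprime_dvd_mult_right_iff[of 3 2 "z ^ 3"] by simp
  then show z: "3 dvd z" using p3 prime_dvd_power by blast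
  then obtain z' where z': "z = 3 * z'" by auto
  have x': "x = 3 * w - y - 3 * z'" using x z' by simp
  have "27 dvd nrm x y z - (6 * b + 3) * y ^ 3"
    using k
  proof
    assume bm: "b = 1 + 9 * k \<and> m = 1 + 9 * k + 27 * k ^ 2"
    have "nrm x y z - (6 * b + 3) * y ^ 3 = 27 * ((243)*k^2*w^2*z' + (-243)*k^2*w*y*z'
      + (-324)*k^2*w*z'^2 + (54)*k^2*y^2*z' + (162)*k^2*y*z'^2 + (108)*k^2*z'^3 + (9)*k*w^2*y
      + (81)*k*w^2*z' + (-9)*k*w*y^2 + (-99)*k*w*y*z' + (-108)*k*w*z'^2 + (27)*k*y^2*z'
      + (63)*k*y*z'^2 + (36)*k*z'^3 + (1)*w^3 + (6)*w^2*z' + (-1)*w*y^2 + (-9)*w*y*z' + (-9)*w*z'^2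
      + (3)*y^2*z' + (6)*y*z'^2 + (3)*z'^3)"
      unfolding nrm_def unfolding x' z' conjunct1[OF bm] conjunct2[OF bm]
      by (simp add: power2_eq_square power3_eq_cube algebra_simps)
    then show ?thesis by (rule dvdI)
  next
    assume bm: "b = 7 + 9 * k \<and> m = 19 + 45 * k + 27 * k ^ 2"
    have "nrm x y z - (6 * b + 3) * y ^ 3 = 27 * ((243)*k^2*w^2*z' + (-243)*k^2*w*y*z'
      + (-324)*k^2*w*z'^2 + (54)*k^2*y^2*z' + (162)*k^2*y*z'^2 + (108)*k^2*z'^3 + (9)*k*w^2*y
      + (405)*k*w^2*z' + (-9)*k*w*y^2 + (-423)*k*w*y*z' + (-540)*k*w*z'^2 + (99)*k*y^2*z'
      + (279)*k*y*z'^2 + (180)*k*z'^3 + (1)*w^3 + (6)*w^2*y + (168)*w^2*z' + (-7)*w*y^2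
      + (-183)*w*y*z' + (-225)*w*z'^2 + (45)*y^2*z' + (120)*y*z'^2 + (75)*z'^3)"
      unfolding nrm_def unfolding x' z' conjunct1[OF bm] conjunct2[OF bm]
      by (simp add: power2_eq_square power3_eq_cube algebra_simps)
    then show ?thesis by (rule dvdI)
  qed
  then have y27: "27 dvd (6 * b + 3) * y ^ 3"
    using assms by (meson dvd_diff_right_iff dvd_diffD1 dvd_diff_left_iff)
  \<comment> \<open>9 divides 6 b + 3 with a cofactor that is 1 or -1 modulo 3, so the third factor
    3 of 27 must come from y^3.\<close>
  obtain j where "6 * b + 3 = 9 * (3 * j + 1) \<or> 6 * b + 3 = 9 * (3 * j - 1)"
    using k
  proof
    assume "b = 1 + 9 * k \<and> m = 1 + 9 * k + 27 * k ^ 2"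
    then show ?thesis using that[of "2 * k"] by simp
  next
    assume "b = 7 + 9 * k \<and> m = 19 + 45 * k + 27 * k ^ 2"
    then show ?thesis using that[of "2 * k + 2"] by simp
  qed
  then have "3 dvd y ^ 3"
  proof
    assume e: "6 * b + 3 = 9 * (3 * j + 1)"
    have "(6 * b + 3) * y ^ 3 = 9 * (3 * (j * y ^ 3) + y ^ 3)"
      unfolding e by (simp add: algebra_simps)
    with y27 have "9 * 3 dvd 9 * (3 * (j * y ^ 3) + y ^ 3)" by simp
    then have "3 dvd 3 * (j * y ^ 3) + y ^ 3" by (subst (asm) dvd_mult_cancel_left) simp
    then show ?thesis by (simp add: dvd_add_right_iff)
  next
    assume e: "6 * b + 3 = 9 * (3 * j - 1)"
    have "(6 * b + 3) * y ^ 3 = 9 * (3 * (j * y ^ 3) - y ^ 3)"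
      unfolding e by (simp add: algebra_simps)
    with y27 have "9 * 3 dvd 9 * (3 * (j * y ^ 3) - y ^ 3)" by simp
    then have "3 dvd 3 * (j * y ^ 3) - y ^ 3" by (subst (asm) dvd_mult_cancel_left) simp
    then show ?thesis by (simp add: dvd_diff_right_iff)
  qed
  then show y: "3 dvd y" using p3 prime_dvd_power by blast
  show "3 dvd x" unfolding x' using y by simp
qed

end

section \<open>The ring of integers\<close>

text \<open>Since 1 + x + x^2 = x (x - x') for the next conjugate x', differences of conjugates
  isolate c2, and then c1, up to such factors. The left sides are integral whenever the values of f
  are, which bounds the denominators of the coefficients.\<close>

lemma cyclic_difference:
  fixes x1 x2 x3 c0 c1 c2 :: real
  assumes "x1 * x2 = - (1 + x1)" "x2 * x3 = - (1 + x2)"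
  defines "f \<equiv> \<lambda>x. c0 + c1 * x + c2 * x ^ 2"
  shows "(f x1 - f x2) * (x1 * x2) + (f x1 - f x3) * (x1 * x2 ^ 2)
    = c2 * (1 + x1 + x1 ^ 2) * (1 + x2 + x2 ^ 2)"
    and "x1 * (f x1 - f x2) = (1 + x1 + x1 ^ 2) * (c1 + c2 * (x1 + x2))"
proof -
  have l1: "1 + x1 + x1 ^ 2 = x1 * (x1 - x2)" and l2: "1 + x2 + x2 ^ 2 = x2 * (x2 - x3)"
    and k: "(x1 - x3) * x2 = x2 - x1"
    using assms(1,2) by (simp_all add: power2_eq_square algebra_simps)
  have "(f x1 - f x2) * (x1 * x2) + (f x1 - f x3) * (x1 * x2 ^ 2)
    = x1 * x2 * ((x1 - x2) * (c1 + c2 * (x1 + x2)) + ((x1 - x3) * x2) * (c1 + c2 * (x1 + x3)))"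
    by (simp add: f_def power2_eq_square algebra_simps)
  also have "\<dots> = c2 * (x1 * (x1 - x2)) * (x2 * (x2 - x3))"
    unfolding k by (simp add: algebra_simps)
  finally show "(f x1 - f x2) * (x1 * x2) + (f x1 - f x3) * (x1 * x2 ^ 2)
    = c2 * (1 + x1 + x1 ^ 2) * (1 + x2 + x2 ^ 2)" unfolding l1 l2 .
  show "x1 * (f x1 - f x2) = (1 + x1 + x1 ^ 2) * (c1 + c2 * (x1 + x2))"
    unfolding l1 by (simp add: f_def power2_eq_square algebra_simps)
qed

lemma rat_cube_int:
  fixes q :: rat
  assumes "q ^ 3 = of_int n"
  obtains k where "q = of_int k"
proof -
  have "algebraic_int q"
  proof (rule algebraic_int_root)
    show "poly (monom 1 3) q = of_int n" using assms by (simp add: poly_monom)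
  qed (auto simp: degree_monom_eq)
  then have "q \<in> \<int>" by (rule rational_algebraic_int_is_int) (metis Rats_of_rat of_rat_eq_id id_apply)
  then show ?thesis using that by (auto elim: Ints_cases)
qed

context simplest_cubic
begin

lemma OK_iff_algebraic_int: "OK a c \<longleftrightarrow> (\<forall>r\<in>roots a. algebraic_int (emb r c))"
  by (simp add: OK_def alg_int_iff)

lemma algebraic_int_root_r:
  assumes "r \<in> roots a"
  shows "algebraic_int r"
proof
  let ?p = "[:- 1, - (of_int a + 3), - of_int a, 1:] :: real poly"
  show "\<forall>i. coeff ?p i \<in> \<int>" by (auto simp: coeff_pCons split: nat.splits)
  show "poly ?p r = 0" using cubic[OF assms] by (simp add: power2_eq_square power3_eq_cube algebra_simps)
qed simp

lemma algebraic_int_g3: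
  assumes "r \<in> roots a"
  shows "algebraic_int ((1 + r + r ^ 2) / 3)"
proof
  define g where "g = (1 + r + r ^ 2) / 3"
  \<comment> \<open>The norm of x - (1 + rho + rho^2) / 3 as a polynomial in x, read off from the
    norm form at (x, 0, -1).\<close>
  let ?p = "[:- of_int m, 6 * of_int m, - 9 * of_int m, 1:] :: real poly"
  show "\<forall>i. coeff ?p i \<in> \<int>" by (auto simp: coeff_pCons split: nat.splits)
  have "(g + 0 * r1 + (- 1) * ((1 + r1 + r1 ^ 2) / 3)) * (g + 0 * r2 + (- 1) * ((1 + r2 + r2 ^ 2) / 3))
    * (g + 0 * r3 + (- 1) * ((1 + r3 + r3 ^ 2) / 3)) = 0"
  proof -
    have "g = (1 + r1 + r1 ^ 2) / 3 \<or> g = (1 + r2 + r2 ^ 2) / 3 \<or> g = (1 + r3 + r3 ^ 2) / 3"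
      using assms roots_eq g_def by auto
    moreover have "g + 0 * u + (- 1) * v = g - v" for u v by simp
    ultimately show ?thesis by (metis right_minus_eq mult_zero_left mult_zero_right)
  qed
  then have "g ^ 3 - 9 * of_int m * g ^ 2 + 6 * of_int m * g - of_int m = 0"
    unfolding norm_form_gb by simp
  then show "poly ?p ((1 + r + r ^ 2) / 3) = 0"
    unfolding g_def[symmetric] by (simp add: power2_eq_square power3_eq_cube algebra_simps)
qed simp

lemma OK_gb: "OK a (gb x y z)"
  unfolding OK_iff_algebraic_int emb_gb
proof
  fix r assume r: "r \<in> roots a"
  show "algebraic_int (of_int x + of_int y * r + of_int z * ((1 + r + r ^ 2) / 3))"
    by (intro algebraic_int_plus algebraic_int_times algebraic_int_of_int
        algebraic_int_root_r[OF r] algebraic_int_g3[OF r])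
qed

text \<open>A polynomial of degree at most 2 is determined by its values at the three distinct
  roots. This turns identities between real values into identities of triples.\<close>

lemma emb_inj:
  assumes "\<forall>r\<in>roots a. emb r c = emb r d"
  shows "c = d"
proof -
  obtain c0 c1 c2 d0 d1 d2 where cd: "c = (c0, c1, c2)" "d = (d0, d1, d2)" by (metis prod_cases3)
  define e0 e1 e2 :: real where e: "e0 = of_rat c0 - of_rat d0" "e1 = of_rat c1 - of_rat d1"
    "e2 = of_rat c2 - of_rat d2"
  have z: "e0 + e1 * r + e2 * r ^ 2 = 0" if "r \<in> roots a" for r
    using assms that by (auto simp: cd emb_triple e algebra_simps)
  have "(r1 - r2) * (e1 + e2 * (r1 + r2)) = 0" "(r1 - r3) * (e1 + e2 * (r1 + r3)) = 0"
    using z[OF r_in(1)] z[OF r_in(2)] z[OF r_in(3)] by (simp_all add: power2_eq_square algebra_simps)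
  then have s: "e1 + e2 * (r1 + r2) = 0" "e1 + e2 * (r1 + r3) = 0" using distinct by auto
  moreover have "e2 * (r2 - r3) = (e1 + e2 * (r1 + r2)) - (e1 + e2 * (r1 + r3))"
    by (simp add: algebra_simps)
  ultimately have "e2 * (r2 - r3) = 0" by simp
  then have "e2 = 0" using distinct by simp
  moreover from this have "e1 = 0" using s by simp
  moreover from calculation have "e0 = 0" using z[OF r_in(1)] by simp
  ultimately show ?thesis by (simp add: cd e)
qed

lemma emb_gb_scale: "emb r (gb (k * x) (k * y) (k * z)) = of_int k * emb r (gb x y z)"
  by (simp add: emb_gb algebra_simps)

text \<open>The norm of an integral third is an integer, so 27 divides the norm of the element
  itself and \<open>nrm_dvd_27\<close> applies.\<close>

lemma dvd_3_if_third_integral: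
  assumes "\<forall>r\<in>roots a. algebraic_int (emb r (gb x y z) / 3)"
  shows "3 dvd x" "3 dvd y" "3 dvd z"
proof -
  have "algebraic_int (emb r1 (gb x y z) / 3 * (emb r2 (gb x y z) / 3) * (emb r3 (gb x y z) / 3))"
    using assms unfolding ball_roots by (metis algebraic_int_times)
  also have "emb r1 (gb x y z) / 3 * (emb r2 (gb x y z) / 3) * (emb r3 (gb x y z) / 3)
     = of_rat (of_int (nrm x y z) / 27)"
    using norm_gb[of x y z] by (simp add: of_rat_divide)
  finally obtain n where "of_int (nrm x y z) / 27 = (of_int n :: rat)"
    by (rule algebraic_int_rat_int)
  then have "(of_int (nrm x y z) :: rat) = of_int (27 * n)" by simp
  then have "nrm x y z = 27 * n" by (simp only: of_int_eq_iff)
  then have "27 dvd nrm x y z" by simp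
  then show "3 dvd x" "3 dvd y" "3 dvd z" by (rule nrm_dvd_27)+
qed

lemma descend:
  assumes "OK a c" "\<forall>r\<in>roots a. 3 ^ Suc n * emb r c = emb r (gb x y z)"
  obtains x' y' z' where "\<forall>r\<in>roots a. 3 ^ n * emb r c = emb r (gb x' y' z')"
proof -
  have "algebraic_int (emb r (gb x y z) / 3)" if "r \<in> roots a" for r
  proof -
    have "algebraic_int (of_int (3 ^ n) * emb r c)"
      using assms(1) that by (intro algebraic_int_times algebraic_int_of_int) (auto simp: OK_iff_algebraic_int)
    moreover have "emb r (gb x y z) / 3 = of_int (3 ^ n) * emb r c"
      using bspec[OF assms(2) that] by simp
    ultimately show ?thesis by simp
  qed
  then obtain x' y' z' where "x = 3 * x'" "y = 3 * y'" "z = 3 * z'"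
    using dvd_3_if_third_integral[of x y z] by (auto elim!: dvdE)
  then have "\<forall>r\<in>roots a. 3 ^ n * emb r c = emb r (gb x' y' z')"
    using assms(2) by (auto simp: emb_gb_scale)
  then show ?thesis using that by blast
qed

lemma coprime_m_3: "coprime m 3"
proof -
  have "\<not> 3 dvd m"
  proof
    assume "3 dvd m"
    then obtain k where "m = 3 * k" by auto
    then have e: "b ^ 2 + b + 1 = 9 * k" using m_eq by simp
    \<comment> \<open>Both residues give b^2 + b + 1 = 3 modulo 9, while 3 dividing m would give
      0.\<close>
    have "b mod 9 = 1 \<Longrightarrow> (b ^ 2 + b + 1) mod 9 = 3" "b mod 9 = 7 \<Longrightarrow> (b ^ 2 + b + 1) mod 9 = 3"
      by (simp_all add: power2_eq_square mod_simps flip: mod_add_eq mod_mult_eq)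
    then show False using b_mod e by auto
  qed
  then show ?thesis using prime_imp_coprime[of 3 m] by (simp add: coprime_commute)
qed

text \<open>The product of the three values of 1 + r + r^2 is 27 m. Together with
  \<open>cyclic_difference\<close> this shows that 27 clears the denominators of c2, then of c1,
  then of c0; three uses of \<open>descend\<close> remove the 27.\<close>

lemma OK_imp_gb:
  assumes "OK a c"
  obtains x y z where "c = gb x y z"
proof -
  obtain c0 c1 c2 where c: "c = (c0, c1, c2)" by (metis prod_cases3)
  let ?c0 = "of_rat c0 :: real" and ?c1 = "of_rat c1 :: real" and ?c2 = "of_rat c2 :: real"
  let ?L = "\<lambda>r. 1 + r + r ^ 2 :: real"
  define f where "f r = ?c0 + ?c1 * r + ?c2 * r ^ 2" for r
  have emb: "emb r c = f r" for r by (simp add: c emb_triple f_def)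
  have f: "algebraic_int (f r)" if "r \<in> roots a" for r
    using assms that by (simp add: OK_iff_algebraic_int emb)
  have L: "algebraic_int (?L r)" if "r \<in> roots a" for r
    by (intro algebraic_int_plus algebraic_int_power algebraic_int_root_r[OF that] algebraic_int_1)
  have LLL: "?L r1 * ?L r2 * ?L r3 = 27 * of_int m"
    using norm_form_gb[of 0 0 1] by simp
  have p: "algebraic_int (?c2 * ?L x1 * ?L x2)" "algebraic_int (?L x1 * (?c1 + ?c2 * (x1 + x2)))"
    if "x1 \<in> roots a" "x2 \<in> roots a" "x3 \<in> roots a"
      "x1 * x2 = - (1 + x1)" "x2 * x3 = - (1 + x2)" for x1 x2 x3
    unfolding cyclic_difference[OF that(4,5), of ?c0 ?c1 ?c2, folded f_def, symmetric]
    by (intro algebraic_int_plus algebraic_int_diff algebraic_int_times algebraic_int_power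
        f[OF that(1)] f[OF that(2)] f[OF that(3)]
        algebraic_int_root_r[OF that(1)] algebraic_int_root_r[OF that(2)])+
  note p1 = p[OF r_in(1,2,3) r12 r23] and p2 = p[OF r_in(2,3,1) r23 r31]
    and p3 = p[OF r_in(3,1,2) r31 r12]
  have "algebraic_int (?c2 * ?L r1 * ?L r2 * ?L r3)"
    using p1(1) L[OF r_in(3)] by (rule algebraic_int_times)
  also have "?c2 * ?L r1 * ?L r2 * ?L r3 = of_rat (c2 * 27 * of_int m)"
    using LLL by (simp add: of_rat_mult mult.assoc)
  finally obtain k where k: "c2 * 27 * of_int m = of_int k" by (rule algebraic_int_rat_int)
  \<comment> \<open>So far the denominator of c2 may still contain m. Multiplying the three
    conjugate relations makes k^3 a multiple of 27 m, and squarefreeness of m gives that 3 m divides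
    k.\<close>
  have "algebraic_int ((?c2 * ?L r1 * ?L r2) * (?c2 * ?L r2 * ?L r3) * (?c2 * ?L r3 * ?L r1))"
    by (rule algebraic_int_times[OF algebraic_int_times[OF p1(1) p2(1)] p3(1)])
  also have "(?c2 * ?L r1 * ?L r2) * (?c2 * ?L r2 * ?L r3) * (?c2 * ?L r3 * ?L r1)
      = ?c2 ^ 3 * (?L r1 * ?L r2 * ?L r3) ^ 2"
    by (simp only: power2_eq_square power3_eq_cube mult_ac)
  also have "\<dots> = of_rat (c2 ^ 3 * (27 * of_int m) ^ 2)"
    unfolding LLL by (simp add: of_rat_mult of_rat_power)
  finally obtain k2 where k2: "c2 ^ 3 * (27 * of_int m) ^ 2 = of_int k2" by (rule algebraic_int_rat_int)
  have "(of_int (k ^ 3) :: rat) = (c2 * 27 * of_int m) ^ 3" by (simp add: k)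
  also have "\<dots> = 27 * of_int m * (c2 ^ 3 * (27 * of_int m) ^ 2)"
    by (simp add: power2_eq_square power3_eq_cube)
  also have "\<dots> = of_int (27 * m * k2)" unfolding k2 by simp
  finally have k3: "k ^ 3 = 27 * m * k2" by (simp only: of_int_eq_iff)
  have "m dvd k" by (rule squarefree_dvd_power_imp_dvd[OF sqf, of _ 3]) (simp add: k3)
  moreover have "3 dvd k ^ 3" by (simp add: k3)
  then have "3 dvd k" using prime_dvd_power[of "3 :: int" k 3] by simp
  ultimately have "m * 3 dvd k" using coprime_m_3 by (simp add: divides_mult)
  then obtain k' where "k = m * 3 * k'" by auto
  then have "of_int m * (9 * c2) = of_int m * of_int k'" using k by (simp add: algebra_simps)
  then have k': "9 * c2 = of_int k'" using m_pos by simp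
  then have k'r: "9 * ?c2 = of_int k'" by (metis of_rat_mult of_rat_numeral_eq of_rat_of_int_eq)
  \<comment> \<open>With 9 c2 an integer, the c2 part of the second relation can be subtracted,
    which leaves c1 alone.\<close>
  have q: "algebraic_int (9 * ?c1 * ?L x1)"
    if "x1 \<in> roots a" "x2 \<in> roots a" "algebraic_int (?L x1 * (?c1 + ?c2 * (x1 + x2)))" for x1 x2
  proof -
    have "algebraic_int (of_int 9 * (?L x1 * (?c1 + ?c2 * (x1 + x2))))"
      by (rule algebraic_int_times[OF algebraic_int_of_int that(3)])
    moreover have "algebraic_int (?L x1 * (of_int k' * (x1 + x2)))"
      by (rule algebraic_int_times[OF L[OF that(1)] algebraic_int_times[OF algebraic_int_of_int
          algebraic_int_plus[OF algebraic_int_root_r[OF that(1)] algebraic_int_root_r[OF that(2)]]]])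
    ultimately have "algebraic_int (of_int 9 * (?L x1 * (?c1 + ?c2 * (x1 + x2))) - ?L x1 * (of_int k' * (x1 + x2)))"
      by (rule algebraic_int_diff)
    then show ?thesis unfolding k'r[symmetric] by (simp add: algebra_simps)
  qed
  have "algebraic_int ((9 * ?c1 * ?L r1) * (9 * ?c1 * ?L r2) * (9 * ?c1 * ?L r3))"
    by (rule algebraic_int_times[OF algebraic_int_times[OF
        q[OF r_in(1,2) p1(2)] q[OF r_in(2,3) p2(2)]] q[OF r_in(3,1) p3(2)]])
  also have "(9 * ?c1 * ?L r1) * (9 * ?c1 * ?L r2) * (9 * ?c1 * ?L r3)
      = 729 * ?c1 ^ 3 * (?L r1 * ?L r2 * ?L r3)"
    by (simp add: power3_eq_cube)
  also have "\<dots> = of_rat (of_int m * (27 * c1) ^ 3)"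
    unfolding LLL by (simp add: of_rat_mult of_rat_power power_mult_distrib)
  finally obtain n' where n': "of_int m * (27 * c1) ^ 3 = of_int n'" by (rule algebraic_int_rat_int)
  then have "(of_int m * (27 * c1)) ^ 3 = of_int (m ^ 2 * n')"
    by (simp add: power2_eq_square power3_eq_cube flip: n')
  then obtain j where j: "of_int m * (27 * c1) = of_int j" by (rule rat_cube_int)
  have "(of_int (j ^ 3) :: rat) = of_int (m ^ 2 * n')"
    using \<open>(of_int m * (27 * c1)) ^ 3 = of_int (m ^ 2 * n')\<close> by (simp add: j)
  then have j3: "j ^ 3 = m ^ 2 * n'" by (simp only: of_int_eq_iff)
  have "m dvd j ^ 3" unfolding j3 by (intro dvd_mult2 dvd_power) simp
  then have "m dvd j" by (rule squarefree_dvd_power_imp_dvd[OF sqf])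
  then obtain n1 where "j = m * n1" by auto
  then have n1: "27 * c1 = of_int n1" using j m_pos by simp
  have n2: "27 * c2 = of_int (3 * k')" using k' by simp
  have n1r: "27 * ?c1 = of_int n1" and n2r: "27 * ?c2 = of_int (3 * k')"
    using n1 n2 by (metis of_rat_mult of_rat_numeral_eq of_rat_of_int_eq)+
  have "algebraic_int (of_int 27 * f r1 - of_int n1 * r1 - of_int (3 * k') * r1 ^ 2)"
    by (intro algebraic_int_diff algebraic_int_times algebraic_int_power
        f[OF r_in(1)] algebraic_int_root_r[OF r_in(1)] algebraic_int_of_int)
  also have "of_int 27 * f r1 - of_int n1 * r1 - of_int (3 * k') * r1 ^ 2 = of_rat (27 * c0)"
    unfolding n1r[symmetric] n2r[symmetric] by (simp add: f_def of_rat_mult algebra_simps)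
  finally obtain n0 where n0: "27 * c0 = of_int n0" by (rule algebraic_int_rat_int)
  then have n0r: "27 * ?c0 = of_int n0" by (metis of_rat_mult of_rat_numeral_eq of_rat_of_int_eq)
  \<comment> \<open>In the basis with (1 + rho + rho^2) / 3 the last coordinate of 27 c is 3 * 27 c2
    = 9 k'.\<close>
  have "3 ^ Suc 2 * emb r c = emb r (gb (n0 - 3 * k') (n1 - 3 * k') (9 * k'))" for r
  proof -
    have "3 ^ Suc 2 * emb r c = 27 * ?c0 + 27 * ?c1 * r + 27 * ?c2 * r ^ 2"
      by (simp add: emb f_def algebra_simps)
    then show ?thesis unfolding n0r n1r n2r by (simp add: emb_gb algebra_simps)
  qed
  then obtain x y z where "\<forall>r\<in>roots a. 3 ^ Suc 1 * emb r c = emb r (gb x y z)"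
    using descend[OF assms] by (metis Suc_1)
  then obtain x y z where "\<forall>r\<in>roots a. 3 ^ Suc 0 * emb r c = emb r (gb x y z)"
    using descend[OF assms] by (metis One_nat_def)
  then obtain x y z where "\<forall>r\<in>roots a. 3 ^ 0 * emb r c = emb r (gb x y z)"
    using descend[OF assms] by metis
  then have "c = gb x y z" by (intro emb_inj) simp
  then show ?thesis using that by blast
qed

end

section \<open>Trace functionals and lattice coordinates\<close>

text \<open>Lagrange interpolation: the weights are the values at the roots of an element of the
  dual basis span of 1, x, x^2 under the trace form, with the derivative of the cubic as
  denominator. Hence every linear functional of the coordinates is a trace.\<close>

lemma lagrange_functional:
  fixes x1 x2 x3 n0 n1 n2 c0 c1 c2 :: real
  assumes "x1 \<noteq> x2" "x1 \<noteq> x3" "x2 \<noteq> x3"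
  shows "(n0 * (x2 * x3) - n1 * (x2 + x3) + n2) / ((x1 - x2) * (x1 - x3)) * (c0 + c1 * x1 + c2 * x1 ^ 2)
    + (n0 * (x3 * x1) - n1 * (x3 + x1) + n2) / ((x2 - x3) * (x2 - x1)) * (c0 + c1 * x2 + c2 * x2 ^ 2)
    + (n0 * (x1 * x2) - n1 * (x1 + x2) + n2) / ((x3 - x1) * (x3 - x2)) * (c0 + c1 * x3 + c2 * x3 ^ 2)
    = n0 * c0 + n1 * c1 + n2 * c2"
proof -
  define V where "V = (x1 - x2) * (x1 - x3) * (x2 - x3)"
  have "V \<noteq> 0" using assms by (simp add: V_def)
  have V: "1 / ((x1 - x2) * (x1 - x3)) = (x2 - x3) / V" "1 / ((x2 - x3) * (x2 - x1)) = (x3 - x1) / V"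
    "1 / ((x3 - x1) * (x3 - x2)) = (x1 - x2) / V"
    using assms by (simp_all add: V_def divide_eq_eq eq_divide_eq)
      (simp_all add: algebra_simps)
  have q: "p / d * f = p * f * (1 / d)" for p d f :: real by simp
  have sum: "p1 * ((x2 - x3) / V) + p2 * ((x3 - x1) / V) + p3 * ((x1 - x2) / V)
    = ((x2 - x3) * p1 + (x3 - x1) * p2 + (x1 - x2) * p3) / V" for p1 p2 p3
    by (simp add: add_divide_distrib mult.commute)
  have id: "(x2 - x3) * ((n0 * (x2 * x3) - n1 * (x2 + x3) + n2) * (c0 + c1 * x1 + c2 * x1 ^ 2))
    + (x3 - x1) * ((n0 * (x3 * x1) - n1 * (x3 + x1) + n2) * (c0 + c1 * x2 + c2 * x2 ^ 2))
    + (x1 - x2) * ((n0 * (x1 * x2) - n1 * (x1 + x2) + n2) * (c0 + c1 * x3 + c2 * x3 ^ 2))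
    = (n0 * c0 + n1 * c1 + n2 * c2) * V"
    unfolding V_def by (simp add: power2_eq_square algebra_simps)
  show ?thesis
    unfolding q V sum id using \<open>V \<noteq> 0\<close> by simp
qed

section \<open>Explicit totally positive units and the functionals of the two cones\<close>

definition gen1 :: "int \<Rightarrow> Kel" where \<comment> \<open>the square of the second conjugate of rho\<close>
  "gen1 a = gb (a ^ 2 + 4 * a + 5) (a ^ 2 + 2 * a + 2) (- 3 * (a + 1))"
definition gen1_inv :: "int \<Rightarrow> Kel" where
  "gen1_inv a = gb (- 2 * a - 3) (- (a ^ 2 + 4 * a + 5)) (3 * a + 6)"
text \<open>The square of 1 + rho, a generator of the first cone; it equals \<open>gen1\<close>
  times rho^2.\<close>

definition gen2 :: "int \<Rightarrow> Kel" where
  "gen2 a = gb 0 1 3"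
definition gen2_inv :: "int \<Rightarrow> Kel" where
  "gen2_inv a = gb (2 - 2 * a) (- (a ^ 2 + 2 * a + 1)) (3 * a)"

lemma emb_1: "emb r (gb 1 0 0) = 1" by (simp add: emb_gb)

lemma gen_triple:
  "gen1 a = (of_int a ^ 2 + 3 * of_int a + 4, of_int a ^ 2 + of_int a + 1, - of_int a - 1)"
  "gen1_inv a = (- of_int a - 1, - (of_int a ^ 2) - 3 * of_int a - 3, of_int a + 2)"
  "gen2 a = (1, 2, 1)"
  "gen2_inv a = (2 - of_int a, - (of_int a ^ 2) - of_int a - 1, of_int a)"
  by (simp_all add: gb_def gen1_def gen2_def gen1_inv_def gen2_inv_def field_simps)

lemma gb_triple: "gb 1 0 0 = (1, 0, 0)" "gb (- 1) (- 1) 3 = (0, 0, 1)"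
  by (simp_all add: gb_def)

lemma mulK_gen: "mulK a (gen1 a) (gen1_inv a) = gb 1 0 0" "mulK a (gen2 a) (gen2_inv a) = gb 1 0 0"
  "mulK a (gen1 a) (gb (- 1) (- 1) 3) = gen2 a"
  unfolding gen_triple gb_triple mulK_def
  by (simp_all add: power2_eq_square algebra_simps)

lemma emb_quot: "emb r (p / d, q / d, s / d) = emb r (p, q, s) / of_rat d"
  by (simp add: emb_triple of_rat_divide add_divide_distrib)

text \<open>\<open>hK\<close> is 3 on 1, rho^2, \<open>gen1_inv\<close>, and \<open>TK\<close> is 2
  on 1, rho^2, \<open>gen2\<close>. They are the traces against \<open>dual 3 0 3\<close> and
  \<open>dual 2 (- 1) 2\<close>, in a rational valued form that can be computed on triples.\<close>

definition hK :: "Kel \<Rightarrow> rat" where "hK c = (case c of (c0, c1, c2) \<Rightarrow> 3 * c0 + 3 * c2)"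
definition TK :: "Kel \<Rightarrow> rat" where "TK c = (case c of (c0, c1, c2) \<Rightarrow> 2 * c0 - c1 + 2 * c2)"

context simplest_cubic
begin

text \<open>The level h is three times the sum of the coefficients of 1 and rho^2, and Z is
  (b - 1) h - X - Y throughout.\<close>

definition el :: "int \<Rightarrow> int \<Rightarrow> int \<Rightarrow> Kel" where
  "el h X Y = gb (- h - 2 * X) (- ((a + 3) * X + Y + (b + 2) * h)) (3 * X + 2 * h)"

lemma gb_inj: "gb x y z = gb x' y' z' \<longleftrightarrow> x = x' \<and> y = y' \<and> z = z'"
  by (auto simp: gb_def)

text \<open>The change between x, y, z and h, X, Y is unimodular, so \<open>el\<close> runs through
  the whole ring of integers.\<close>

lemma gb_el: "gb x y z = el (3 * x + 2 * z) (- (2 * x + z)) (- y + (a + 3) * (2 * x + z) - (b + 2) * (3 * x + 2 * z))"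
  by (simp add: el_def gb_inj algebra_simps)

lemma el_inj: "el h X Y = el h' X' Y' \<longleftrightarrow> h = h' \<and> X = X' \<and> Y = Y'"
proof
  assume "el h X Y = el h' X' Y'"
  then have e: "h + 2 * X = h' + 2 * X'" "3 * X + 2 * h = 3 * X' + 2 * h'"
    "(a + 3) * X + Y + (b + 2) * h = (a + 3) * X' + Y' + (b + 2) * h'"
    by (auto simp: el_def gb_inj)
  from e(1,2) have "h = h'" "X = X'" by linarith+
  with e(3) show "h = h' \<and> X = X' \<and> Y = Y'" by simp
qed simp

lemma el_add: "el (h + h') (X + X') (Y + Y') = addK (el h X Y) (el h' X' Y')"
  unfolding el_def gb_add[symmetric] by (simp add: gb_inj algebra_simps)

lemma OK_el: "OK a (el h X Y)" by (simp add: el_def OK_gb)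

lemma OK_imp_el:
  assumes "OK a c"
  obtains h X Y where "c = el h X Y"
  using OK_imp_gb[OF assms] gb_el by metis

text \<open>The numerator in the Lagrange formula: at a root r the first bracket is 1 / r, and r - a
  is minus the sum of the other two roots.\<close>

definition W :: "int \<Rightarrow> int \<Rightarrow> int \<Rightarrow> real \<Rightarrow> real" where
  "W n0 n1 n2 r = of_int n0 * (r ^ 2 - of_int a * r - (of_int a + 3)) + of_int n1 * (r - of_int a) + of_int n2"

text \<open>The element W(rho) / f'(rho), where f is the cubic; the first factor is the inverse of
  f'(rho), as \<open>emb_dual\<close> verifies.\<close>

definition dual :: "int \<Rightarrow> int \<Rightarrow> int \<Rightarrow> Kel" where
  "dual n0 n1 n2 = mulK a
     (- (of_int a + 4) / (of_int a ^ 2 + 3 * of_int a + 9), - (2 * of_int a + 1) / (of_int a ^ 2 + 3 * of_int a + 9),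
      2 / (of_int a ^ 2 + 3 * of_int a + 9))
     (of_int (- (n0 * (a + 3)) - n1 * a + n2), of_int (- n0 * a + n1), of_int n0)"

lemma D_pos: "(of_int a :: real) ^ 2 + 3 * of_int a + 9 > 0"
  using a_eq b_ge by (simp add: add_pos_pos)

lemma emb_dual:
  assumes "r \<in> roots a"
  shows "emb r (dual n0 n1 n2) * (3 * r ^ 2 - 2 * of_int a * r - (of_int a + 3)) = W n0 n1 n2 r"
proof -
  let ?D = "(of_int a :: real) ^ 2 + 3 * of_int a + 9"
  have "(- (of_int a + 4) - (2 * of_int a + 1) * r + 2 * r ^ 2) * (3 * r ^ 2 - 2 * of_int a * r - (of_int a + 3))
      = ?D + (6 * r - 4 * of_int a - 3) * (r ^ 3 - of_int a * r ^ 2 - (of_int a + 3) * r - 1)"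
    by (simp add: power2_eq_square power3_eq_cube algebra_simps)
  also have "\<dots> = ?D" using cubic[OF assms] by simp
  finally have e: "(- (of_int a + 4) - (2 * of_int a + 1) * r + 2 * r ^ 2) * (3 * r ^ 2 - 2 * of_int a * r - (of_int a + 3)) = ?D" .
  have "emb r (- (of_int a + 4) / (of_int a ^ 2 + 3 * of_int a + 9), - (2 * of_int a + 1) / (of_int a ^ 2 + 3 * of_int a + 9),
      2 / (of_int a ^ 2 + 3 * of_int a + 9)) = (- (of_int a + 4) - (2 * of_int a + 1) * r + 2 * r ^ 2) / ?D"
    unfolding emb_quot by (simp add: emb_triple of_rat_add of_rat_minus of_rat_diff of_rat_mult of_rat_power)
      (simp add: algebra_simps)
  moreover have "emb r (of_int (- (n0 * (a + 3)) - n1 * a + n2), of_int (- n0 * a + n1), of_int n0) = W n0 n1 n2 r"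
    unfolding emb_triple of_rat_of_int_eq by (simp add: W_def algebra_simps)
  ultimately have "emb r (dual n0 n1 n2) * (3 * r ^ 2 - 2 * of_int a * r - (of_int a + 3))
    = ((- (of_int a + 4) - (2 * of_int a + 1) * r + 2 * r ^ 2) * (3 * r ^ 2 - 2 * of_int a * r - (of_int a + 3))) / ?D * W n0 n1 n2 r"
    unfolding dual_def emb_mulK[OF assms] by simp
  then show ?thesis unfolding e using D_pos by simp
qed

lemma emb_dual_frac:
  assumes "x1 + x2 + x3 = of_int a" "x1 * x2 + x1 * x3 + x2 * x3 = - (of_int a + 3)"
    "x1 \<noteq> x2" "x1 \<noteq> x3" "x1 \<in> roots a"
  shows "emb x1 (dual n0 n1 n2)
    = (of_int n0 * (x2 * x3) - of_int n1 * (x2 + x3) + of_int n2) / ((x1 - x2) * (x1 - x3))"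
    "W n0 n1 n2 x1 = of_int n0 * (x2 * x3) - of_int n1 * (x2 + x3) + of_int n2"
proof -
  have a: "of_int a = x1 + x2 + x3" and a3: "of_int a + 3 = - (x1 * x2 + x1 * x3 + x2 * x3)"
    using assms(1,2) by simp_all
  have d: "3 * x1 ^ 2 - 2 * of_int a * x1 - (of_int a + 3) = (x1 - x2) * (x1 - x3)"
    unfolding a3 unfolding a by (simp add: power2_eq_square algebra_simps)
  show w: "W n0 n1 n2 x1 = of_int n0 * (x2 * x3) - of_int n1 * (x2 + x3) + of_int n2"
    unfolding W_def a3 unfolding a by (simp add: power2_eq_square algebra_simps)
  show "emb x1 (dual n0 n1 n2)
    = (of_int n0 * (x2 * x3) - of_int n1 * (x2 + x3) + of_int n2) / ((x1 - x2) * (x1 - x3))"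
    using emb_dual[OF assms(5), of n0 n1 n2] assms(3,4) unfolding d w by (simp add: eq_divide_eq)
qed

lemmas emb_dual1 = emb_dual_frac[OF e1 e2 distinct(1,2) r_in(1)]

lemma e_cyc:
  "r2 + r3 + r1 = of_int a" "r2 * r3 + r2 * r1 + r3 * r1 = - (of_int a + 3)"
  "r3 + r1 + r2 = of_int a" "r3 * r1 + r3 * r2 + r1 * r2 = - (of_int a + 3)"
  using e1 e2 by (simp_all add: algebra_simps)

lemmas emb_dual2 = emb_dual_frac[OF e_cyc(1,2) distinct(3) distinct(1)[symmetric] r_in(2)]
  and emb_dual3 = emb_dual_frac[OF e_cyc(3,4) distinct(2,3)[symmetric] r_in(3)]

lemma trprod_dual:
  "trprod a (dual n0 n1 n2) (c0, c1, c2)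
    = of_int n0 * of_rat c0 + of_int n1 * of_rat c1 + of_int n2 * of_rat c2"
  unfolding trprod_def sum_roots emb_dual1 emb_dual2 emb_dual3 emb_triple
  by (rule lagrange_functional[OF distinct])

text \<open>The functional takes the value (n0 + n1 + n2) / 3 at (1 + rho + rho^2) / 3; the
  assumption makes it integral, which puts \<open>dual\<close> into the codifferent.\<close>

lemma trprod_dual_gb:
  assumes "n0 + n1 + n2 = 3 * n"
  shows "trprod a (dual n0 n1 n2) (gb x y z) = of_int (n0 * x + n1 * y + n * z)"
proof -
  have "(of_int n0 + of_int n1 + of_int n2 :: real) = 3 * of_int n"
    using arg_cong[OF assms, of "of_int :: int \<Rightarrow> real"] by simp
  then have n2: "(of_int n2 :: real) = 3 * of_int n - of_int n0 - of_int n1" by simp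
  show ?thesis unfolding gb_def trprod_dual n2
    by (simp add: of_rat_add of_rat_divide algebra_simps)
qed

lemma codiff_dual:
  assumes "n0 + n1 + n2 = 3 * n"
  shows "codiff a (dual n0 n1 n2)"
  unfolding codiff_def
proof (intro allI impI)
  fix c assume "OK a c"
  then obtain x y z where "c = gb x y z" by (rule OK_imp_gb)
  then show "trprod a (dual n0 n1 n2) c \<in> \<int>" by (simp only: trprod_dual_gb[OF assms] Ints_of_int)
qed

lemma totpos_iff: "totpos a c \<longleftrightarrow> emb r1 c > 0 \<and> emb r2 c > 0 \<and> emb r3 c > 0"
  by (simp add: totpos_def ball_roots)

text \<open>The roots are ordered r2 < r3 < r1, so the derivative of the cubic is positive at r1 and
  r2 and negative at r3; the numerators must have the same signs.\<close>

lemma totpos_dual: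
  assumes "W n0 n1 n2 r1 > 0" "W n0 n1 n2 r2 > 0" "W n0 n1 n2 r3 < 0"
  shows "totpos a (dual n0 n1 n2)"
proof -
  have "(r1 - r2) * (r1 - r3) > 0" "(r2 - r3) * (r2 - r1) > 0" "(r3 - r1) * (r3 - r2) < 0"
    using r1_pos r2_bounds r3_bounds by (auto intro!: mult_pos_pos mult_neg_neg mult_neg_pos)
  then show ?thesis
    unfolding totpos_iff emb_dual1(1) emb_dual2(1) emb_dual3(1)
    using assms unfolding emb_dual1(2) emb_dual2(2) emb_dual3(2)
    by (simp add: divide_neg_neg)
qed

lemma trprod_pos: "totpos a d \<Longrightarrow> totpos a c \<Longrightarrow> trprod a d c > 0"
  by (simp add: totpos_iff trprod_def sum_roots add_pos_pos)

lemma inv_r: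
  "r1 ^ 2 - of_int a * r1 - (of_int a + 3) = r2 * r3"
  "r2 ^ 2 - of_int a * r2 - (of_int a + 3) = r3 * r1"
  "r3 ^ 2 - of_int a * r3 - (of_int a + 3) = r1 * r2"
  using emb_dual1(2)[of 1 0 0] emb_dual2(2)[of 1 0 0] emb_dual3(2)[of 1 0 0] by (simp_all add: W_def)

lemma r_signs: "r2 * r3 > 0" "r2 * r3 < 1" "r3 * r1 < 0" "r3 * r1 > - 1" "r1 * r2 < - 23"
  using r1_pos r2_bounds r3_bounds unfolding r23 r31 r12 by auto

text \<open>This and the next four lemmas supply the functionals h, h + X, h + Y, h + Z and T = (a +
  2) X + Y + (b + 2) h, see \<open>trprod_functionals\<close>. Each takes positive integer values on
  totally positive integers.\<close>

lemma totpos_h: "totpos a (dual 3 0 3)"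
  by (rule totpos_dual) (use r_signs in \<open>simp_all add: W_def inv_r\<close>)

lemma totpos_hX: "totpos a (dual 1 0 2)"
  by (rule totpos_dual) (use r_signs in \<open>simp_all add: W_def inv_r\<close>)

lemma totpos_hY: "totpos a (dual (a + 3) (- 1) 1)"
proof -
  \<comment> \<open>For these coefficients the numerator is 1 - 1 / r^2, whose sign is plain at each
    root.\<close>
  have w: "W (a + 3) (- 1) 1 r = 1 - s ^ 2" if "r \<in> roots a" "r * s = 1" for r s
  proof -
    have "r ^ 2 * (W (a + 3) (- 1) 1 r - (1 - s ^ 2)) = (r * s) ^ 2 - 1
      + ((of_int a + 3) * r - 1) * (r ^ 3 - of_int a * r ^ 2 - (of_int a + 3) * r - 1)"
      by (simp add: W_def power2_eq_square power3_eq_cube algebra_simps)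
    also have "\<dots> = 0" using cubic[OF that(1)] that(2) by simp
    finally show ?thesis using that(2) by auto
  qed
  have s: "(r2 * r3) ^ 2 < 1" "(r3 * r1) ^ 2 < 1" "(r1 * r2) ^ 2 > 1"
  proof -
    show "(r2 * r3) ^ 2 < 1" "(r3 * r1) ^ 2 < 1"
      unfolding abs_square_less_1 using r_signs by linarith+
    have "1 < (- (r1 * r2)) ^ 2" using r_signs by (intro one_less_power) auto
    then show "(r1 * r2) ^ 2 > 1" by simp
  qed
  show ?thesis
  proof (rule totpos_dual)
    show "W (a + 3) (- 1) 1 r1 > 0" using w[OF r_in(1), of "r2 * r3"] e3 s by (simp add: mult_ac)
    show "W (a + 3) (- 1) 1 r2 > 0" using w[OF r_in(2), of "r3 * r1"] e3 s by (simp add: mult_ac)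
    show "W (a + 3) (- 1) 1 r3 < 0" using w[OF r_in(3), of "r1 * r2"] e3 s by (simp add: mult_ac)
  qed
qed

lemma totpos_hZ: "totpos a (dual 2 1 (a + 3))"
proof (rule totpos_dual)
  show "W 2 1 (a + 3) r1 > 0" using r_signs r1_pos by (simp add: W_def inv_r)
  have "- r3 * (r2 + 2) > 0" using r2_bounds r3_bounds by (intro mult_pos_pos) auto
  then have "r2 - 2 * r3 + 1 > 0" using r23 by (simp add: algebra_simps)
  then show "W 2 1 (a + 3) r2 > 0" by (simp add: W_def inv_r r31)
  show "W 2 1 (a + 3) r3 < 0" using r_signs r3_bounds by (simp add: W_def inv_r)
qed

lemma totpos_T: "totpos a (dual 2 (- 1) 2)"
proof (rule totpos_dual)
  have a: "of_int a > (20 :: real)" using a_eq b_ge by simp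
  show "W 2 (- 1) 2 r1 > 0" using r_signs r1_less by (simp add: W_def inv_r)
  show "W 2 (- 1) 2 r2 > 0" using r_signs r2_bounds a by (simp add: W_def inv_r)
  show "W 2 (- 1) 2 r3 < 0" using r1_gt r3_bounds a by (simp add: W_def inv_r r12)
qed

lemma pos_functional:
  assumes "totpos a (dual n0 n1 n2)" "n0 + n1 + n2 = 3 * n" "totpos a (gb x y z)"
  shows "n0 * x + n1 * y + n * z \<ge> 1"
  using trprod_pos[OF assms(1,3)] unfolding trprod_dual_gb[OF assms(2)] of_int_0_less_iff by linarith

lemma totpos_el_imp:
  assumes "totpos a (el h X Y)" "Z = (b - 1) * h - X - Y"
  shows "h \<ge> 1" "h + X \<ge> 1" "h + Y \<ge> 1" "h + Z \<ge> 1" "(a + 2) * X + Y + (b + 2) * h \<ge> 1"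
proof -
  note p = pos_functional[OF _ _ assms(1)[unfolded el_def]]
  show "h \<ge> 1" using p[OF totpos_h, of 2] by simp
  show "h + X \<ge> 1" using p[OF totpos_hX, of 1] by simp
  show "h + Y \<ge> 1" using p[OF totpos_hY, of "b + 1"] by (simp add: a_eq algebra_simps)
  show "h + Z \<ge> 1" using p[OF totpos_hZ, of "b + 2"] by (simp add: a_eq assms(2) algebra_simps)
  show "(a + 2) * X + Y + (b + 2) * h \<ge> 1" using p[OF totpos_T, of 1] by (simp add: a_eq algebra_simps)
qed

text \<open>Conjugation followed by multiplication with a totally positive unit permutes X, Y, Z cyclically.\<close>

lemma emb_el_cyclic:
  assumes "x1 \<in> roots a" "x1 * x2 = - (1 + x1)"
  shows "emb x2 (el h X Y) = x2 ^ 2 * emb x1 (el h Y ((b - 1) * h - X - Y))"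
proof -
  define H XX YY B :: real where r: "H = of_int h" "XX = of_int X" "YY = of_int Y" "B = of_int b"
  define Z where "Z = (B - 1) * H - XX - YY"
  define c0 c1 c2 where c: "c0 = - H - 2 * XX" "c1 = - ((3 * B + 3) * XX + YY + (B + 2) * H)" "c2 = XX + 2 / 3 * H"
  define d0 d1 d2 where d: "d0 = - H - 2 * YY" "d1 = - ((3 * B + 3) * YY + Z + (B + 2) * H)" "d2 = YY + 2 / 3 * H"
  have x1: "x1 \<noteq> 0" using assms(2) by auto
  have cub: "x1 ^ 3 - 3 * B * x1 ^ 2 - (3 * B + 3) * x1 - 1 = 0"
    using cubic[OF assms(1)] by (simp add: r a_eq)
  have E1: "emb x2 (el h X Y) = c0 + c1 * x2 + c2 * (1 + x2 + x2 ^ 2)"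
    unfolding el_def emb_gb by (simp add: c r a_eq field_simps)
  have E2: "emb x1 (el h Y ((b - 1) * h - X - Y)) = d0 + d1 * x1 + d2 * (1 + x1 + x1 ^ 2)"
    unfolding el_def emb_gb by (simp add: d r a_eq Z_def field_simps)
  have "x1 ^ 2 * (c0 + c1 * x2 + c2 * (1 + x2 + x2 ^ 2))
      = c0 * x1 ^ 2 + c1 * x1 * (x1 * x2) + c2 * (x1 ^ 2 + x1 * (x1 * x2) + (x1 * x2) ^ 2)"
    by (simp add: power2_eq_square algebra_simps)
  also have "\<dots> = c0 * x1 ^ 2 - c1 * x1 * (1 + x1) + c2 * (x1 ^ 2 + x1 + 1)"
    unfolding assms(2) by (simp add: power2_eq_square algebra_simps)
  also have "\<dots> = (1 + x1) ^ 2 * (d0 + d1 * x1 + d2 * (1 + x1 + x1 ^ 2))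
     - (d2 * x1 + (d1 + d2 + (2 + 3 * B) * d2)) * (x1 ^ 3 - 3 * B * x1 ^ 2 - (3 * B + 3) * x1 - 1)"
    unfolding c d Z_def by (simp add: power2_eq_square power3_eq_cube field_simps)
  also have "\<dots> = (1 + x1) ^ 2 * (d0 + d1 * x1 + d2 * (1 + x1 + x1 ^ 2))"
    unfolding cub by simp
  also have "(1 + x1) ^ 2 = x1 ^ 2 * x2 ^ 2"
    unfolding power_mult_distrib[symmetric] assms(2) by (simp add: power2_eq_square algebra_simps)
  finally have "x1 ^ 2 * (c0 + c1 * x2 + c2 * (1 + x2 + x2 ^ 2))
      = x1 ^ 2 * (x2 ^ 2 * (d0 + d1 * x1 + d2 * (1 + x1 + x1 ^ 2)))" by (simp only: mult.assoc)
  then show ?thesis unfolding E1 E2 using x1 by simp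
qed

lemma emb_el_cyc:
  "emb r2 (el h X Y) = r2 ^ 2 * emb r1 (el h Y ((b - 1) * h - X - Y))"
  "emb r3 (el h X Y) = r3 ^ 2 * emb r2 (el h Y ((b - 1) * h - X - Y))"
  "emb r1 (el h X Y) = r1 ^ 2 * emb r3 (el h Y ((b - 1) * h - X - Y))"
  using emb_el_cyclic r_in r12 r23 r31 by blast+

lemma totpos_cyc: "totpos a (el h Y ((b - 1) * h - X - Y)) \<longleftrightarrow> totpos a (el h X Y)"
proof -
  have "r1 ^ 2 > 0" "r2 ^ 2 > 0" "r3 ^ 2 > 0" using r1_pos r2_bounds r3_bounds by auto
  then show ?thesis unfolding totpos_iff emb_el_cyc[of h X Y] by (auto simp: zero_less_mult_iff)
qed

lemma totpos_el_imp_T: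
  assumes "totpos a (el h X Y)" "Z = (b - 1) * h - X - Y"
  shows "(a + 2) * Y + Z + (b + 2) * h \<ge> 1" "(a + 2) * Z + X + (b + 2) * h \<ge> 1"
proof -
  have t: "totpos a (el h Y Z)" using assms totpos_cyc by simp
  show "(a + 2) * Y + Z + (b + 2) * h \<ge> 1" using totpos_el_imp(5)[OF t refl] .
  have X: "(b - 1) * h - Y - Z = X" by (simp add: assms(2))
  have "totpos a (el h Z X)" using t totpos_cyc[of h Z Y] unfolding X by simp
  then show "(a + 2) * Z + X + (b + 2) * h \<ge> 1" using totpos_el_imp(5)[OF _ refl] by simp
qed

definition norm_el :: "int \<Rightarrow> int \<Rightarrow> int \<Rightarrow> int" where
  "norm_el h X Y = nrm (- h - 2 * X) (- ((a + 3) * X + Y + (b + 2) * h)) (3 * X + 2 * h)"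

lemma emb_norm_el: "emb r1 (el h X Y) * emb r2 (el h X Y) * emb r3 (el h X Y) = of_int (norm_el h X Y)"
  unfolding el_def norm_el_def by (rule norm_gb)

text \<open>The rotation scales the embeddings by the squares of the roots, and the product of the
  roots is 1.\<close>

lemma norm_el_cyc: "norm_el h Y ((b - 1) * h - X - Y) = norm_el h X Y"
proof -
  let ?d = "el h Y ((b - 1) * h - X - Y)"
  have "(of_int (norm_el h X Y) :: real) = (r1 * r2 * r3) ^ 2 * (emb r1 ?d * emb r2 ?d * emb r3 ?d)"
    unfolding emb_norm_el[symmetric] emb_el_cyc[of h X Y] by (simp add: power2_eq_square mult_ac)
  then show ?thesis unfolding e3 emb_norm_el by simp
qed

section \<open>Unimodular decomposition of a cone\<close>

text \<open>Family (v) is level 1. The ranges at X = -1 extend (vi) by (1 + rho + rho^2) / 3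
  (h = 2, Y = b - 1) and (ii) by the unit rho^2 (h = 3, Y = -2).\<close>

definition chain :: "int \<Rightarrow> int \<Rightarrow> int \<Rightarrow> int \<Rightarrow> bool" where
  "chain h X Y Z \<longleftrightarrow> X + Y + Z = (b - 1) * h \<and>
     (h = 1 \<and> X \<ge> 0 \<and> Y \<ge> 0 \<and> Z \<ge> 0 \<or> h = 2 \<and> X = - 1 \<and> b - 1 \<le> Y \<and> Y \<le> 2 * b - 1
      \<or> h = 3 \<and> X = - 1 \<and> - 2 \<le> Y \<and> Y \<le> b - 2)"

definition Gen :: "int \<Rightarrow> int \<Rightarrow> int \<Rightarrow> int \<Rightarrow> bool" where
  "Gen h X Y Z \<longleftrightarrow> chain h X Y Z \<or> chain h Y Z X \<or> chain h Z X Y"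

lemma Gen_cyc: "Gen h Y Z X \<longleftrightarrow> Gen h X Y Z" by (auto simp: Gen_def)

text \<open>The additive monoid generated by \<open>Gen\<close>. Z is determined by the other
  entries and is carried along so that conjugation becomes a plain rotation of the last three
  arguments.\<close>

inductive mon :: "int \<Rightarrow> int \<Rightarrow> int \<Rightarrow> int \<Rightarrow> bool" where
  mon_0: "mon 0 0 0 0"
| mon_step: "Gen h X Y Z \<Longrightarrow> mon h' X' Y' Z' \<Longrightarrow> mon (h + h') (X + X') (Y + Y') (Z + Z')"

lemma mon_cyc: "mon h Y Z X \<Longrightarrow> mon h X Y Z"
  by (induction h Y Z X rule: mon.induct) (auto intro: mon.intros simp: Gen_cyc[symmetric])

lemma mon_add: "mon h X Y Z \<Longrightarrow> mon h' X' Y' Z' \<Longrightarrow> mon (h + h') (X + X') (Y + Y') (Z + Z')"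
  by (induction h X Y Z rule: mon.induct) (auto intro: mon_step simp: add.assoc)

text \<open>The n-fold sumset of an interval of integers is the dilated interval, so a row of
  generators with fixed level and X fills the dilated row.\<close>

lemma mon_chain:
  assumes "\<And>j. lo \<le> j \<Longrightarrow> j \<le> hi \<Longrightarrow> Gen h X j (s - j)"
    and "n \<ge> 0" "n * lo \<le> Y" "Y \<le> n * hi"
  shows "mon (n * h) (n * X) Y (n * s - Y)"
  using assms(2-4)
proof (induction n arbitrary: Y rule: int_ge_induct)
  case base
  then show ?case using mon_0 by simp
next
  case (step n)
  \<comment> \<open>As large as possible while leaving at least lo for each of the other n
    summands.\<close>
  define j where "j = min hi (Y - n * lo)"
  have j: "lo \<le> j" "j \<le> hi" "n * lo \<le> Y - j" "Y - j \<le> n * hi"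
  proof -
    have "(n + 1) * (hi - lo) \<ge> 0" using step.prems by (simp add: algebra_simps)
    then have "hi \<ge> lo" using step.hyps by (simp add: zero_le_mult_iff)
    then have "n * lo \<le> n * hi" using step.hyps by (simp add: mult_left_mono)
    then show "lo \<le> j" "j \<le> hi" "n * lo \<le> Y - j" "Y - j \<le> n * hi"
      using step.prems \<open>hi \<ge> lo\<close> by (auto simp: j_def algebra_simps min_def)
  qed
  have "mon (h + n * h) (X + n * X) (j + (Y - j)) ((s - j) + (n * s - (Y - j)))"
    by (rule mon_step[OF assms(1)[OF j(1,2)] step.IH[OF j(3,4)]])
  then show ?case by (simp add: algebra_simps)
qed

lemma mon_multiple:
  assumes "Gen h X Y Z" "n \<ge> 0"
  shows "mon (n * h) (n * X) (n * Y) (n * Z)"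
  using mon_chain[of Y Y h X "Y + Z" n "n * Y"] assms by (simp add: algebra_simps)

text \<open>A lattice point of a dilated standard triangle is a sum of lattice points of the
  triangle: a summand of level 1 is taken off greedily.\<close>

lemma mon_nonneg:
  assumes "h \<ge> 0" "X + Y + Z = (b - 1) * h" "X \<ge> 0" "Y \<ge> 0" "Z \<ge> 0"
  shows "mon h X Y Z"
  using assms
proof (induction h arbitrary: X Y Z rule: int_ge_induct)
  case base
  then have "X = 0" "Y = 0" "Z = 0" by auto
  then show ?case using mon_0 by simp
next
  case (step h)
  define x y where "x = min X (b - 1)" and "y = min Y (b - 1 - x)"
  define z where "z = b - 1 - x - y"
  have "(b - 1) * h \<ge> 0" using step.hyps b_ge by simp
  moreover have "X + Y + Z = (b - 1) * h + (b - 1)" using step.prems by (simp add: algebra_simps)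
  ultimately have z: "0 \<le> x" "x \<le> X" "0 \<le> y" "y \<le> Y" "0 \<le> z" "z \<le> Z"
    using step.prems b_ge by (auto simp: x_def y_def z_def min_def)
  have "Gen 1 x y z" using z by (auto simp: Gen_def chain_def z_def)
  moreover have "mon h (X - x) (Y - y) (Z - z)"
    by (rule step.IH) (use z step.prems in \<open>auto simp: z_def algebra_simps\<close>)
  ultimately have "mon (1 + h) (x + (X - x)) (y + (Y - y)) (z + (Z - z))" by (rule mon_step)
  then show ?case by (simp add: add.commute)
qed

text \<open>The region between a facet of the cone and the opposite simplex of elements of level 1. With
  k = -X, the four cases are the triangles spanned by the point of level 1 in the corner,
  the last point of level 2 and the vertex; the vertex and points of level 2; points of level 1 and 2;
  and points of level 1, 2 and 3.\<close>

lemma mon_strip: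
  assumes sum: "X + Y + Z = (b - 1) * h" and h: "h \<ge> 0"
    and strip: "2 * X \<le> Y" "X \<le> 2 * Z" "X < 0"
    and T: "2 * h \<le> 3 * ((a + 2) * X + Y + (b + 2) * h)"
  shows "mon h X Y Z"
proof -
  define k where "k = - X"
  have k: "X = - k" "k > 0" using strip by (auto simp: k_def)
  have Z: "Z = b * h - h + k - Y" using sum k by (simp add: algebra_simps)
  have T': "3 * Y \<ge> 9 * (b * k) + 6 * k - 3 * (b * h) - 4 * h"
    using T unfolding k a_eq by (simp add: algebra_simps)
  have gB: "Gen 2 (- 1) j (2 * b - 1 - j)" if "b - 1 \<le> j" "j \<le> 2 * b - 1" for j
    using that by (auto simp: Gen_def chain_def)
  have gC: "Gen 3 (- 1) j (3 * b - 2 - j)" if "- 2 \<le> j" "j \<le> b - 2" for j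
    using that by (auto simp: Gen_def chain_def)
  have gA: "Gen 1 0 j (b - 1 - j)" if "0 \<le> j" "j \<le> b - 1" for j
    using that by (auto simp: Gen_def chain_def)
  have gV: "Gen 3 (- 2) (3 * b) (- 1)" using b_ge by (auto simp: Gen_def chain_def)
  \<comment> \<open>The vertex \<open>gV\<close> has k : h = 2 : 3, the largest ratio in this part
    of the cone.\<close>
  have nB: "2 * h - 3 * k \<ge> 0"
  proof -
    have "2 * Y \<le> 2 * (b * h) - 2 * h + 3 * k" using strip k Z by simp
    with T' have "(6 * b + 1) * (2 * h - 3 * k) \<ge> 0" by (simp add: algebra_simps)
    then show ?thesis using b_ge by (simp add: zero_le_mult_iff)
  qed
  consider (1) "Z \<le> 0" "Z \<le> h - 2 * k" | (2) "h < 2 * k" "Z > h - 2 * k"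
    | (3) "h \<ge> 2 * k" "Y \<ge> (b - 1) * k" "Z > 0" | (4) "h \<ge> 2 * k" "Y < (b - 1) * k"
    by linarith
  then show ?thesis
  proof cases
    case 1
    \<comment> \<open>Of the three generators only the vertex has a nonzero last entry, -1, so Z
      fixes its multiplicity; X and h then fix the other two.\<close>
    have "mon (- Z * 3) (- Z * - 2) (- Z * (3 * b)) (- Z * - 1)"
      by (rule mon_multiple[OF gV]) (use 1 in simp)
    moreover have "mon ((k + 2 * Z) * 2) ((k + 2 * Z) * - 1) ((k + 2 * Z) * (2 * b - 1)) ((k + 2 * Z) * (2 * b - 1 - (2 * b - 1)))"
      by (rule mon_multiple[OF gB]) (use strip k b_ge in auto)
    moreover have "mon ((h - 2 * k - Z) * 1) ((h - 2 * k - Z) * 0) ((h - 2 * k - Z) * (b - 1)) ((h - 2 * k - Z) * (b - 1 - (b - 1)))"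
      by (rule mon_multiple[OF gA]) (use 1 b_ge in auto)
    ultimately have "mon (- Z * 3 + ((k + 2 * Z) * 2 + (h - 2 * k - Z) * 1))
       (- Z * - 2 + ((k + 2 * Z) * - 1 + (h - 2 * k - Z) * 0))
       (- Z * (3 * b) + ((k + 2 * Z) * (2 * b - 1) + (h - 2 * k - Z) * (b - 1)))
       (- Z * - 1 + ((k + 2 * Z) * (2 * b - 1 - (2 * b - 1)) + (h - 2 * k - Z) * (b - 1 - (b - 1))))"
      by (intro mon_add)
    moreover have "- Z * (3 * b) + ((k + 2 * Z) * (2 * b - 1) + (h - 2 * k - Z) * (b - 1)) = Y"
      using sum k by (simp add: algebra_simps)
    ultimately show ?thesis by (simp add: k)
  next
    case 2
    \<comment> \<open>The multiplicities solve 3 V + 2 B = h and 2 V + B = k.\<close>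
    let ?V = "2 * k - h" and ?B = "2 * h - 3 * k"
    have "mon (?V * 3) (?V * - 2) (?V * (3 * b)) (?V * - 1)"
      by (rule mon_multiple[OF gV]) (use 2 in simp)
    moreover have "mon (?B * 2) (?B * - 1) (Y - ?V * (3 * b)) (?B * (2 * b - 1) - (Y - ?V * (3 * b)))"
    proof (rule mon_chain[OF gB nB])
      show "?B * (b - 1) \<le> Y - ?V * (3 * b)" using T' nB by (simp add: algebra_simps)
      show "Y - ?V * (3 * b) \<le> ?B * (2 * b - 1)" using 2 Z by (simp add: algebra_simps)
    qed auto
    ultimately have "mon (?V * 3 + ?B * 2) (?V * - 2 + ?B * - 1) (?V * (3 * b) + (Y - ?V * (3 * b)))
       (?V * - 1 + (?B * (2 * b - 1) - (Y - ?V * (3 * b))))" by (rule mon_add)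
    moreover have "?V * - 1 + (?B * (2 * b - 1) - (Y - ?V * (3 * b))) = Z" unfolding Z by (simp add: algebra_simps)
    ultimately show ?thesis by (simp add: k)
  next
    case 3
    let ?A = "h - 2 * k"
    \<comment> \<open>There are k points of level 2 and h - 2 k of level 1; the former take as much
      of Y as they can.\<close>
    define Y1 where "Y1 = min Y (k * (2 * b - 1))"
    have Y1: "k * (b - 1) \<le> Y1" "Y1 \<le> k * (2 * b - 1)" "0 \<le> Y - Y1" "Y - Y1 \<le> ?A * (b - 1)"
    proof -
      have "k * b \<ge> 0" using k b_ge by simp
      then have "k * (b - 1) \<le> k * (2 * b - 1)" using k by (simp add: algebra_simps)
      then show "k * (b - 1) \<le> Y1" "Y1 \<le> k * (2 * b - 1)" "0 \<le> Y - Y1"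
        using 3 by (auto simp: Y1_def min_def algebra_simps)
      have "?A * (b - 1) \<ge> 0" using 3 b_ge by simp
      then show "Y - Y1 \<le> ?A * (b - 1)"
        using 3 Z by (auto simp: Y1_def min_def algebra_simps)
    qed
    have "mon (k * 2) (k * - 1) Y1 (k * (2 * b - 1) - Y1)"
      by (rule mon_chain[OF gB]) (use k Y1 in auto)
    moreover have "mon (?A * 1) (?A * 0) (Y - Y1) (?A * (b - 1) - (Y - Y1))"
      by (rule mon_chain[OF gA]) (use 3 Y1 in auto)
    ultimately have "mon (k * 2 + ?A * 1) (k * - 1 + ?A * 0) (Y1 + (Y - Y1))
      (k * (2 * b - 1) - Y1 + (?A * (b - 1) - (Y - Y1)))" by (rule mon_add)
    moreover have "k * (2 * b - 1) - Y1 + (?A * (b - 1) - (Y - Y1)) = Z" unfolding Z by (simp add: algebra_simps)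
    ultimately show ?thesis by (simp add: k)
  next
    case 4
    \<comment> \<open>The number of points of level 2: the least n >= 0 for which the number h - 3 k
      + n of points of level 1 is nonnegative and the k - n points of level 3 stay within their
      upper bound b - 2 for Y.\<close>
    define n where "n = max 0 (max (3 * k - h) (Y - (b - 2) * k))"
    have n: "n \<ge> 0" "n \<ge> 3 * k - h" "n \<ge> Y - (b - 2) * k" by (auto simp: n_def)
    have nk: "n \<le> k" using 4 k by (auto simp: n_def algebra_simps)
    have low: "(b + 1) * n \<le> Y + 2 * k"
    proof -
      consider "n = 0" | "n = 3 * k - h" "n \<ge> 0" | "n = Y - (b - 2) * k" using n_def by linarith
      then show ?thesis
      proof cases
        case 1 then show ?thesis using strip k by simp
      next
        case 2
        show ?thesis unfolding 2(1) using 2 T' by (simp add: algebra_simps)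
      next
        case 3
        have "b * Y \<le> b * ((b - 1) * k)" using 4 b_ge by (intro mult_left_mono) auto
        then show ?thesis unfolding 3 by (simp add: algebra_simps)
      qed
    qed
    have "mon ((k - n) * 3) ((k - n) * - 1) (Y - n * (b - 1)) ((k - n) * (3 * b - 2) - (Y - n * (b - 1)))"
    proof (rule mon_chain[OF gC])
      show "(k - n) * - 2 \<le> Y - n * (b - 1)" using low by (simp add: algebra_simps)
      show "Y - n * (b - 1) \<le> (k - n) * (b - 2)" using n(3) by (simp add: algebra_simps)
    qed (use nk in auto)
    moreover have "mon (n * 2) (n * - 1) (n * (b - 1)) (n * (2 * b - 1 - (b - 1)))"
      by (rule mon_multiple[OF gB]) (use n b_ge in auto)
    moreover have "mon ((h - 3 * k + n) * 1) ((h - 3 * k + n) * 0) ((h - 3 * k + n) * 0) ((h - 3 * k + n) * (b - 1 - 0))"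
      by (rule mon_multiple[OF gA]) (use n b_ge in auto)
    ultimately have "mon ((k - n) * 3 + (n * 2 + (h - 3 * k + n) * 1)) ((k - n) * - 1 + (n * - 1 + (h - 3 * k + n) * 0))
      (Y - n * (b - 1) + (n * (b - 1) + (h - 3 * k + n) * 0))
      ((k - n) * (3 * b - 2) - (Y - n * (b - 1)) + (n * (2 * b - 1 - (b - 1)) + (h - 3 * k + n) * (b - 1 - 0)))"
      by (intro mon_add)
    moreover have "(k - n) * (3 * b - 2) - (Y - n * (b - 1)) + (n * (2 * b - 1 - (b - 1)) + (h - 3 * k + n) * (b - 1 - 0)) = Z"
      unfolding Z by (simp add: algebra_simps)
    ultimately show ?thesis by (simp add: k)
  qed
qed

text \<open>The planes X = 2 Z and 2 X = Y join vertices of the cone to corners of the level 1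
  triangle. With their rotations they divide what lies outside the cone over this triangle into
  three strips, one for each facet.\<close>

lemma mon_cone:
  assumes sum: "X + Y + Z = (b - 1) * h" and h: "h \<ge> 1"
    and T: "2 * h \<le> 3 * ((a + 2) * X + Y + (b + 2) * h)" "2 * h \<le> 3 * ((a + 2) * Y + Z + (b + 2) * h)"
      "2 * h \<le> 3 * ((a + 2) * Z + X + (b + 2) * h)"
  shows "mon h X Y Z"
proof -
  have "(b - 1) * h > 0" using h b_ge by simp
  then have "X + Y + Z > 0" using sum by simp
  then consider "X \<ge> 0" "Y \<ge> 0" "Z \<ge> 0" | "2 * X \<le> Y" "X \<le> 2 * Z" "X < 0"
    | "2 * Y \<le> Z" "Y \<le> 2 * X" "Y < 0" | "2 * Z \<le> X" "Z \<le> 2 * Y" "Z < 0" by linarith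
  then show ?thesis
  proof cases
    case 1
    then show ?thesis using mon_nonneg sum h by simp
  next
    case 2
    then show ?thesis using mon_strip[OF sum] h T by simp
  next
    case 3
    have "mon h Y Z X" using mon_strip[of Y Z X h] 3 sum h T by simp
    then show ?thesis by (rule mon_cyc)
  next
    case 4
    have "mon h Z X Y" using mon_strip[of Z X Y h] 4 sum h T by simp
    then show ?thesis by (rule mon_cyc[OF mon_cyc])
  qed
qed

end

section \<open>Totally positive units and the fundamental domain\<close>

text \<open>Field elements are triples; simp would otherwise split quantifiers over them into
  coordinates.\<close>

declare split_paired_All [simp del] split_paired_Ex [simp del]

lemma mulK_addK: "mulK a e (addK x y) = addK (mulK a e x) (mulK a e y)"
  by (auto simp: mulK_def addK_def algebra_simps split: prod.splits)

context simplest_cubic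
begin

lemma OK_mulK: "OK a x \<Longrightarrow> OK a y \<Longrightarrow> OK a (mulK a x y)"
  by (simp add: OK_iff_algebraic_int emb_mulK algebraic_int_times)

lemma totpos_mulK: "totpos a x \<Longrightarrow> totpos a y \<Longrightarrow> totpos a (mulK a x y)"
  by (simp add: totpos_def emb_mulK)

lemma totpos_addK: "totpos a x \<Longrightarrow> totpos a y \<Longrightarrow> totpos a (addK x y)"
  by (simp add: totpos_def emb_addK add_pos_pos)

lemma tp_unitI:
  assumes "OK a e" "OK a e'" "mulK a e e' = gb 1 0 0" "totpos a e"
  shows "tp_unit a e" "tp_unit a e'"
proof -
  have p: "emb r e * emb r e' = 1" if "r \<in> roots a" for r
    using emb_mulK[OF that, of e e'] assms(3) by (simp add: emb_1)
  then show "tp_unit a e" using assms by (auto simp: tp_unit_def unitK_def)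
  have "emb r e' > 0" if "r \<in> roots a" for r
  proof -
    have "emb r e > 0" using assms(4) that by (simp add: totpos_def)
    moreover have "0 < emb r e * emb r e'" using p[OF that] by simp
    ultimately show ?thesis by (simp add: zero_less_mult_iff)
  qed
  then show "tp_unit a e'" using p assms by (auto simp: tp_unit_def unitK_def totpos_def mult.commute)
qed

lemma tp_unit_inverse:
  assumes "tp_unit a e"
  obtains e' where "tp_unit a e'" "\<And>r. r \<in> roots a \<Longrightarrow> emb r e * emb r e' = 1"
proof -
  obtain h where h: "OK a h" "\<forall>r\<in>roots a. emb r e * emb r h = 1"
    using assms by (auto simp: tp_unit_def unitK_def)
  have "mulK a e h = gb 1 0 0" by (rule emb_inj) (simp add: emb_mulK h(2) emb_1)
  then have "tp_unit a h" using tp_unitI(2)[of e h] h(1) assms by (simp add: tp_unit_def unitK_def)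
  then show ?thesis using that h(2) by blast
qed

lemma tp_unit_mulK:
  assumes "tp_unit a e" "tp_unit a f"
  shows "tp_unit a (mulK a e f)"
proof -
  obtain e' f' where i: "tp_unit a e'" "\<And>r. r \<in> roots a \<Longrightarrow> emb r e * emb r e' = 1"
    "tp_unit a f'" "\<And>r. r \<in> roots a \<Longrightarrow> emb r f * emb r f' = 1"
    using tp_unit_inverse[OF assms(1)] tp_unit_inverse[OF assms(2)] by metis
  have "mulK a (mulK a e f) (mulK a e' f') = gb 1 0 0"
  proof (rule emb_inj, rule ballI)
    fix r assume r: "r \<in> roots a"
    have "emb r (mulK a (mulK a e f) (mulK a e' f')) = (emb r e * emb r e') * (emb r f * emb r f')"
      by (simp add: emb_mulK[OF r])
    then show "emb r (mulK a (mulK a e f) (mulK a e' f')) = emb r (gb 1 0 0)"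
      using i(2,4)[OF r] by (simp add: emb_1)
  qed
  moreover have "OK a (mulK a e f)" "OK a (mulK a e' f')" "totpos a (mulK a e f)"
    using assms i(1,3) by (auto simp: tp_unit_def unitK_def intro: OK_mulK totpos_mulK)
  ultimately show ?thesis by (intro tp_unitI(1))
qed

lemma tp_unit_1: "tp_unit a (gb 1 0 0)"
  by (rule tp_unitI(1)[of _ "gb 1 0 0"]) (auto simp: OK_gb totpos_def emb_1 intro!: emb_inj simp: emb_mulK)

lemma tp_assoc_iff: "tp_assoc a c d \<longleftrightarrow> (\<exists>e. tp_unit a e \<and> c = mulK a e d)"
  unfolding tp_assoc_def by (metis emb_inj emb_mulK)

lemma tp_assoc_refl: "tp_assoc a c c"
  unfolding tp_assoc_def using tp_unit_1 by (auto simp: emb_1 intro!: exI[of _ "gb 1 0 0"])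

lemma tp_assoc_sym:
  assumes "tp_assoc a c d"
  shows "tp_assoc a d c"
proof -
  obtain e where e: "tp_unit a e" "\<forall>r\<in>roots a. emb r c = emb r e * emb r d"
    using assms by (auto simp: tp_assoc_def)
  obtain e' where "tp_unit a e'" "\<And>r. r \<in> roots a \<Longrightarrow> emb r e * emb r e' = 1"
    using tp_unit_inverse[OF e(1)] by metis
  then show ?thesis unfolding tp_assoc_def using e(2)
    by (intro exI[of _ e']) (auto, metis mult.commute mult.left_commute mult_1)
qed

lemma tp_assoc_trans:
  assumes "tp_assoc a c d" "tp_assoc a d g"
  shows "tp_assoc a c g"
proof -
  obtain e f where "tp_unit a e" "\<forall>r\<in>roots a. emb r c = emb r e * emb r d"
    "tp_unit a f" "\<forall>r\<in>roots a. emb r d = emb r f * emb r g"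
    using assms unfolding tp_assoc_def by metis
  then show ?thesis unfolding tp_assoc_def
    by (intro exI[of _ "mulK a e f"]) (auto simp: tp_unit_mulK emb_mulK)
qed

lemma tp_assoc_OK_totpos:
  assumes "tp_assoc a c d" "OK a d" "totpos a d"
  shows "OK a c" "totpos a c"
  using assms unfolding tp_assoc_iff tp_unit_def unitK_def by (auto intro: OK_mulK totpos_mulK)

lemma indecD:
  assumes "indec a (addK x y)" "OK a x" "OK a y" "totpos a x" "totpos a y"
  shows False
  using assms by (auto simp: indec_def)

lemma indec_assoc:
  assumes "tp_assoc a c d" "indec a d"
  shows "indec a c"
proof -
  obtain e where e: "tp_unit a e" "d = mulK a e c"
    using tp_assoc_sym[OF assms(1)] by (auto simp: tp_assoc_iff)
  have "OK a c" "totpos a c" using tp_assoc_OK_totpos[OF assms(1)] assms(2) by (auto simp: indec_def)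
  moreover have False if "OK a x" "OK a y" "totpos a x" "totpos a y" "c = addK x y" for x y
    using indecD[of "mulK a e x" "mulK a e y"] that assms(2) e
    by (auto simp: mulK_addK tp_unit_def unitK_def intro: OK_mulK totpos_mulK)
  ultimately show ?thesis unfolding indec_def by blast
qed

lemma emb_gb_square: "emb r (gb (- 1) (- 1) 3) = r ^ 2" and emb_gen2: "emb r (gen2 a) = (1 + r) ^ 2"
  by (simp_all add: emb_gb gen2_def power2_eq_square algebra_simps)

lemma root_nz: "r \<in> roots a \<Longrightarrow> r \<noteq> 0 \<and> 1 + r \<noteq> 0"
  using r1_pos r2_bounds r3_bounds by (auto simp: roots_eq)

lemma tp_unit_gens: "tp_unit a (gen1 a)" "tp_unit a (gen1_inv a)" "tp_unit a (gen2 a)" "tp_unit a (gen2_inv a)"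
proof -
  have "totpos a (gen2 a)" unfolding totpos_def emb_gen2 using root_nz by auto
  moreover have "totpos a (gen1 a)"
    unfolding totpos_def
  proof
    fix r assume r: "r \<in> roots a"
    have "emb r (gen1 a) * r ^ 2 = (1 + r) ^ 2"
      using emb_mulK[OF r, of "gen1 a" "gb (- 1) (- 1) 3"]
      unfolding mulK_gen(3) emb_gb_square emb_gen2 by simp
    moreover have "(1 + r) ^ 2 > 0" "r ^ 2 > 0" using root_nz[OF r] by auto
    ultimately show "emb r (gen1 a) > 0" by (metis zero_less_mult_pos2)
  qed
  moreover have "OK a (gen1 a)" "OK a (gen1_inv a)" "OK a (gen2 a)" "OK a (gen2_inv a)"
    by (simp_all add: gen1_def gen1_inv_def gen2_def gen2_inv_def OK_gb)
  ultimately show "tp_unit a (gen1 a)" "tp_unit a (gen1_inv a)" "tp_unit a (gen2 a)" "tp_unit a (gen2_inv a)"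
    using tp_unitI[OF _ _ mulK_gen(1)[of a]] tp_unitI[OF _ _ mulK_gen(2)[of a]] by auto
qed

lemma tp_unit_square: "tp_unit a (gb (- 1) (- 1) 3)"
proof -
  have "gb (- 1) (- 1) 3 = mulK a (gen1_inv a) (gen2 a)"
    unfolding gen_triple gb_triple mulK_def by (simp add: power2_eq_square algebra_simps)
  then show ?thesis using tp_unit_mulK tp_unit_gens by simp
qed

lemma tp_unit_assoc_1: "tp_unit a e \<Longrightarrow> tp_assoc a e (gb 1 0 0)"
  by (auto simp: tp_assoc_def emb_1)

lemma el_vertices:
  "gb 1 0 0 = el 3 (- 2) (3 * b)" "gb (- 1) (- 1) 3 = el 3 (- 1) (- 2)" "gen1_inv a = el 3 (3 * b) (- 1)"
  "gb 0 0 1 = el 2 (- 1) (b - 1)"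
  unfolding el_def gen1_inv_def gb_inj by (simp_all add: a_eq power2_eq_square algebra_simps)

text \<open>The rotations of (1 + rho + rho^2) / 3 are associated to it. Hence the rows of level 2
  in \<open>listed_chain\<close> start at b, not at b - 1.\<close>

lemma el_g3_assoc:
  "el 2 b (- 1) = mulK a (gen1_inv a) (gb 0 0 1)" "el 2 (b - 1) b = mulK a (gen2_inv a) (gb 0 0 1)"
  unfolding gen_triple el_def gb_def mulK_def
  by (simp_all add: a_eq power2_eq_square field_simps)

text \<open>Barycentric coordinates in the second cone, up to a common factor. Each coefficient
  compares the functional of an adjacent cone with h; the two agree on the common facet, so the
  coefficient vanishes at two of the generators.\<close>

lemma cone_combination:
  fixes h X Y :: int
  defines "Z \<equiv> (b - 1) * h - X - Y"
  shows "3 * (of_int a ^ 2 + 3 * of_int a + 3) * emb r (el h X Y)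
    = of_int (3 * ((a + 2) * Y + Z + (b + 2) * h) - 2 * h) * emb r (gb 1 0 0)
     + of_int (3 * ((a + 2) * Z + X + (b + 2) * h) - 2 * h) * emb r (gb (- 1) (- 1) 3)
     + of_int (3 * ((a + 2) * X + Y + (b + 2) * h) - 2 * h) * emb r (gen1_inv a)"
  unfolding Z_def gen1_inv_def el_def emb_gb by (simp add: a_eq power2_eq_square field_simps)

lemma totpos_cone:
  assumes "X + Y + Z = (b - 1) * h" "h \<ge> 1" "2 * h \<le> 3 * ((a + 2) * X + Y + (b + 2) * h)"
    "2 * h \<le> 3 * ((a + 2) * Y + Z + (b + 2) * h)" "2 * h \<le> 3 * ((a + 2) * Z + X + (b + 2) * h)"
  shows "totpos a (el h X Y)"
  unfolding totpos_def
proof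
  fix r assume r: "r \<in> roots a"
  define A B C where d: "A = 3 * ((a + 2) * Y + Z + (b + 2) * h) - 2 * h"
    "B = 3 * ((a + 2) * Z + X + (b + 2) * h) - 2 * h" "C = 3 * ((a + 2) * X + Y + (b + 2) * h) - 2 * h"
  have nn: "A \<ge> 0" "B \<ge> 0" "C \<ge> 0" using assms by (auto simp: d)
  have Z: "Z = (b - 1) * h - X - Y" using assms(1) by simp
  have "A + B + C = (a ^ 2 + 3 * a + 3) * h"
    unfolding d Z by (simp add: a_eq power2_eq_square algebra_simps)
  moreover have N: "a ^ 2 + 3 * a + 3 > 0" using a_eq b_ge by (smt (verit) zero_le_power2)
  ultimately have "A + B + C > 0" using assms(2) by simp
  then have "A > 0 \<or> B > 0 \<or> C > 0" using nn by linarith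
  moreover have "emb r (gb 1 0 0) > 0" "emb r (gb (- 1) (- 1) 3) > 0" "emb r (gen1_inv a) > 0"
    using tp_unit_1 tp_unit_square tp_unit_gens r by (auto simp: tp_unit_def totpos_def)
  ultimately have "of_int A * emb r (gb 1 0 0) + of_int B * emb r (gb (- 1) (- 1) 3)
      + of_int C * emb r (gen1_inv a) > 0"
    using nn by (auto simp: add_pos_nonneg add_nonneg_pos)
  then have "3 * (of_int a ^ 2 + 3 * of_int a + 3) * emb r (el h X Y) > 0"
    unfolding d Z cone_combination .
  moreover have "3 * ((of_int a :: real) ^ 2 + 3 * of_int a + 3) > 0"
    using a_eq b_ge by (simp add: add_pos_pos)
  ultimately show "emb r (el h X Y) > 0" by (metis zero_less_mult_pos)
qed

lemma totpos_g3: "totpos a (gb 0 0 1)"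
proof -
  have "1 + r + r ^ 2 > 0" for r :: real
  proof -
    have "1 + r + r ^ 2 = (r + 1 / 2) ^ 2 + 3 / 4" by (simp add: power2_eq_square algebra_simps)
    then show ?thesis by (simp add: add_nonneg_pos)
  qed
  then show ?thesis by (simp add: totpos_def emb_gb)
qed

lemma totpos_chain:
  assumes "chain h X Y Z"
  shows "totpos a (el h X Y)"
\<comment> \<open>The element (1 + rho + rho^2) / 3 has h = 2 and T = 1, so 3 T < 2 h: it lies
  outside the second cone and is treated apart.\<close>
proof (cases "h = 2 \<and> X = - 1 \<and> Y = b - 1")
  case True
  then show ?thesis using totpos_g3 el_vertices(4) by simp
next
  case False
  have ab: "a * X = 3 * (b * X)" "a * Y = 3 * (b * Y)" "a * Z = 3 * (b * Z)" by (simp_all add: a_eq)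
  have sum: "X + Y + Z = (b - 1) * h" using assms by (simp add: chain_def)
  consider "h = 1" "X \<ge> 0" "Y \<ge> 0" "Z \<ge> 0" | "h = 2" "X = - 1" "b \<le> Y" "Y \<le> 2 * b - 1"
    | "h = 3" "X = - 1" "- 2 \<le> Y" "Y \<le> b - 2"
    using assms False by (fastforce simp: chain_def)
  then show ?thesis
  proof cases
    case 1
    have "a * X \<ge> 0" "a * Y \<ge> 0" "a * Z \<ge> 0" using 1 a_eq b_ge by simp_all
    then show ?thesis using 1 b_ge by (intro totpos_cone[OF sum]) (simp_all add: algebra_simps)
  next
    case 2
    have Z: "Z = 2 * b - 1 - Y" using sum 2 by simp
    have "b * Y \<ge> 7 * Y" using 2 b_ge by (intro mult_right_mono) auto
    moreover have "b * (2 * b - 1 - Y) \<ge> 0" using 2 b_ge by (intro mult_nonneg_nonneg) auto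
    ultimately show ?thesis using 2 b_ge
      by (intro totpos_cone[OF sum]) (simp_all add: Z a_eq algebra_simps)
  next
    case 3
    have Z: "Z = 3 * b - 2 - Y" using sum 3 by simp
    have "b * (Y + 2) \<ge> 0" using 3 b_ge by (intro mult_nonneg_nonneg) auto
    moreover have "b * (b - 2 - Y) \<ge> 0" using 3 b_ge by (intro mult_nonneg_nonneg) auto
    moreover have "b * b \<ge> 0" by simp
    ultimately show ?thesis using 3 b_ge
      by (intro totpos_cone[OF sum]) (simp_all add: Z a_eq algebra_simps)
  qed
qed

lemma totpos_Gen:
  assumes "Gen h X Y Z"
  shows "totpos a (el h X Y)"
proof -
  have c: "totpos a (el h X Y)" if "totpos a (el h Y Z)" "X + Y + Z = (b - 1) * h" for X Y Z
  proof -
    have "Z = (b - 1) * h - X - Y" using that(2) by simp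
    then show ?thesis using that(1) totpos_cyc by simp
  qed
  from assms consider "chain h X Y Z" | "chain h Y Z X" | "chain h Z X Y" by (auto simp: Gen_def)
  then show ?thesis
  proof cases
    case 1
    then show ?thesis by (rule totpos_chain)
  next
    case 2
    then show ?thesis by (intro c[of Y Z]) (auto simp: totpos_chain chain_def)
  next
    case 3
    then have "totpos a (el h Y Z)" by (intro c[of Z X]) (auto simp: totpos_chain chain_def)
    then show ?thesis by (rule c) (use 3 in \<open>auto simp: chain_def\<close>)
  qed
qed

lemma mon_totpos:
  assumes "mon h X Y Z"
  shows "h = 0 \<and> X = 0 \<and> Y = 0 \<and> Z = 0 \<or> totpos a (el h X Y)"
  using assms
proof induction
  case (mon_step h X Y Z h' X' Y' Z')
  note G = totpos_Gen[OF mon_step.hyps(1)]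
  from mon_step.IH show ?case
  proof
    assume "totpos a (el h' X' Y')"
    then show ?thesis using totpos_addK[OF G] by (simp add: el_add)
  qed (use G in simp)
qed simp

lemma not_totpos_0: "\<not> totpos a (el 0 0 0)"
  using r_in by (auto simp: totpos_def el_def emb_gb)

text \<open>Generators are totally positive, so a sum of two or more of them is
  decomposable.\<close>

lemma indec_mon_imp_Gen:
  assumes "mon h X Y Z" "indec a (el h X Y)"
  shows "Gen h X Y Z"
  using assms(1)
proof cases
  case mon_0
  then show ?thesis using assms(2) not_totpos_0 by (auto simp: indec_def)
next
  case (mon_step h1 X1 Y1 Z1 h2 X2 Y2 Z2)
  have "\<not> totpos a (el h2 X2 Y2)"
    using indecD[of "el h1 X1 Y1" "el h2 X2 Y2"] assms(2) OK_el totpos_Gen[OF mon_step(5)]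
    by (auto simp: mon_step el_add)
  then show ?thesis using mon_totpos[OF mon_step(6)] mon_step by auto
qed

text \<open>Subtracting u leaves a nonnegative integer combination, which is totally positive unless
  all its coefficients vanish.\<close>

lemma indec_first:
  fixes p q s :: int
  assumes ind: "indec a c" and c: "\<And>r. emb r c = of_int p * emb r u + of_int q * emb r v + of_int s * emb r w"
    and p: "p > 0" "q \<ge> 0" "s \<ge> 0" and OK: "OK a u" "OK a v" "OK a w"
    and tp: "totpos a u" "totpos a v" "totpos a w"
  shows "c = u"
proof (cases "p = 1 \<and> q = 0 \<and> s = 0")
  case True
  then show ?thesis by (intro emb_inj) (simp add: c)
next
  case False
  obtain cx cy cz where cg: "c = gb cx cy cz" using ind OK_imp_gb unfolding indec_def by metis
  obtain ux uy uz where ug: "u = gb ux uy uz" using OK OK_imp_gb by blast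
  define d where "d = gb (cx - ux) (cy - uy) (cz - uz)"
  have cd: "c = addK u d" using gb_add[of ux "cx - ux" uy "cy - uy" uz "cz - uz"] by (simp add: cg ug d_def)
  have "totpos a d"
    unfolding totpos_def
  proof
    fix r assume r: "r \<in> roots a"
    have "emb r d = of_int (p - 1) * emb r u + of_int q * emb r v + of_int s * emb r w"
      using c[of r] unfolding cd emb_addK by (simp add: algebra_simps)
    moreover have "emb r u > 0" "emb r v > 0" "emb r w > 0" using tp r by (auto simp: totpos_def)
    moreover have "p - 1 > 0 \<or> q > 0 \<or> s > 0" using False p by linarith
    ultimately show "emb r d > 0" using p
      by (elim disjE) (auto simp: add_pos_nonneg add_nonneg_pos add_nonneg_nonneg)
  qed
  then have False using indecD[of u d] ind OK(1) tp(1) by (simp add: cd[symmetric]) (simp add: d_def OK_gb)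
  then show ?thesis ..
qed

lemma indec_combination:
  fixes p q s :: int
  assumes ind: "indec a c" and c: "\<And>r. emb r c = of_int p * emb r u + of_int q * emb r v + of_int s * emb r w"
    and p: "p \<ge> 0" "q \<ge> 0" "s \<ge> 0" and OK: "OK a u" "OK a v" "OK a w"
    and tp: "totpos a u" "totpos a v" "totpos a w"
  shows "c = u \<or> c = v \<or> c = w"
proof -
  consider "p > 0" | "q > 0" | "s > 0" | "p = 0" "q = 0" "s = 0" using p by linarith
  then show ?thesis
  proof cases
    case 1
    then show ?thesis using indec_first[OF ind c] p OK tp by blast
  next
    case 2
    have "c = v" by (rule indec_first[OF ind, of q v p u s w]) (use 2 c p OK tp in auto)
    then show ?thesis by simp
  next
    case 3
    have "c = w" by (rule indec_first[OF ind, of s w p u q v]) (use 3 c p OK tp in auto)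
    then show ?thesis by simp
  next
    case 4
    then have "emb r1 c = 0" using c by simp
    then show ?thesis using ind r_in by (auto simp: indec_def totpos_def)
  qed
qed

text \<open>\<open>gen1\<close> and \<open>gen2\<close> carry two of the cones adjacent to the
  second cone to the first one; the resulting functionals are the rotations of T, as in
  \<open>cone_combination\<close>.\<close>

lemma TK_gens:
  fixes h X Y :: int
  defines "Z \<equiv> (b - 1) * h - X - Y"
  shows "TK (el h X Y) = of_int ((a + 2) * X + Y + (b + 2) * h)" "hK (el h X Y) = of_int h"
    "TK (mulK a (gen1 a) (el h X Y)) = of_int ((a + 2) * Y + Z + (b + 2) * h)"
    "TK (mulK a (gen2 a) (el h X Y)) = of_int ((a + 2) * Z + X + (b + 2) * h)"
  unfolding gen_triple el_def gb_def mulK_def TK_def hK_def Z_def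
  by (simp_all add: a_eq power2_eq_square field_simps)

text \<open>The differences between 2 h, over the three cones adjacent to the first one, and 3 T are
  six times the barycentric coordinates with respect to rho^2, 1 and (1 + rho)^2.\<close>

lemma hK_gens:
  "2 * hK (mulK a (gen1_inv a) (gb x y z)) = 3 * TK (gb x y z) + of_int (z - 3 * y)"
  "2 * hK (mulK a (gen2_inv a) (gb x y z)) = 3 * TK (gb x y z) + of_int (6 * x - 3 * y + z)"
  "2 * hK (gb x y z) = 3 * TK (gb x y z) + of_int (3 * y + z)"
  unfolding gen_triple gb_def mulK_def TK_def hK_def
  by (simp_all add: a_eq power2_eq_square field_simps)

lemma hK_TK_pos:
  assumes "OK a c" "totpos a c"
  obtains h t where "hK c = of_int h" "TK c = of_int t" "h \<ge> 1" "t \<ge> 1"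
proof -
  obtain h X Y where c: "c = el h X Y" using OK_imp_el[OF assms(1)] .
  show ?thesis using that[of h "(a + 2) * X + Y + (b + 2) * h"] totpos_el_imp(1,5)[OF _ refl, of h X Y] assms(2)
    by (simp only: c TK_gens)
qed

text \<open>Each of the two simplicial cones of a fundamental domain for the totally positive units has
  an associated functional, hK / 3 or TK / 2, equal to 1 on its generators. Where the smallest value
  over a whole orbit is attained, comparison with the functionals of the three adjacent cones says
  that all barycentric coordinates are nonnegative.\<close>

lemma orbit_minimum:
  assumes "OK a c" "totpos a c"
  obtains d where "tp_assoc a d c"
    "\<And>e. tp_unit a e \<Longrightarrow> min (2 * hK d) (3 * TK d) \<le> min (2 * hK (mulK a e d)) (3 * TK (mulK a e d))"
proof -
  \<comment> \<open>On totally positive integers both functionals are positive integers, so the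
    floor is exact and a least value exists.\<close>
  define M where "M d = nat \<lfloor>min (2 * hK d) (3 * TK d)\<rfloor>" for d
  obtain d where d: "tp_assoc a d c" "\<forall>d'. tp_assoc a d' c \<longrightarrow> M d \<le> M d'"
    using ex_has_least_nat[of "\<lambda>d. tp_assoc a d c" c M] tp_assoc_refl by blast
  have M: "min (2 * hK d) (3 * TK d) = of_nat (M d)" if "tp_assoc a d c" for d
  proof -
    have "OK a d" "totpos a d" using tp_assoc_OK_totpos[OF that] assms by auto
    then obtain h t where "hK d = of_int h" "TK d = of_int t" "h \<ge> 1" "t \<ge> 1"
      using hK_TK_pos by blast
    then have "min (2 * hK d) (3 * TK d) = of_int (min (2 * h) (3 * t))" "min (2 * h) (3 * t) \<ge> 0"
      by (auto simp: min_def)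
    then show ?thesis unfolding M_def by simp
  qed
  show ?thesis
  proof (rule that[OF d(1)])
    fix e assume "tp_unit a e"
    then have "tp_assoc a (mulK a e d) c" using tp_assoc_trans d(1) tp_assoc_iff by blast
    then show "min (2 * hK d) (3 * TK d) \<le> min (2 * hK (mulK a e d)) (3 * TK (mulK a e d))"
      using M[OF d(1)] M[of "mulK a e d"] d(2) by simp
  qed
qed

lemma emb_gb_g3: "emb r (gb x y z) = of_int x + of_int y * r + of_int z * emb r (gb 0 0 1)"
  by (simp add: emb_gb)

lemma indec_imp_assoc_Gen:
  assumes "indec a c"
  shows "tp_assoc a c (gb 1 0 0) \<or> (\<exists>h X Y Z. Gen h X Y Z \<and> tp_assoc a c (el h X Y))"
proof -
  have c: "OK a c" "totpos a c" using assms by (auto simp: indec_def)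
  obtain d where d: "tp_assoc a d c"
    and le: "\<And>e. tp_unit a e \<Longrightarrow> min (2 * hK d) (3 * TK d) \<le> min (2 * hK (mulK a e d)) (3 * TK (mulK a e d))"
    using orbit_minimum[OF c] by blast
  have ind: "indec a d" using indec_assoc[OF d assms] .
  have cd: "tp_assoc a c d" using tp_assoc_sym[OF d] .
  have dd: "OK a d" "totpos a d" using ind by (auto simp: indec_def)
  show ?thesis
  proof (cases "2 * hK d \<le> 3 * TK d")
    case True
    obtain h X Y where e: "d = el h X Y" using OK_imp_el[OF dd(1)] .
    define Z where "Z = (b - 1) * h - X - Y"
    have t: "2 * hK d \<le> 3 * TK (mulK a (gen1 a) d)" "2 * hK d \<le> 3 * TK (mulK a (gen2 a) d)"
      using le[OF tp_unit_gens(1)] le[OF tp_unit_gens(3)] True by auto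
    have "(of_int (2 * h) :: rat) \<le> of_int (3 * ((a + 2) * X + Y + (b + 2) * h))"
      "(of_int (2 * h) :: rat) \<le> of_int (3 * ((a + 2) * Y + Z + (b + 2) * h))"
      "(of_int (2 * h) :: rat) \<le> of_int (3 * ((a + 2) * Z + X + (b + 2) * h))"
      using True t unfolding e TK_gens Z_def[symmetric] by simp_all
    then have "mon h X Y Z"
      unfolding of_int_le_iff
      using totpos_el_imp(1)[OF _ refl, of h X Y] dd(2) by (intro mon_cone) (auto simp: e Z_def)
    then have "Gen h X Y Z" using indec_mon_imp_Gen ind by (simp add: e)
    then show ?thesis using cd e by blast
  next
    case False
    obtain x y z where e: "d = gb x y z" using OK_imp_gb[OF dd(1)] .
    have t: "3 * TK d \<le> 2 * hK (mulK a (gen1_inv a) d)" "3 * TK d \<le> 2 * hK (mulK a (gen2_inv a) d)"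
      using le[OF tp_unit_gens(2)] le[OF tp_unit_gens(4)] False by auto
    have nn: "0 \<le> 3 * y + z" "0 \<le> z - 3 * y" "0 \<le> 6 * x - 3 * y + z"
    proof -
      have "(of_int 0 :: rat) \<le> of_int (3 * y + z)" "(of_int 0 :: rat) \<le> of_int (z - 3 * y)"
        "(of_int 0 :: rat) \<le> of_int (6 * x - 3 * y + z)"
        using False t unfolding e hK_gens by simp_all
      then show "0 \<le> 3 * y + z" "0 \<le> z - 3 * y" "0 \<le> 6 * x - 3 * y + z" by (simp_all only: of_int_le_iff)
    qed
    have units: "OK a (gb 1 0 0)" "OK a (gb (- 1) (- 1) 3)" "OK a (gen2 a)" "OK a (gb 0 0 1)"
      "totpos a (gb 1 0 0)" "totpos a (gb (- 1) (- 1) 3)" "totpos a (gen2 a)" "totpos a (gb 0 0 1)"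
      using tp_unit_1 tp_unit_square tp_unit_gens(3) OK_gb totpos_g3 by (auto simp: tp_unit_def unitK_def)
    \<comment> \<open>(1 + rho + rho^2) / 3 is a sixth of the sum of the three generators. The cases
      say which barycentric coordinate is smallest; d is then a combination of this element and the
      other two generators.\<close>
    consider "0 \<le> x - y" "0 \<le> - y" | "0 \<le> x" "0 \<le> y" | "0 \<le> - x" "0 \<le> y - x" by linarith
    then have "d = gb 0 0 1 \<or> d = gb 1 0 0 \<or> d = gb (- 1) (- 1) 3 \<or> d = gen2 a"
    proof cases
      case 1
      have "d = gb 0 0 1 \<or> d = gb 1 0 0 \<or> d = gb (- 1) (- 1) 3"
        by (rule indec_combination[OF ind, of "3 * y + z" _ "x - y" _ "- y"])
          (use 1 nn units in \<open>auto simp: e emb_1 emb_gb_g3[of _ x y z] emb_gb_g3[of _ "- 1" "- 1" 3] algebra_simps\<close>)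
      then show ?thesis by blast
    next
      case 2
      have "d = gb 0 0 1 \<or> d = gb 1 0 0 \<or> d = gen2 a"
        by (rule indec_combination[OF ind, of "z - 3 * y" _ x _ y])
          (use 2 nn units in \<open>auto simp: e gen2_def emb_1 emb_gb_g3[of _ x y z] emb_gb_g3[of _ 0 1 3] algebra_simps\<close>)
      then show ?thesis by blast
    next
      case 3
      have "d = gb 0 0 1 \<or> d = gb (- 1) (- 1) 3 \<or> d = gen2 a"
        by (rule indec_combination[OF ind, of "6 * x - 3 * y + z" _ "- x" _ "y - x"])
          (use 3 nn units in \<open>auto simp: e gen2_def emb_gb_g3[of _ x y z] emb_gb_g3[of _ "- 1" "- 1" 3]
            emb_gb_g3[of _ 0 1 3] algebra_simps\<close>)
      then show ?thesis by blast
    qed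
    moreover have "Gen 2 (- 1) (b - 1) b" using b_ge by (auto simp: Gen_def chain_def)
    ultimately show ?thesis
      using cd el_vertices(4) tp_unit_assoc_1 tp_unit_1 tp_unit_square tp_unit_gens(3) tp_assoc_trans
      by metis
  qed
qed

end

section \<open>The listed elements\<close>

text \<open>t^3 - 27 p q s is a sum of squared differences with positive weights, which gives both
  the bound and the case of equality.\<close>

lemma arith_geo_mean_3:
  fixes p q s :: real
  assumes "p > 0" "q > 0" "s > 0" "p * q * s \<ge> 1"
  shows "p + q + s \<ge> 3" and "p + q + s = 3 \<Longrightarrow> p = 1 \<and> q = 1 \<and> s = 1"
proof -
  define t where "t = p + q + s"
  have id: "t ^ 3 - 27 * (p * q * s) = (p + q + 7 * s) / 2 * (p - q) ^ 2 + (q + s + 7 * p) / 2 * (q - s) ^ 2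
    + (s + p + 7 * q) / 2 * (s - p) ^ 2"
    unfolding t_def by (simp add: power2_eq_square power3_eq_cube field_simps)
  have nn: "(p + q + 7 * s) / 2 * (p - q) ^ 2 \<ge> 0" "(q + s + 7 * p) / 2 * (q - s) ^ 2 \<ge> 0"
    "(s + p + 7 * q) / 2 * (s - p) ^ 2 \<ge> 0" using assms by simp_all
  have "3 ^ 3 \<le> t ^ 3" using id nn assms(4) by simp
  moreover have "t > 0" using assms by (simp add: t_def)
  ultimately have "3 \<le> t" using power_le_imp_le_base[of 3 2 t] by (simp add: numeral_3_eq_3)
  then show "p + q + s \<ge> 3" by (simp add: t_def)
  assume "p + q + s = 3"
  then have "t = 3" by (simp add: t_def)
  then have "t ^ 3 = 27" by simp
  then have "(p + q + 7 * s) / 2 * (p - q) ^ 2 = 0" "(q + s + 7 * p) / 2 * (q - s) ^ 2 = 0"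
    using id nn assms(4) by linarith+
  moreover have "(p + q + 7 * s) / 2 \<noteq> 0" "(q + s + 7 * p) / 2 \<noteq> 0" using assms by auto
  ultimately have "p = q" "q = s" by simp_all
  then show "p = 1 \<and> q = 1 \<and> s = 1" using \<open>p + q + s = 3\<close> by simp
qed

context simplest_cubic
begin

text \<open>Level 1 is family (v); at level 2 the facets X = -1, Y = -1, Z = -1 give (vi), (vii), (viii),
  and at level 3 they give (ii), (iii), (iv).\<close>

definition listed_chain :: "int \<Rightarrow> int \<Rightarrow> int \<Rightarrow> int \<Rightarrow> bool" where
  "listed_chain h X Y Z \<longleftrightarrow> X + Y + Z = (b - 1) * h \<and>
     (h = 1 \<and> X \<ge> 0 \<and> Y \<ge> 0 \<and> Z \<ge> 0 \<or> h = 2 \<and> X = - 1 \<and> b \<le> Y \<and> Y \<le> 2 * b - 1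
      \<or> h = 3 \<and> X = - 1 \<and> - 1 \<le> Y \<and> Y \<le> b - 2)"

definition listed :: "int \<Rightarrow> int \<Rightarrow> int \<Rightarrow> int \<Rightarrow> bool" where
  "listed h X Y Z \<longleftrightarrow> listed_chain h X Y Z \<or> listed_chain h Y Z X \<or> listed_chain h Z X Y"

lemma listed_chain_imp_chain: "listed_chain h X Y Z \<Longrightarrow> chain h X Y Z"
  unfolding listed_chain_def chain_def by (elim conjE disjE) simp_all

lemma chain_cases:
  assumes "chain h X Y Z"
  obtains "listed_chain h X Y Z" | "h = 2" "X = - 1" "Y = b - 1" "Z = b"
    | "h = 3" "X = - 1" "Y = - 2" "Z = 3 * b"
proof -
  from assms consider "listed_chain h X Y Z" | "h = 2" "X = - 1" "Y = b - 1" "X + Y + Z = (b - 1) * h"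
    | "h = 3" "X = - 1" "Y = - 2" "X + Y + Z = (b - 1) * h"
    unfolding chain_def listed_chain_def by linarith
  then show ?thesis by cases (use that in auto)
qed

lemma listed_imp_Gen: "listed h X Y Z \<Longrightarrow> Gen h X Y Z"
  unfolding listed_def Gen_def using listed_chain_imp_chain by blast

lemma listed_sum: "listed h X Y Z \<Longrightarrow> Z = (b - 1) * h - X - Y"
  by (auto simp: listed_def listed_chain_def)

lemma listed_OK_totpos: "listed h X Y Z \<Longrightarrow> OK a (el h X Y)" "listed h X Y Z \<Longrightarrow> totpos a (el h X Y)"
  using OK_el totpos_Gen listed_imp_Gen by blast+

lemma div_simps: "a div 3 = b" "2 * a div 3 = 2 * b" "4 * a div 3 = 4 * b"
  by (simp_all add: a_eq)

text \<open>The parameters translate as X = v, Y = r - b - 1 in (v), as Y = r + b in (vi) and as X =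
  v in (vii) and (viii).\<close>

lemma L1_eq: "L1 a = insert (gb 0 0 1) {el h X Y | h X Y. h \<noteq> 3 \<and> listed h X Y ((b - 1) * h - X - Y)}"
proof (intro equalityI subsetI)
  let ?S = "insert (gb 0 0 1) {el h X Y | h X Y. h \<noteq> 3 \<and> listed h X Y ((b - 1) * h - X - Y)}"
  have mem: "d \<in> ?S" if "d = el h X Y" "h \<noteq> 3" "listed h X Y ((b - 1) * h - X - Y)" for d h X Y
    using that by blast
  fix c assume "c \<in> L1 a"
  then consider "c = gb 0 0 1"
    | v r where "c = gb (-(2*v+1)) (-(v*(a+3)+r+1)) (3*v+2)" "0 \<le> v" "v \<le> b - 1" "b + 1 \<le> r" "r \<le> 2 * b - v"
    | r where "c = gb 0 (-(r+1)) 1" "0 \<le> r" "r \<le> b - 1"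
    | v where "c = gb (-(2*v+2)) (-(v*(a+3) + 2*b + 3)) (3*v+4)" "0 \<le> v" "v \<le> b - 1"
    | v where "c = gb (-(2*v+2)) (-(v*(a+3) + 4*b - v + 3)) (3*v+4)" "b \<le> v" "v \<le> 2*b - 1"
    unfolding L1_def div_simps by blast
  then show "c \<in> insert (gb 0 0 1) {el h X Y | h X Y. h \<noteq> 3 \<and> listed h X Y ((b - 1) * h - X - Y)}"
  proof cases
    case 2
    have "c = el 1 v (r - b - 1)" unfolding 2(1) el_def gb_inj by (simp add: algebra_simps)
    then show ?thesis by (rule mem) (use 2 in \<open>simp_all add: listed_def listed_chain_def algebra_simps\<close>)
  next
    case 3
    have "c = el 2 (- 1) (r + b)" unfolding 3(1) el_def gb_inj by (simp add: a_eq algebra_simps)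
    then show ?thesis by (rule mem) (use 3 in \<open>simp_all add: listed_def listed_chain_def algebra_simps\<close>)
  next
    case 4
    have "c = el 2 v (- 1)" unfolding 4(1) el_def gb_inj by (simp add: a_eq algebra_simps)
    then show ?thesis by (rule mem) (use 4 in \<open>simp_all add: listed_def listed_chain_def algebra_simps\<close>)
  next
    case 5
    have "c = el 2 v (2 * b - 1 - v)" unfolding 5(1) el_def gb_inj by (simp add: a_eq algebra_simps)
    then show ?thesis by (rule mem) (use 5 in \<open>simp_all add: listed_def listed_chain_def algebra_simps\<close>)
  qed simp
next
  fix c assume "c \<in> insert (gb 0 0 1) {el h X Y | h X Y. h \<noteq> 3 \<and> listed h X Y ((b - 1) * h - X - Y)}"
  then consider "c = gb 0 0 1" | X Y where "c = el 1 X Y" "0 \<le> X" "0 \<le> Y" "X + Y \<le> b - 1"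
    | Y where "c = el 2 (- 1) Y" "b \<le> Y" "Y \<le> 2 * b - 1" | X where "c = el 2 X (- 1)" "0 \<le> X" "X \<le> b - 1"
    | X where "c = el 2 X (2 * b - 1 - X)" "b \<le> X" "X \<le> 2 * b - 1"
    by (auto simp: listed_def listed_chain_def algebra_simps)
      (smt (verit))+
  then show "c \<in> L1 a"
  proof cases
    case 1
    then show ?thesis by (simp add: L1_def)
  next
    case 2
    have "c = gb (-(2*X+1)) (-(X*(a+3)+(Y + b + 1)+1)) (3*X+2)" unfolding 2(1) el_def gb_inj by (simp add: algebra_simps)
    moreover have "0 \<le> X" "X \<le> b - 1" "b + 1 \<le> Y + b + 1" "Y + b + 1 \<le> 2 * b - X" using 2 by auto
    ultimately show ?thesis unfolding L1_def div_simps by blast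
  next
    case 3
    have "c = gb 0 (-((Y - b)+1)) 1" unfolding 3(1) el_def gb_inj by (simp add: a_eq algebra_simps)
    moreover have "0 \<le> Y - b" "Y - b \<le> b - 1" using 3 by auto
    ultimately show ?thesis unfolding L1_def div_simps by blast
  next
    case 4
    have "c = gb (-(2*X+2)) (-(X*(a+3) + 2*b + 3)) (3*X+4)" unfolding 4(1) el_def gb_inj by (simp add: a_eq algebra_simps)
    then show ?thesis using 4(2,3) unfolding L1_def div_simps by blast
  next
    case 5
    have "c = gb (-(2*X+2)) (-(X*(a+3) + 4*b - X + 3)) (3*X+4)" unfolding 5(1) el_def gb_inj by (simp add: a_eq algebra_simps)
    then show ?thesis using 5(2,3) unfolding L1_def div_simps by blast
  qed
qed

text \<open>Here Y = r - 2 in (ii), and X = v - 1 in (iii) and (iv).\<close>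

lemma L2_eq: "L2 a = {el 3 X Y | X Y. listed 3 X Y ((b - 1) * 3 - X - Y)}"
proof (intro equalityI subsetI)
  have mem: "d \<in> {el 3 X Y | X Y. listed 3 X Y ((b - 1) * 3 - X - Y)}"
    if "d = el 3 X Y" "listed 3 X Y ((b - 1) * 3 - X - Y)" for d X Y
    using that by blast
  fix c assume "c \<in> L2 a"
  then consider r where "c = gb (-1) (-(r+1)) 3" "1 \<le> r" "r \<le> b"
    | v where "c = gb (-(2*v+1)) (-(v*(a+3)+2)) (3*(v+1))" "2*b + 1 \<le> v" "v \<le> 3 * b"
    | v where "c = gb (-(2*v+1)) (-((v+1)*(a+2))) (3*(v+1))" "0 \<le> v" "v \<le> b - 1"
    unfolding L2_def div_simps using a_eq by blast
  then show "c \<in> {el 3 X Y | X Y. listed 3 X Y ((b - 1) * 3 - X - Y)}"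
  proof cases
    case 1
    have "c = el 3 (- 1) (r - 2)" unfolding 1(1) el_def gb_inj by (simp add: a_eq algebra_simps)
    then show ?thesis by (rule mem) (use 1 in \<open>simp_all add: listed_def listed_chain_def algebra_simps\<close>)
  next
    case 2
    have "c = el 3 (v - 1) (- 1)" unfolding 2(1) el_def gb_inj by (simp add: a_eq algebra_simps)
    then show ?thesis by (rule mem) (use 2 in \<open>simp_all add: listed_def listed_chain_def algebra_simps\<close>)
  next
    case 3
    have "c = el 3 (v - 1) (3 * b - 1 - v)" unfolding 3(1) el_def gb_inj by (simp add: a_eq algebra_simps)
    then show ?thesis by (rule mem) (use 3 in \<open>simp_all add: listed_def listed_chain_def algebra_simps\<close>)
  qed
next
  fix c assume "c \<in> {el 3 X Y | X Y. listed 3 X Y ((b - 1) * 3 - X - Y)}"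
  then consider Y where "c = el 3 (- 1) Y" "- 1 \<le> Y" "Y \<le> b - 2"
    | X where "c = el 3 X (- 1)" "2 * b \<le> X" "X \<le> 3 * b - 1"
    | X where "c = el 3 X (3 * b - 2 - X)" "- 1 \<le> X" "X \<le> b - 2"
    by (auto simp: listed_def listed_chain_def algebra_simps)
      (smt (verit))+
  then show "c \<in> L2 a"
  proof cases
    case 1
    have "c = gb (-1) (-((Y + 2)+1)) 3" unfolding 1(1) el_def gb_inj by (simp add: a_eq algebra_simps)
    moreover have "1 \<le> Y + 2" "Y + 2 \<le> b" using 1 by auto
    ultimately show ?thesis unfolding L2_def div_simps by blast
  next
    case 2
    have "c = gb (-(2*(X+1)+1)) (-((X+1)*(a+3)+2)) (3*((X+1)+1))" unfolding 2(1) el_def gb_inj by (simp add: a_eq algebra_simps)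
    moreover have "2 * b + 1 \<le> X + 1" "X + 1 \<le> a" using 2 a_eq by auto
    ultimately show ?thesis unfolding L2_def div_simps by blast
  next
    case 3
    have "c = gb (-(2*(X+1)+1)) (-(((X+1)+1)*(a+2))) (3*((X+1)+1))" unfolding 3(1) el_def gb_inj by (simp add: a_eq algebra_simps)
    moreover have "0 \<le> X + 1" "X + 1 \<le> b - 1" using 3 by auto
    ultimately show ?thesis unfolding L2_def div_simps by blast
  qed
qed

text \<open>The ends of chains omitted from \<open>listed\<close> are the vertices of the cone,
  which are units, and the rotations of (1 + rho + rho^2) / 3, which are associated to it.\<close>

lemma Gen_assoc_listed:
  assumes "Gen h X Y Z"
  shows "tp_assoc a (el h X Y) (gb 1 0 0) \<or> tp_assoc a (el h X Y) (gb 0 0 1) \<or> listed h X Y Z"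
proof -
  have g: "tp_assoc a (mulK a e d) d" if "tp_unit a e" for e d using that tp_assoc_iff by blast
  from assms consider "chain h X Y Z" | "chain h Y Z X" | "chain h Z X Y" by (auto simp: Gen_def)
  then show ?thesis
  proof cases
    case 1
    then show ?thesis
      by (cases rule: chain_cases) (use el_vertices tp_assoc_refl tp_unit_assoc_1 tp_unit_square in \<open>auto simp: listed_def\<close>)
  next
    case 2
    then show ?thesis
      by (cases rule: chain_cases)
        (use el_vertices el_g3_assoc(1) g[OF tp_unit_gens(2)] tp_unit_assoc_1 tp_unit_gens in \<open>auto simp: listed_def\<close>)
  next
    case 3
    then show ?thesis
      by (cases rule: chain_cases)
        (use el_vertices el_g3_assoc(2) g[OF tp_unit_gens(4)] tp_unit_assoc_1 tp_unit_1 in \<open>auto simp: listed_def\<close>)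
  qed
qed

lemma indec_imp_assoc_listed:
  assumes "indec a c"
  shows "\<exists>d \<in> insert (gb 1 0 0) (L1 a \<union> L2 a). tp_assoc a c d"
proof -
  have l: "el h X Y \<in> L1 a \<union> L2 a" if "listed h X Y Z" for h X Y Z
    using that listed_sum[OF that] unfolding L1_eq L2_eq by (cases "h = 3") auto
  have g3: "gb 0 0 1 \<in> L1 a" by (simp add: L1_def)
  from indec_imp_assoc_Gen[OF assms] show ?thesis
    using Gen_assoc_listed tp_assoc_trans l g3 by (metis UnCI insert_iff)
qed

section \<open>Traces and indecomposability\<close>

lemma trprod_functionals:
  fixes h X Y :: int
  defines "Z \<equiv> (b - 1) * h - X - Y"
  shows "trprod a (dual 3 0 3) (el h X Y) = of_int h"
    "trprod a (dual 1 0 2) (el h X Y) = of_int (h + X)"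
    "trprod a (dual (a + 3) (- 1) 1) (el h X Y) = of_int (h + Y)"
    "trprod a (dual 2 1 (a + 3)) (el h X Y) = of_int (h + Z)"
    "trprod a (dual 2 (- 1) 2) (el h X Y) = of_int ((a + 2) * X + Y + (b + 2) * h)"
  unfolding el_def
  by (subst trprod_dual_gb[of _ _ _ 2] trprod_dual_gb[of _ _ _ 1] trprod_dual_gb[of _ _ _ "b + 1"]
      trprod_dual_gb[of _ _ _ "b + 2"], simp add: a_eq, simp only: of_int_eq_iff, simp add: a_eq Z_def algebra_simps)+

lemma codiff_functionals:
  "codiff a (dual 3 0 3)" "codiff a (dual 1 0 2)" "codiff a (dual (a + 3) (- 1) 1)"
  "codiff a (dual 2 1 (a + 3))"
  by (rule codiff_dual[of _ _ _ 2] codiff_dual[of _ _ _ 1] codiff_dual[of _ _ _ "b + 1"]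
      codiff_dual[of _ _ _ "b + 2"], simp add: a_eq)+

lemma codiff_trprod_int:
  assumes "codiff a d" "totpos a d" "OK a c" "totpos a c"
  obtains n :: int where "trprod a d c = of_int n" "n \<ge> 1"
proof -
  obtain n :: int where n: "trprod a d c = of_int n"
    using assms(1,3) unfolding codiff_def by (metis Ints_cases)
  moreover have "n \<ge> 1" using trprod_pos[OF assms(2,4)] unfolding n by simp
  ultimately show ?thesis using that by blast
qed

lemma trprod_addK: "trprod a d (addK x y) = trprod a d x + trprod a d y"
  by (simp add: trprod_def sum_roots emb_addK algebra_simps)

lemma indec_if_trace_1:
  assumes "codiff a d" "totpos a d" "OK a c" "totpos a c" "trprod a d c = 1"
  shows "indec a c"
  unfolding indec_def
proof (intro conjI notI)
  assume "\<exists>x y. OK a x \<and> OK a y \<and> totpos a x \<and> totpos a y \<and> c = addK x y"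
  then obtain x y where xy: "OK a x" "OK a y" "totpos a x" "totpos a y" "c = addK x y" by metis
  obtain i j :: int where "trprod a d x = of_int i" "i \<ge> 1" "trprod a d y = of_int j" "j \<ge> 1"
    using codiff_trprod_int[OF assms(1,2)] xy by metis
  then show False using assms(5) xy(5) trprod_addK[of d x y] by simp
qed (use assms in auto)

lemma has_min_trace_1I:
  assumes "codiff a d" "totpos a d" "OK a c" "totpos a c" "trprod a d c = 1"
  shows "has_min_trace a c 1"
  unfolding has_min_trace_def
proof (intro conjI exI allI impI)
  fix d' assume "codiff a d' \<and> totpos a d'"
  then obtain n :: int where "trprod a d' c = of_int n" "n \<ge> 1" using codiff_trprod_int assms(3,4) by metis
  then show "1 \<le> trprod a d' c" by simp
qed (use assms in auto)

lemma trace_1_exists: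
  assumes "c \<in> L1 a"
  obtains d where "codiff a d" "totpos a d" "OK a c" "totpos a c" "trprod a d c = 1"
proof -
  from assms consider "c = el 2 (- 1) (b - 1)" | h X Y where "c = el h X Y" "h \<noteq> 3" "listed h X Y ((b - 1) * h - X - Y)"
    unfolding L1_eq el_vertices(4) by auto
  then show ?thesis
  proof cases
    case 1
    then show ?thesis
      using that[OF codiff_functionals(2) totpos_hX] totpos_g3 OK_gb[of 0 0 1] trprod_functionals(2)[of 2 "- 1" "b - 1"]
      by (simp add: el_vertices(4))
  next
    case 2
    have ok: "OK a c" "totpos a c" using listed_OK_totpos[OF 2(3)] 2(1) by auto
    \<comment> \<open>At level 2 one coordinate is -1, and the corresponding functional among h + X,
      h + Y, h + Z is 1.\<close>
    have "h = 1 \<or> h + X = 1 \<or> h + Y = 1 \<or> h + ((b - 1) * h - X - Y) = 1"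
      using 2 by (auto simp: listed_def listed_chain_def)
    then show ?thesis
      using that[OF codiff_functionals(1) totpos_h ok] that[OF codiff_functionals(2) totpos_hX ok]
        that[OF codiff_functionals(3) totpos_hY ok] that[OF codiff_functionals(4) totpos_hZ ok]
      unfolding 2(1) trprod_functionals by (metis of_int_1)
  qed
qed

lemma emb_el_linear:
  "emb r (el h X Y) = of_int h * emb r (el 1 0 0) + of_int X * emb r (el 0 1 0) + of_int Y * emb r (el 0 0 1)"
  by (simp add: el_def emb_gb field_simps)

text \<open>Every listed element of level 3 lies on the segment from a unit to a sum of two elements.\<close>

lemma level_3_relation:
  assumes "listed 3 X Y Z"
  obtains j u g w where "- 1 \<le> j" "j \<le> b - 2" "OK a u" "OK a g" "OK a w" "totpos a u" "totpos a g" "totpos a w"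
    "\<forall>r. of_int (b + 1) * emb r (el 3 X Y) = of_int (b - 1 - j) * emb r u + of_int (j + 2) * (emb r g + emb r w)"
proof -
  have G: "Gen 3 (- 1) (- 2) (3 * b)" "Gen 3 (3 * b) (- 1) (- 2)" "Gen 3 (- 2) (3 * b) (- 1)"
    "Gen 2 (- 1) (b - 1) b" "Gen 2 b (- 1) (b - 1)" "Gen 2 (b - 1) b (- 1)"
    "Gen 1 0 0 (b - 1)" "Gen 1 (b - 1) 0 0" "Gen 1 0 (b - 1) 0"
    using b_ge by (auto simp: Gen_def chain_def)
  note t = totpos_Gen[OF G(1)] totpos_Gen[OF G(2)] totpos_Gen[OF G(3)] totpos_Gen[OF G(4)] totpos_Gen[OF G(5)]
    totpos_Gen[OF G(6)] totpos_Gen[OF G(7)] totpos_Gen[OF G(8)] totpos_Gen[OF G(9)]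
  \<comment> \<open>On the row X = -1 of level 3, Y = -2 is the unit u and Y = b - 1 is g + w with g
    of level 2 and w of level 1; their distance b + 1 is the denominator. The other cases are
    rotations.\<close>
  consider "X = - 1" "- 1 \<le> Y" "Y \<le> b - 2" | "Y = - 1" "- 1 \<le> Z" "Z \<le> b - 2" "X = 3 * b - 2 - Z"
    | "- 1 \<le> X" "X \<le> b - 2" "Y = 3 * b - 2 - X"
    using assms by (auto simp: listed_def listed_chain_def)
  then show ?thesis
  proof cases
    case 1
    show ?thesis
      by (rule that[OF 1(2,3) OK_el OK_el OK_el t(1,4,7)], rule allI, subst (1 2 3 4) emb_el_linear) (simp add: 1 algebra_simps)
  next
    case 2
    show ?thesis
      by (rule that[OF 2(2,3) OK_el OK_el OK_el t(2,5,8)], rule allI, subst (1 2 3 4) emb_el_linear) (simp add: 2 algebra_simps)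
  next
    case 3
    show ?thesis
      by (rule that[OF 3(1,2) OK_el OK_el OK_el t(3,6,9)], rule allI, subst (1 2 3 4) emb_el_linear) (simp add: 3 algebra_simps)
  qed
qed

text \<open>u, g, w in \<open>level_3_relation\<close> have trace at least 1, so b + 1 times the
  trace is at least (b - 1 - j) + 2 (j + 2) > b + 1. This excludes trace 1.\<close>

lemma has_min_trace_2:
  assumes "listed 3 X Y Z"
  shows "has_min_trace a (el 3 X Y) 2"
  unfolding has_min_trace_def
proof (intro conjI allI impI)
  have "3 + X = 2 \<or> 3 + Y = 2 \<or> 3 + ((b - 1) * 3 - X - Y) = 2"
    using assms by (auto simp: listed_def listed_chain_def)
  then show "\<exists>d. codiff a d \<and> totpos a d \<and> trprod a d (el 3 X Y) = 2"
    using codiff_functionals totpos_hX totpos_hY totpos_hZ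
      trprod_functionals(2)[of 3 X Y] trprod_functionals(3)[of 3 X Y] trprod_functionals(4)[of 3 X Y]
    by (metis of_int_numeral)
next
  fix d assume d: "codiff a d \<and> totpos a d"
  note int = codiff_trprod_int[OF conjunct1[OF d] conjunct2[OF d]]
  obtain j u g w where j: "- 1 \<le> j" "j \<le> b - 2" and ok: "OK a u" "OK a g" "OK a w" "totpos a u" "totpos a g" "totpos a w"
    and rel: "\<forall>r. of_int (b + 1) * emb r (el 3 X Y) = of_int (b - 1 - j) * emb r u + of_int (j + 2) * (emb r g + emb r w)"
    using level_3_relation[OF assms] .
  obtain i1 i2 i3 i4 :: int where i: "trprod a d u = of_int i1" "i1 \<ge> 1" "trprod a d g = of_int i2" "i2 \<ge> 1"
    "trprod a d w = of_int i3" "i3 \<ge> 1" "trprod a d (el 3 X Y) = of_int i4"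
    using int ok listed_OK_totpos[OF assms] by metis
  have "of_int (b + 1) * trprod a d (el 3 X Y) = (\<Sum>r\<in>roots a. emb r d * (of_int (b + 1) * emb r (el 3 X Y)))"
    by (simp add: trprod_def sum_distrib_left mult_ac)
  also have "\<dots> = of_int (b - 1 - j) * trprod a d u + of_int (j + 2) * (trprod a d g + trprod a d w)"
    unfolding rel[rule_format] by (simp add: trprod_def sum_roots algebra_simps)
  finally have "of_int ((b + 1) * i4) = (of_int ((b - 1 - j) * i1 + (j + 2) * (i2 + i3)) :: real)"
    unfolding i by simp
  then have e: "(b + 1) * i4 = (b - 1 - j) * i1 + (j + 2) * (i2 + i3)" by (simp only: of_int_eq_iff)
  have "(b - 1 - j) * i1 \<ge> (b - 1 - j) * 1" "(j + 2) * (i2 + i3) \<ge> (j + 2) * 2"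
    using i j by (intro mult_left_mono; simp)+
  then have "(b + 1) * i4 \<ge> (b - 1 - j) * 1 + (j + 2) * 2" unfolding e by (rule add_mono)
  moreover have "(b - 1 - j) * 1 + (j + 2) * 2 > (b + 1) * 1" using j by simp
  ultimately have "(b + 1) * i4 > (b + 1) * 1" by (rule less_le_trans[rotated])
  then have "i4 > 1" using b_ge by (simp add: mult_less_cancel_left_pos)
  then show "2 \<le> trprod a d (el 3 X Y)" using i(7) by simp
qed

text \<open>The part of level 1 has X >= 0 and that of level 2 has X >= -1, so these are equalities.
  Then T forces Y >= b - 1 at level 2, and Y >= 0 at level 1, so the sum exceeds b - 2.\<close>

lemma level_3_contradiction:
  fixes X1 X2 Y1 Y2 h1 h2 :: int
  assumes "h1 \<ge> 1" "h2 \<ge> 1" "h1 + h2 = 3" "h1 + X1 \<ge> 1" "h2 + X2 \<ge> 1" "X1 + X2 = - 1"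
    "h1 + Y1 \<ge> 1" "h2 + Y2 \<ge> 1" "Y1 + Y2 \<le> b - 2" "(a + 2) * X1 + Y1 + (b + 2) * h1 \<ge> 1"
    "(a + 2) * X2 + Y2 + (b + 2) * h2 \<ge> 1"
  shows False
proof -
  consider "h1 = 1" "h2 = 2" | "h1 = 2" "h2 = 1" using assms(1-3) by linarith
  then show False
  proof cases
    case 1
    then have X: "X2 = - 1" using assms(4-6) by linarith
    have "Y2 \<ge> b - 1" using assms(11) unfolding 1 X a_eq by simp
    then show False using assms(7,9) 1 by simp
  next
    case 2
    then have X: "X1 = - 1" using assms(4-6) by linarith
    have "Y1 \<ge> b - 1" using assms(10) unfolding 2 X a_eq by simp
    then show False using assms(8,9) 2 by simp
  qed
qed

lemma indec_level_3:
  assumes "listed 3 X Y Z"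
  shows "indec a (el 3 X Y)"
  unfolding indec_def
proof (intro conjI notI)
  assume "\<exists>x y. OK a x \<and> OK a y \<and> totpos a x \<and> totpos a y \<and> el 3 X Y = addK x y"
  then obtain x y where xy: "OK a x" "OK a y" "totpos a x" "totpos a y" "el 3 X Y = addK x y" by metis
  obtain h1 X1 Y1 where x: "x = el h1 X1 Y1" using OK_imp_el[OF xy(1)] .
  obtain h2 X2 Y2 where y: "y = el h2 X2 Y2" using OK_imp_el[OF xy(2)] .
  define Z1 Z2 where "Z1 = (b - 1) * h1 - X1 - Y1" and "Z2 = (b - 1) * h2 - X2 - Y2"
  have e: "h1 + h2 = 3" "X1 + X2 = X" "Y1 + Y2 = Y"
    using xy(5) unfolding x y el_add[symmetric] el_inj by auto
  have "(b - 1) * h1 + (b - 1) * h2 = (b - 1) * 3" using e(1) by (metis distrib_left)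
  then have Z: "Z1 + Z2 = Z" using e listed_sum[OF assms] by (simp add: Z1_def Z2_def)
  note p = totpos_el_imp[OF xy(3)[unfolded x] Z1_def] totpos_el_imp_T[OF xy(3)[unfolded x] Z1_def]
    totpos_el_imp[OF xy(4)[unfolded y] Z2_def] totpos_el_imp_T[OF xy(4)[unfolded y] Z2_def]
  from assms consider "X = - 1" "Y \<le> b - 2" | "Y = - 1" "Z \<le> b - 2" | "Z = - 1" "X \<le> b - 2"
    by (auto simp: listed_def listed_chain_def)
  then show False
  proof cases
    case 1
    show False by (rule level_3_contradiction[of h1 h2 X1 X2 Y1 Y2]) (use p e 1 in auto)
  next
    case 2
    show False by (rule level_3_contradiction[of h1 h2 Y1 Y2 Z1 Z2]) (use p e Z 2 in auto)
  next
    case 3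
    show False by (rule level_3_contradiction[of h1 h2 Z1 Z2 X1 X2]) (use p e Z 3 in auto)
  qed
qed (use listed_OK_totpos[OF assms] in auto)

lemma norm_pos_int:
  assumes "OK a c" "totpos a c"
  obtains n :: int where "emb r1 c * emb r2 c * emb r3 c = of_int n" "n \<ge> 1"
proof -
  obtain h X Y where c: "c = el h X Y" using OK_imp_el[OF assms(1)] .
  have "emb r1 c * emb r2 c * emb r3 c > 0" using assms(2) by (simp add: totpos_iff)
  then show ?thesis using that[of "norm_el h X Y"] by (simp add: c emb_norm_el)
qed

text \<open>A summand of 1 would have all conjugates strictly between 0 and 1, hence norm below
  1.\<close>

lemma indec_1: "indec a (gb 1 0 0)"
  unfolding indec_def
proof (intro conjI notI)
  assume "\<exists>x y. OK a x \<and> OK a y \<and> totpos a x \<and> totpos a y \<and> gb 1 0 0 = addK x y"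
  then obtain x y where xy: "OK a x" "OK a y" "totpos a x" "totpos a y" "gb 1 0 0 = addK x y" by metis
  have lt: "0 < emb r x \<and> emb r x < 1" if "r \<in> roots a" for r
    using arg_cong[OF xy(5), of "emb r"] xy(3,4) that unfolding emb_addK emb_1 totpos_def by fastforce
  have mul: "0 < p * q \<and> p * q < 1" if "0 < p \<and> p < 1" "0 < q \<and> q < 1" for p q :: real
    using mult_strict_mono[of p 1 q 1] that by simp
  then have "emb r1 x * emb r2 x * emb r3 x < 1"
    using mul[OF mul[OF lt lt] lt] r_in by blast
  moreover obtain n :: int where "emb r1 x * emb r2 x * emb r3 x = of_int n" "n \<ge> 1" using norm_pos_int xy by blast
  ultimately show False by simp
qed (use tp_unit_1 in \<open>auto simp: tp_unit_def unitK_def\<close>)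

lemma indec_listed:
  assumes "c \<in> insert (gb 1 0 0) (L1 a \<union> L2 a)"
  shows "indec a c"
proof -
  consider "c = gb 1 0 0" | "c \<in> L1 a" | X Y Z where "c = el 3 X Y" "listed 3 X Y Z"
    using assms unfolding L2_eq by auto
  then show ?thesis
  proof cases
    case 1
    then show ?thesis using indec_1 by simp
  next
    case 2
    then show ?thesis using indec_if_trace_1 trace_1_exists by metis
  next
    case 3
    then show ?thesis using indec_level_3 by simp
  qed
qed

section \<open>Totally positive units are of level at least 3\<close>

lemma emb_tp_unit_norm:
  assumes "tp_unit a e"
  shows "emb r1 e * emb r2 e * emb r3 e = 1"
proof -
  obtain e' where e': "tp_unit a e'" "\<And>r. r \<in> roots a \<Longrightarrow> emb r e * emb r e' = 1"
    using tp_unit_inverse[OF assms] by metis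
  obtain n :: int where n: "emb r1 e * emb r2 e * emb r3 e = of_int n" "n \<ge> 1"
    using norm_pos_int assms by (metis tp_unit_def unitK_def)
  obtain k :: int where k: "emb r1 e' * emb r2 e' * emb r3 e' = of_int k" "k \<ge> 1"
    using norm_pos_int e'(1) by (metis tp_unit_def unitK_def)
  have "(emb r1 e * emb r2 e * emb r3 e) * (emb r1 e' * emb r2 e' * emb r3 e')
      = (emb r1 e * emb r1 e') * (emb r2 e * emb r2 e') * (emb r3 e * emb r3 e')"
    by (simp add: mult_ac)
  then have "(of_int (n * k) :: real) = 1" unfolding n(1) k(1) e'(2)[OF r_in(1)] e'(2)[OF r_in(2)] e'(2)[OF r_in(3)] by simp
  then have "n * k = 1" by (simp only: of_int_eq_1_iff)
  then have "n = 1" using n(2) k(2) by (simp add: zmult_eq_1_iff)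
  then show ?thesis using n(1) by simp
qed

text \<open>By the inequality of arithmetic and geometric means, a totally positive unit u is the unique
  minimum of the functional given by the trace of its inverse, on all totally positive integers.\<close>

lemma tp_unit_trace:
  assumes "tp_unit a u"
  obtains d where "trprod a d u = 3" "\<And>c. OK a c \<Longrightarrow> totpos a c \<Longrightarrow> trprod a d c \<ge> 3"
    "\<And>c. OK a c \<Longrightarrow> totpos a c \<Longrightarrow> trprod a d c = 3 \<Longrightarrow> c = u"
proof -
  obtain d where d: "tp_unit a d" "\<And>r. r \<in> roots a \<Longrightarrow> emb r u * emb r d = 1"
    using tp_unit_inverse[OF assms] by metis
  have d3: "trprod a d c = emb r1 d * emb r1 c + emb r2 d * emb r2 c + emb r3 d * emb r3 c" for c
    by (simp add: trprod_def sum_roots)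
  have pos: "emb r1 d * emb r1 c > 0" "emb r2 d * emb r2 c > 0" "emb r3 d * emb r3 c > 0"
    "(emb r1 d * emb r1 c) * (emb r2 d * emb r2 c) * (emb r3 d * emb r3 c) \<ge> 1"
    if "OK a c" "totpos a c" for c
  proof -
    have p: "totpos a (mulK a d c)" using totpos_mulK d(1) that by (simp add: tp_unit_def)
    then show "emb r1 d * emb r1 c > 0" "emb r2 d * emb r2 c > 0" "emb r3 d * emb r3 c > 0"
      by (simp_all add: totpos_iff emb_mulK r_in)
    have "OK a (mulK a d c)" using OK_mulK d(1) that by (simp add: tp_unit_def unitK_def)
    then obtain n :: int where "emb r1 (mulK a d c) * emb r2 (mulK a d c) * emb r3 (mulK a d c) = of_int n" "n \<ge> 1"
      using norm_pos_int p by blast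
    then show "(emb r1 d * emb r1 c) * (emb r2 d * emb r2 c) * (emb r3 d * emb r3 c) \<ge> 1"
      by (simp add: emb_mulK r_in)
  qed
  show ?thesis
  proof (rule that)
    show "trprod a d u = 3" unfolding d3 using d(2) r_in by (simp add: mult.commute)
    show "trprod a d c \<ge> 3" if "OK a c" "totpos a c" for c
      unfolding d3 using arith_geo_mean_3(1) pos[OF that] by blast
    show "c = u" if "OK a c" "totpos a c" "trprod a d c = 3" for c
    proof (rule emb_inj, rule ballI)
      fix r assume r: "r \<in> roots a"
      have "emb r1 d * emb r1 c = 1 \<and> emb r2 d * emb r2 c = 1 \<and> emb r3 d * emb r3 c = 1"
        using arith_geo_mean_3(2) pos[OF that(1,2)] that(3) unfolding d3 by blast
      then have "emb r d * emb r c = 1" using r by (auto simp: roots_eq)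
      then show "emb r c = emb r u" using d(2)[OF r] by (metis mult.commute mult.left_commute mult.right_neutral)
    qed
  qed
qed

text \<open>The trace against the inverse of u is 3 at u and at least 3 at x, y, z, so it is 3
  wherever the weight is positive; there the point equals u.\<close>

lemma not_tp_unit_between:
  assumes u: "tp_unit a u" and n: "n > 0" "p \<ge> 0" "q \<ge> 0" "s \<ge> 0" "p + q + s = n"
    and rel: "\<And>r. of_int n * emb r u = of_int p * emb r x + of_int q * emb r y + of_int s * emb r z"
    and ok: "OK a x" "OK a y" "OK a z" "totpos a x" "totpos a y" "totpos a z"
  shows "u = x \<or> u = y \<or> u = z"
proof -
  obtain d where d: "trprod a d u = 3" "\<And>c. OK a c \<Longrightarrow> totpos a c \<Longrightarrow> trprod a d c \<ge> 3"
    "\<And>c. OK a c \<Longrightarrow> totpos a c \<Longrightarrow> trprod a d c = 3 \<Longrightarrow> c = u"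
    using tp_unit_trace[OF u] by blast
  have "of_int n * trprod a d u = (\<Sum>r\<in>roots a. emb r d * (of_int n * emb r u))"
    by (simp add: trprod_def sum_distrib_left mult_ac)
  also have "\<dots> = of_int p * trprod a d x + of_int q * trprod a d y + of_int s * trprod a d z"
    unfolding rel by (simp add: trprod_def sum_roots algebra_simps)
  finally have "of_int n * 3 = of_int p * trprod a d x + of_int q * trprod a d y + of_int s * trprod a d z"
    unfolding d(1) .
  moreover have "(of_int n :: real) = of_int p + of_int q + of_int s" using n(5) by auto
  ultimately have e: "of_int p * (trprod a d x - 3) + of_int q * (trprod a d y - 3) + of_int s * (trprod a d z - 3) = 0"
    by (simp add: algebra_simps)
  have nn: "of_int p * (trprod a d x - 3) \<ge> 0" "of_int q * (trprod a d y - 3) \<ge> 0" "of_int s * (trprod a d z - 3) \<ge> 0"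
    using n d(2) ok by simp_all
  then have z: "of_int p * (trprod a d x - 3) = 0" "of_int q * (trprod a d y - 3) = 0" "of_int s * (trprod a d z - 3) = 0"
    using e by linarith+
  have "p > 0 \<Longrightarrow> u = x" "q > 0 \<Longrightarrow> u = y" "s > 0 \<Longrightarrow> u = z"
    using z d(3)[OF ok(1,4)] d(3)[OF ok(2,5)] d(3)[OF ok(3,6)] by auto
  moreover have "p > 0 \<or> q > 0 \<or> s > 0" using n by linarith
  ultimately show ?thesis by blast
qed

text \<open>These are the corners of the triangle of level 1 and the ends of the rows of level 2;
  norms above 1 show that none is a unit.\<close>

lemma norm_corners:
  "norm_el 1 0 0 = 2 * m - 1" "norm_el 1 (b - 1) 0 = 2 * m - 1" "norm_el 1 0 (b - 1) = 2 * m - 1"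
  "norm_el 2 (- 1) (b - 1) = m" "norm_el 2 b (- 1) = m" "norm_el 2 (b - 1) b = m"
  "norm_el 2 (- 1) (2 * b - 1) = 4 * m - 1" "norm_el 2 0 (- 1) = 4 * m - 1" "norm_el 2 (2 * b - 1) 0 = 4 * m - 1"
proof -
  have m1: "b * b = 3 * m - 1 - b" using m_eq by (simp add: power2_eq_square)
  have "b * (b ^ 2 + b + 1) = b * (3 * m)" by (simp only: m_eq)
  then have m2: "b * (b * b) = 3 * (b * m) - b - b * b" by (simp add: power2_eq_square algebra_simps)
  show 1: "norm_el 1 0 0 = 2 * m - 1"
    unfolding norm_el_def nrm_def using m1 m2 by (simp add: a_eq power2_eq_square power3_eq_cube algebra_simps)
  show 2: "norm_el 2 (- 1) (b - 1) = m"
    unfolding norm_el_def nrm_def using m1 m2 by (simp add: a_eq power2_eq_square power3_eq_cube algebra_simps)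
  show 3: "norm_el 2 (- 1) (2 * b - 1) = 4 * m - 1"
    unfolding norm_el_def nrm_def using m1 m2 by (simp add: a_eq power2_eq_square power3_eq_cube algebra_simps)
  show "norm_el 1 (b - 1) 0 = 2 * m - 1"
    using norm_el_cyc[where h = 1 and X = "b - 1" and Y = 0] 1 by simp
  then show "norm_el 1 0 (b - 1) = 2 * m - 1"
    using norm_el_cyc[where h = 1 and X = 0 and Y = "b - 1"] by simp
  show "norm_el 2 (b - 1) b = m"
    using norm_el_cyc[where h = 2 and X = "- 1" and Y = "b - 1"] 2 by (simp add: algebra_simps)
  then show "norm_el 2 b (- 1) = m"
    using norm_el_cyc[where h = 2 and X = "b - 1" and Y = b] by (simp add: algebra_simps)
  show "norm_el 2 (2 * b - 1) 0 = 4 * m - 1"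
    using norm_el_cyc[where h = 2 and X = "- 1" and Y = "2 * b - 1"] 3 by (simp add: algebra_simps)
  then show "norm_el 2 0 (- 1) = 4 * m - 1"
    using norm_el_cyc[where h = 2 and X = "2 * b - 1" and Y = 0] by (simp add: algebra_simps)
qed

lemma m_ge: "m \<ge> 19"
proof -
  have "b ^ 2 \<ge> 7 ^ 2" using b_ge by (intro power_mono) auto
  then show ?thesis using m_eq b_ge by simp
qed

lemma tp_unit_norm_el: "tp_unit a (el h X Y) \<Longrightarrow> norm_el h X Y = 1"
  using emb_tp_unit_norm[of "el h X Y"] unfolding emb_norm_el by simp

lemma tp_unit_corners:
  "\<not> tp_unit a (el 1 0 0)" "\<not> tp_unit a (el 1 (b - 1) 0)" "\<not> tp_unit a (el 1 0 (b - 1))"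
  "\<not> tp_unit a (el 2 (- 1) (b - 1))" "\<not> tp_unit a (el 2 b (- 1))" "\<not> tp_unit a (el 2 (b - 1) b)"
  "\<not> tp_unit a (el 2 (- 1) (2 * b - 1))" "\<not> tp_unit a (el 2 0 (- 1))" "\<not> tp_unit a (el 2 (2 * b - 1) 0)"
  using tp_unit_norm_el norm_corners m_ge by fastforce+

text \<open>Positivity of the functionals confines level 1 to a triangle; a unit would have to be
  one of its corners, which have norm 2 m - 1.\<close>

lemma tp_unit_level_1: "\<not> tp_unit a (el 1 X Y)"
proof
  assume u: "tp_unit a (el 1 X Y)"
  then have "totpos a (el 1 X Y)" by (simp add: tp_unit_def)
  note p = totpos_el_imp[OF this refl]
  have G: "Gen 1 (b - 1) 0 0" "Gen 1 0 (b - 1) 0" "Gen 1 0 0 (b - 1)" using b_ge by (auto simp: Gen_def chain_def)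
  have "el 1 X Y = el 1 (b - 1) 0 \<or> el 1 X Y = el 1 0 (b - 1) \<or> el 1 X Y = el 1 0 0"
  proof (rule not_tp_unit_between[OF u, of "b - 1" X Y "b - 1 - X - Y"])
    show "of_int (b - 1) * emb r (el 1 X Y) = of_int X * emb r (el 1 (b - 1) 0) + of_int Y * emb r (el 1 0 (b - 1))
       + of_int (b - 1 - X - Y) * emb r (el 1 0 0)" for r
      by (subst (1 2 3) emb_el_linear) (simp add: algebra_simps)
  qed (use p b_ge OK_el totpos_Gen[OF G(1)] totpos_Gen[OF G(2)] totpos_Gen[OF G(3)] in auto)
  then show False using u tp_unit_corners by auto
qed

lemma tp_unit_level_2_aux:
  assumes u: "tp_unit a u" and j: "b - 1 \<le> j" "j \<le> 2 * b - 1"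
    and rel: "\<And>r. of_int b * emb r u = of_int (2 * b - 1 - j) * emb r g + of_int (j - (b - 1)) * emb r p"
    and ok: "OK a g" "OK a p" "totpos a g" "totpos a p"
  shows "u = g \<or> u = p"
  using not_tp_unit_between[OF u, of b "2 * b - 1 - j" "j - (b - 1)" 0 g p p] assms(2-) b_ge by auto

lemma level_2_bounds:
  assumes "X = - 1" "X + Y + Z = 2 * b - 2" "Z \<ge> - 1" "(a + 2) * X + Y + (b + 2) * 2 \<ge> 1"
    "(a + 2) * Z + X + (b + 2) * 2 \<ge> 1"
  shows "b - 1 \<le> Y" "Y \<le> 2 * b - 1"
proof -
  show "b - 1 \<le> Y" using assms(4) unfolding assms(1) a_eq by simp
  have "Z \<noteq> - 1" using assms(5) b_ge unfolding assms(1) a_eq by auto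
  then show "Y \<le> 2 * b - 1" using assms(1-3) by simp
qed

text \<open>A unit is indecomposable, so with X, Y, Z >= 0 it would be in \<open>Gen\<close>, whose
  elements of level 2 have an entry -1. Otherwise it lies on a row whose ends are not units.\<close>

lemma tp_unit_level_2: "\<not> tp_unit a (el 2 X Y)"
proof
  assume u: "tp_unit a (el 2 X Y)"
  define Z where "Z = (b - 1) * 2 - X - Y"
  have t: "totpos a (el 2 X Y)" using u by (simp add: tp_unit_def)
  note p = totpos_el_imp[OF t Z_def] totpos_el_imp_T[OF t Z_def]
  have ind: "indec a (el 2 X Y)"
    using tp_unit_assoc_1[OF u] indec_1 indec_assoc by blast
  have G: "Gen 2 (- 1) (b - 1) b" "Gen 2 b (- 1) (b - 1)" "Gen 2 (b - 1) b (- 1)"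
    "Gen 2 (- 1) (2 * b - 1) 0" "Gen 2 0 (- 1) (2 * b - 1)" "Gen 2 (2 * b - 1) 0 (- 1)"
    using b_ge by (auto simp: Gen_def chain_def)
  note t = totpos_Gen[OF G(1)] totpos_Gen[OF G(2)] totpos_Gen[OF G(3)] totpos_Gen[OF G(4)] totpos_Gen[OF G(5)]
    totpos_Gen[OF G(6)]
  consider "X \<ge> 0" "Y \<ge> 0" "Z \<ge> 0" | "X = - 1" | "Y = - 1" | "Z = - 1" using p by linarith
  then show False
  proof cases
    case 1
    then have "mon 2 X Y Z" by (intro mon_nonneg) (auto simp: Z_def)
    then have "Gen 2 X Y Z" using indec_mon_imp_Gen ind by blast
    then show False using 1 by (auto simp: Gen_def chain_def)
  next
    case 2
    have j: "b - 1 \<le> Y" "Y \<le> 2 * b - 1"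
      using level_2_bounds[of X Y Z] p 2 by (auto simp: Z_def)
    have "el 2 X Y = el 2 (- 1) (b - 1) \<or> el 2 X Y = el 2 (- 1) (2 * b - 1)"
      by (rule tp_unit_level_2_aux[OF u j _ OK_el OK_el t(1,4)], subst (1 2 3) emb_el_linear) (simp add: 2 algebra_simps)
    then show False using u tp_unit_corners by auto
  next
    case 3
    have X: "X = 2 * b - 1 - Z" using 3 by (simp add: Z_def)
    have j: "b - 1 \<le> Z" "Z \<le> 2 * b - 1"
      using level_2_bounds[of Y Z X] p 3 by (auto simp: Z_def)
    have "el 2 X Y = el 2 b (- 1) \<or> el 2 X Y = el 2 0 (- 1)"
      by (rule tp_unit_level_2_aux[OF u j _ OK_el OK_el t(2,5)], subst (1 2 3) emb_el_linear) (simp add: 3 X algebra_simps)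
    then show False using u tp_unit_corners by auto
  next
    case 4
    have Y: "Y = 2 * b - 1 - X" using 4 by (simp add: Z_def)
    have j: "b - 1 \<le> X" "X \<le> 2 * b - 1"
      using level_2_bounds[of Z X Y] p 4 by (auto simp: Z_def)
    have "el 2 X Y = el 2 (b - 1) b \<or> el 2 X Y = el 2 (2 * b - 1) 0"
      by (rule tp_unit_level_2_aux[OF u j _ OK_el OK_el t(3,6)], subst (1 2 3) emb_el_linear) (simp add: Y algebra_simps)
    then show False using u tp_unit_corners by auto
  qed
qed

lemma tp_unit_level:
  assumes "tp_unit a u"
  shows "trprod a (dual 3 0 3) u \<ge> 3"
proof -
  obtain h X Y where u: "u = el h X Y" using assms OK_imp_el by (metis tp_unit_def unitK_def)
  have "totpos a (el h X Y)" using assms u by (simp add: tp_unit_def)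
  then have "h \<ge> 1" using totpos_el_imp(1)[OF _ refl] by blast
  moreover have "h \<noteq> 1" "h \<noteq> 2" using tp_unit_level_1 tp_unit_level_2 assms u by auto
  ultimately show ?thesis unfolding u trprod_functionals by simp
qed

text \<open>Tracing \<open>level_3_relation\<close> against the inverse of such a unit gives 3 (b +
  1) >= 3 (b - 1 - j) + 6 (j + 2), which fails for j >= -1.\<close>

lemma not_tp_unit_level_3:
  assumes "listed 3 X Y Z"
  shows "\<not> tp_unit a (el 3 X Y)"
proof
  assume u: "tp_unit a (el 3 X Y)"
  obtain d where d: "trprod a d (el 3 X Y) = 3" "\<And>c. OK a c \<Longrightarrow> totpos a c \<Longrightarrow> trprod a d c \<ge> 3"
    using tp_unit_trace[OF u] by metis
  obtain j u g w where j: "- 1 \<le> j" "j \<le> b - 2" and ok: "OK a u" "OK a g" "OK a w" "totpos a u" "totpos a g" "totpos a w"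
    and rel: "\<forall>r. of_int (b + 1) * emb r (el 3 X Y) = of_int (b - 1 - j) * emb r u + of_int (j + 2) * (emb r g + emb r w)"
    using level_3_relation[OF assms] .
  have "of_int (b + 1) * trprod a d (el 3 X Y) = (\<Sum>r\<in>roots a. emb r d * (of_int (b + 1) * emb r (el 3 X Y)))"
    by (simp add: trprod_def sum_distrib_left mult_ac)
  also have "\<dots> = of_int (b - 1 - j) * trprod a d u + of_int (j + 2) * (trprod a d g + trprod a d w)"
    unfolding rel[rule_format] by (simp add: trprod_def sum_roots algebra_simps)
  also have "\<dots> \<ge> of_int (b - 1 - j) * 3 + of_int (j + 2) * (3 + 3)"
    using d(2)[OF ok(1,4)] d(2)[OF ok(2,5)] d(2)[OF ok(3,6)] j by (intro add_mono mult_left_mono) auto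
  finally have "of_int (b - 1 - j) * 3 + of_int (j + 2) * (3 + 3) \<le> of_int (b + 1) * (3 :: real)"
    unfolding d(1) .
  then show False using j by simp
qed

text \<open>When T = 1, the bounds x + z >= 1, 3 x - y + z >= 1 and 2 x - 2 y + z >= 1 give x <= y,
  x >= 0 and y <= 0.\<close>

lemma totpos_TK_1_imp:
  assumes "totpos a (gb x y z)" "2 * x - y + z = 1"
  shows "gb x y z = gb 0 0 1"
proof -
  have a: "of_int a > (20 :: real)" using a_eq b_ge by simp
  \<comment> \<open>Positivity of the two new functionals at r1 needs a sharper estimate: r1 exceeds
    a + 1 by less than 3 / r1.\<close>
  have "r1 * (r1 - of_int a - 1) = (of_int a + 3 - r1) + r2 * r3"
    using inv_r(1) by (simp add: power2_eq_square algebra_simps)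
  then have "r1 * (r1 - of_int a - 1) < 3" using r_signs r1_gt by simp
  then have "r1 * (r1 - of_int a - 1) * (r2 * r3) < 3 * (r2 * r3)" using r_signs by (intro mult_strict_right_mono) auto
  moreover have "r1 * (r1 - of_int a - 1) * (r2 * r3) = r1 - of_int a - 1" using e3 by (simp add: algebra_simps) 
  ultimately have lt: "r1 - of_int a - 1 < 3 * (r2 * r3)" by simp
  have "r2 * r3 < 1 / 22"
  proof -
    have "r2 * r3 * r1 = 1" using e3 by (simp add: mult_ac)
    moreover have "r2 * r3 * r1 > r2 * r3 * 22" using r_signs r1_pos by (intro mult_strict_left_mono) auto
    ultimately show ?thesis by simp
  qed
  then have small: "3 * (r2 * r3) < 3 / 22" by simp
  have B: "totpos a (dual 3 (- 1) 1)"
  proof (rule totpos_dual)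
    show "W 3 (- 1) 1 r1 > 0" using lt by (simp add: W_def inv_r)
    show "W 3 (- 1) 1 r2 > 0" using r_signs r2_bounds a by (simp add: W_def inv_r)
    show "W 3 (- 1) 1 r3 < 0" using r1_gt r3_bounds a by (simp add: W_def inv_r r12)
  qed
  have C: "totpos a (dual 2 (- 2) 3)"
  proof (rule totpos_dual)
    show "W 2 (- 2) 3 r1 > 0" using lt small r_signs by (simp add: W_def inv_r)
    show "W 2 (- 2) 3 r2 > 0" using r_signs r2_bounds a by (simp add: W_def inv_r)
    show "W 2 (- 2) 3 r3 < 0" using r1_gt r3_bounds a by (simp add: W_def inv_r r12)
  qed
  have "x + z \<ge> 1" "3 * x - y + z \<ge> 1" "2 * x - 2 * y + z \<ge> 1"
    using pos_functional[OF totpos_hX _ assms(1), of 1] pos_functional[OF B _ assms(1), of 1]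
      pos_functional[OF C _ assms(1), of 1] by simp_all
  then show ?thesis using assms(2) by (simp add: gb_inj)
qed

lemma not_tp_unit_g3: "\<not> tp_unit a (gb 0 0 1)"
  using tp_unit_corners(4) el_vertices(4) by simp

lemma tp_unit_T:
  assumes "tp_unit a u"
  shows "trprod a (dual 2 (- 1) 2) u \<ge> 2"
proof -
  obtain x y z where u: "u = gb x y z" using assms OK_imp_gb by (metis tp_unit_def unitK_def)
  have t: "totpos a (gb x y z)" using assms u by (simp add: tp_unit_def)
  have "trprod a (dual 2 (- 1) 2) u = of_int (2 * x + (- 1) * y + 1 * z)"
    unfolding u by (rule trprod_dual_gb) simp
  moreover have "2 * x - y + z \<ge> 1" using pos_functional[OF totpos_T _ t, of 1] by simp
  moreover have "2 * x - y + z \<noteq> 1" using totpos_TK_1_imp[OF t] assms not_tp_unit_g3 u by auto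
  ultimately show ?thesis by simp
qed

section \<open>The listed elements are pairwise not associated\<close>

lemma listed_chain_interior:
  assumes "listed_chain h X Y Z"
  shows "2 * h < 3 * ((a + 2) * X + Y + (b + 2) * h)" "2 * h < 3 * ((a + 2) * Y + Z + (b + 2) * h)"
    "2 * h < 3 * ((a + 2) * Z + X + (b + 2) * h)"
proof -
  have sum: "X + Y + Z = (b - 1) * h" using assms by (simp add: listed_chain_def)
  consider "h = 1" "X \<ge> 0" "Y \<ge> 0" "Z \<ge> 0" | "h = 2" "X = - 1" "b \<le> Y" "Y \<le> 2 * b - 1" "Z = 2 * b - 1 - Y"
    | "h = 3" "X = - 1" "- 1 \<le> Y" "Y \<le> b - 2" "Z = 3 * b - 2 - Y"
    using assms unfolding listed_chain_def by force
  note cases = this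
  \<comment> \<open>Hides the products with b so that linear arithmetic treats them as
    atoms.\<close>
  define f where "f t = b * t" for t
  have e: "(3 * b + 2) * t = 3 * f t + 2 * t" "(b + 2) * t = f t + 2 * t" for t
    by (simp_all add: f_def algebra_simps)
  have f: "f 1 = b" "f 2 = 2 * b" "f 3 = 3 * b" "f (- 1) = - b" by (simp_all add: f_def)
  from cases have "2 * h < 3 * ((a + 2) * X + Y + (b + 2) * h) \<and> 2 * h < 3 * ((a + 2) * Y + Z + (b + 2) * h)
    \<and> 2 * h < 3 * ((a + 2) * Z + X + (b + 2) * h)"
  proof cases
    case 1
    have "f X \<ge> 0" "f Y \<ge> 0" "f Z \<ge> 0" using 1 b_ge by (simp_all add: f_def)
    then show ?thesis using 1(2-4) b_ge unfolding a_eq e 1(1) f by auto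
  next
    case 2
    have "f Y \<ge> 0" "f Z \<ge> 0" "Z \<ge> 0" using 2 b_ge by (auto simp: f_def intro!: mult_nonneg_nonneg)
    then show ?thesis using 2(3,4) b_ge unfolding a_eq e 2(1,2) f by auto
  next
    case 3
    have "b * (Y + 1) \<ge> 0" "b * Z \<ge> 0" and Z: "Z \<ge> 0" using 3 b_ge by (auto intro!: mult_nonneg_nonneg)
    then have "f Y \<ge> - b" "f Z \<ge> 0" by (simp_all add: f_def algebra_simps)
    then show ?thesis using 3(3,4) Z b_ge unfolding a_eq e 3(1,2) f by auto
  qed
  then show "2 * h < 3 * ((a + 2) * X + Y + (b + 2) * h)" "2 * h < 3 * ((a + 2) * Y + Z + (b + 2) * h)"
    "2 * h < 3 * ((a + 2) * Z + X + (b + 2) * h)" by auto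
qed

lemma listed_interior:
  assumes "listed h X Y Z"
  shows "2 * h < 3 * ((a + 2) * X + Y + (b + 2) * h)" "2 * h < 3 * ((a + 2) * Y + Z + (b + 2) * h)"
    "2 * h < 3 * ((a + 2) * Z + X + (b + 2) * h)"
  using assms listed_chain_interior unfolding listed_def by blast+

text \<open>\<open>coordA\<close>, \<open>coordB\<close>, \<open>coordC\<close> are the coefficients
  of 1, rho^2 and \<open>gen1_inv\<close> in \<open>cone_combination\<close>.\<close>

definition coordA :: "int \<Rightarrow> int \<Rightarrow> int \<Rightarrow> int" where
  "coordA h X Y = 3 * ((a + 2) * Y + ((b - 1) * h - X - Y) + (b + 2) * h) - 2 * h"
definition coordB :: "int \<Rightarrow> int \<Rightarrow> int \<Rightarrow> int" where
  "coordB h X Y = 3 * ((a + 2) * ((b - 1) * h - X - Y) + X + (b + 2) * h) - 2 * h"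
definition coordC :: "int \<Rightarrow> int \<Rightarrow> int \<Rightarrow> int" where
  "coordC h X Y = 3 * ((a + 2) * X + Y + (b + 2) * h) - 2 * h"

lemma coord_pos:
  assumes "listed h X Y Z"
  shows "coordA h X Y > 0" "coordB h X Y > 0" "coordC h X Y > 0"
  using listed_interior[OF assms] unfolding listed_sum[OF assms] coordA_def coordB_def coordC_def by auto

lemma coord_sum:
  "of_int (coordA h X Y) + of_int (coordB h X Y) + of_int (coordC h X Y)
    = (of_int a ^ 2 + 3 * of_int a + 3) * (of_int h :: real)"
  unfolding coordA_def coordB_def coordC_def by (simp add: a_eq power2_eq_square algebra_simps)

lemma trprod_cone:
  "3 * (of_int a ^ 2 + 3 * of_int a + 3) * trprod a d (mulK a e (el h X Y))
    = of_int (coordA h X Y) * trprod a d e + of_int (coordB h X Y) * trprod a d (mulK a e (gb (- 1) (- 1) 3))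
      + of_int (coordC h X Y) * trprod a d (mulK a e (gen1_inv a))"
proof -
  have "3 * (of_int a ^ 2 + 3 * of_int a + 3) * trprod a d (mulK a e (el h X Y))
    = (\<Sum>r\<in>roots a. emb r d * emb r e * (3 * (of_int a ^ 2 + 3 * of_int a + 3) * emb r (el h X Y)))"
    unfolding trprod_def sum_distrib_left by (rule sum.cong) (simp_all add: emb_mulK)
  also have "\<dots> = (\<Sum>r\<in>roots a. emb r d * emb r e * (of_int (coordA h X Y) * emb r (gb 1 0 0)
       + of_int (coordB h X Y) * emb r (gb (- 1) (- 1) 3) + of_int (coordC h X Y) * emb r (gen1_inv a)))"
    unfolding cone_combination coordA_def coordB_def coordC_def ..
  also have "\<dots> = of_int (coordA h X Y) * trprod a d e + of_int (coordB h X Y) * trprod a d (mulK a e (gb (- 1) (- 1) 3))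
      + of_int (coordC h X Y) * trprod a d (mulK a e (gen1_inv a))"
    unfolding trprod_def sum_roots emb_mulK[OF r_in(1)] emb_mulK[OF r_in(2)] emb_mulK[OF r_in(3)] emb_1
    by (simp add: algebra_simps)
  finally show ?thesis .
qed

abbreviation level :: "Kel \<Rightarrow> real" where "level \<equiv> trprod a (dual 3 0 3)"

text \<open>The coordinates sum to (a^2 + 3 a + 3) h, so 3 can be subtracted from the level of each
  translated generator.\<close>

lemma level_defect:
  "3 * (of_int a ^ 2 + 3 * of_int a + 3) * (level (mulK a e (el h X Y)) - of_int h)
    = of_int (coordA h X Y) * (level e - 3) + of_int (coordB h X Y) * (level (mulK a e (gb (- 1) (- 1) 3)) - 3)
      + of_int (coordC h X Y) * (level (mulK a e (gen1_inv a)) - 3)"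
  using trprod_cone[of "dual 3 0 3" e h X Y] coord_sum[of h X Y] by (simp add: algebra_simps)

lemma N_pos: "3 * ((of_int a :: real) ^ 2 + 3 * of_int a + 3) > 0"
  using a_eq b_ge by (simp add: add_pos_pos)

lemma level_units:
  assumes "tp_unit a e"
  shows "level e - 3 \<ge> 0" "level (mulK a e (gb (- 1) (- 1) 3)) - 3 \<ge> 0" "level (mulK a e (gen1_inv a)) - 3 \<ge> 0"
  using tp_unit_level tp_unit_mulK assms tp_unit_square tp_unit_gens by simp_all

lemma level_mono:
  assumes "tp_unit a e" "listed h X Y Z"
  shows "level (mulK a e (el h X Y)) \<ge> of_int h"
proof -
  have "3 * (of_int a ^ 2 + 3 * of_int a + 3) * (level (mulK a e (el h X Y)) - of_int h) \<ge> 0"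
    unfolding level_defect using level_units[OF assms(1)] coord_pos[OF assms(2)] by simp
  then show ?thesis using N_pos by (simp add: zero_le_mult_iff)
qed

lemma level_fixed_imp_1:
  assumes e: "tp_unit a e" and l: "listed h X Y Z" and eq: "level (mulK a e (el h X Y)) = of_int h"
    and r: "r \<in> roots a"
  shows "emb r e = 1"
proof -
  have nn: "of_int (coordA h X Y) * (level e - 3) \<ge> 0"
    "of_int (coordB h X Y) * (level (mulK a e (gb (- 1) (- 1) 3)) - 3) \<ge> 0"
    "of_int (coordC h X Y) * (level (mulK a e (gen1_inv a)) - 3) \<ge> 0"
    using level_units[OF e] coord_pos[OF l] by simp_all
  have "of_int (coordA h X Y) * (level e - 3) + of_int (coordB h X Y) * (level (mulK a e (gb (- 1) (- 1) 3)) - 3)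
      + of_int (coordC h X Y) * (level (mulK a e (gen1_inv a)) - 3) = 0"
    using level_defect[of e h X Y] eq by simp
  then have "of_int (coordA h X Y) * (level e - 3) = 0"
    "of_int (coordB h X Y) * (level (mulK a e (gb (- 1) (- 1) 3)) - 3) = 0"
    "of_int (coordC h X Y) * (level (mulK a e (gen1_inv a)) - 3) = 0"
    using nn by linarith+
  then have three: "level e - 3 = 0" "level (mulK a e (gb (- 1) (- 1) 3)) - 3 = 0" "level (mulK a e (gen1_inv a)) - 3 = 0"
    using coord_pos[OF l] by simp_all
  obtain x y z where exyz: "e = gb x y z" using e OK_imp_gb by (metis tp_unit_def unitK_def)
  \<comment> \<open>The three translated generators have level 3, so multiplication by e preserves
    the level of every integer. For e - 1 this says that (e - 1)^2 has level 0, a sum of squares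
    with positive weights.\<close>
  obtain h' X' Y' where d: "gb (x - 1) y z = el h' X' Y'" using gb_el by metis
  have "3 * (of_int a ^ 2 + 3 * of_int a + 3) * (level (mulK a e (el h' X' Y')) - of_int h') = 0"
    unfolding level_defect three by simp
  then have "level (mulK a e (el h' X' Y')) = level (el h' X' Y')"
    using N_pos unfolding trprod_functionals by simp
  moreover have "emb s (el h' X' Y') = emb s e - 1" for s
    unfolding d[symmetric] exyz by (simp add: emb_gb)
  ultimately have "(\<Sum>s\<in>roots a. emb s (dual 3 0 3) * (emb s e - 1) ^ 2) = 0"
    unfolding trprod_def sum_roots emb_mulK[OF r_in(1)] emb_mulK[OF r_in(2)] emb_mulK[OF r_in(3)]
    by (simp add: power2_eq_square algebra_simps)
  moreover have "finite (roots a)" "\<forall>s\<in>roots a. emb s (dual 3 0 3) > 0"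
    using totpos_h by (auto simp: roots_eq totpos_def)
  ultimately have "emb r (dual 3 0 3) * (emb r e - 1) ^ 2 = 0"
    using r by (subst (asm) sum_nonneg_eq_0_iff) auto
  then show ?thesis using \<open>\<forall>s\<in>roots a. emb s (dual 3 0 3) > 0\<close> r by auto
qed

text \<open>\<open>level_mono\<close> in both directions gives h = h'; then
  \<open>level_fixed_imp_1\<close> makes the unit trivial.\<close>

lemma listed_assoc_imp_eq:
  assumes l: "listed h X Y Z" "listed h' X' Y' Z'" and as: "tp_assoc a (el h X Y) (el h' X' Y')"
  shows "el h X Y = el h' X' Y'"
proof -
  obtain e where e: "tp_unit a e" "el h X Y = mulK a e (el h' X' Y')" using as tp_assoc_iff by blast
  obtain f where f: "tp_unit a f" "el h' X' Y' = mulK a f (el h X Y)" using tp_assoc_sym[OF as] tp_assoc_iff by blast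
  have lev: "level (el h X Y) = of_int h" "level (el h' X' Y') = of_int h'" by (simp_all add: trprod_functionals)
  have "of_int h' \<le> (of_int h :: real)" using level_mono[OF e(1) l(2)] unfolding e(2)[symmetric] lev .
  moreover have "of_int h \<le> (of_int h' :: real)" using level_mono[OF f(1) l(1)] unfolding f(2)[symmetric] lev .
  ultimately have "level (mulK a e (el h' X' Y')) = of_int h'" unfolding e(2)[symmetric] lev by simp
  then have "emb r e = 1" if "r \<in> roots a" for r using level_fixed_imp_1[OF e(1) l(2)] that by blast
  then show ?thesis unfolding e(2) by (intro emb_inj) (simp add: emb_mulK)
qed

text \<open>Two bounds clash. Six times (1 + rho + rho^2) / 3 is a sum of three units, so its
  associates have level at least 9 / 6, whence h >= 2. Since T is at least 2 on units, it is at
  least 2 h / 3 on associates of \<open>el h X Y\<close>, but it is 1 on (1 + rho + rho^2) /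
  3.\<close>

lemma listed_not_assoc_g3:
  assumes l: "listed h X Y Z"
  shows "\<not> tp_assoc a (el h X Y) (gb 0 0 1)"
proof
  assume as: "tp_assoc a (el h X Y) (gb 0 0 1)"
  obtain e where e: "tp_unit a e" "el h X Y = mulK a e (gb 0 0 1)" using as tp_assoc_iff by blast
  obtain f where f: "tp_unit a f" "gb 0 0 1 = mulK a f (el h X Y)" using tp_assoc_sym[OF as] tp_assoc_iff by blast
  have "6 * level (mulK a e (gb 0 0 1)) = level e + level (mulK a e (gb (- 1) (- 1) 3)) + level (mulK a e (gen2 a))"
  proof -
    have "6 * emb r (gb 0 0 1) = 1 + emb r (gb (- 1) (- 1) 3) + emb r (gen2 a)" for r
      by (simp add: gen2_def emb_gb)
    note six = this
    have "6 * level (mulK a e (gb 0 0 1))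
      = (\<Sum>r\<in>roots a. emb r (dual 3 0 3) * emb r e * (6 * emb r (gb 0 0 1)))"
      unfolding trprod_def sum_distrib_left by (rule sum.cong) (simp_all add: emb_mulK)
    then show ?thesis
      unfolding six trprod_def sum_roots emb_mulK[OF r_in(1)] emb_mulK[OF r_in(2)] emb_mulK[OF r_in(3)]
      by (simp add: algebra_simps)
  qed
  moreover have "level e \<ge> 3" "level (mulK a e (gb (- 1) (- 1) 3)) \<ge> 3" "level (mulK a e (gen2 a)) \<ge> 3"
    using tp_unit_level tp_unit_mulK e(1) tp_unit_square tp_unit_gens by simp_all
  ultimately have "6 * level (el h X Y) \<ge> 9" unfolding e(2) by linarith
  then have h: "h \<ge> 2" unfolding trprod_functionals by simp
  let ?T = "trprod a (dual 2 (- 1) 2)" and ?N = "(of_int a :: real) ^ 2 + 3 * of_int a + 3"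
  have T: "?T f \<ge> 2" "?T (mulK a f (gb (- 1) (- 1) 3)) \<ge> 2" "?T (mulK a f (gen1_inv a)) \<ge> 2"
    using tp_unit_T tp_unit_mulK f(1) tp_unit_square tp_unit_gens by simp_all
  have "3 * ?N * 1 = 3 * ?N * ?T (mulK a f (el h X Y))"
    unfolding f(2)[symmetric] by (subst trprod_dual_gb[of _ _ _ 1]) simp_all
  also have "\<dots> = of_int (coordA h X Y) * ?T f + of_int (coordB h X Y) * ?T (mulK a f (gb (- 1) (- 1) 3))
      + of_int (coordC h X Y) * ?T (mulK a f (gen1_inv a))" by (rule trprod_cone)
  also have "\<dots> \<ge> of_int (coordA h X Y) * 2 + of_int (coordB h X Y) * 2 + of_int (coordC h X Y) * 2"
    using T coord_pos[OF l] by (intro add_mono mult_left_mono) auto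
  finally have "2 * (of_int (coordA h X Y) + of_int (coordB h X Y) + of_int (coordC h X Y)) \<le> 3 * ?N" by simp
  then have "?N * (2 * of_int h) \<le> ?N * 3" unfolding coord_sum by (simp add: mult_ac)
  moreover have "?N > 0" using N_pos by simp
  ultimately have "2 * of_int h \<le> (3 :: real)"
    using mult_le_cancel_left_pos[of ?N "2 * of_int h" 3] by blast
  then show False using h by simp
qed

lemma listed_level: "listed h X Y Z \<Longrightarrow> h = 1 \<or> h = 2 \<or> h = 3"
  by (auto simp: listed_def listed_chain_def)

lemma listed_not_tp_unit: "listed h X Y Z \<Longrightarrow> \<not> tp_unit a (el h X Y)"
  using listed_level tp_unit_level_1 tp_unit_level_2 not_tp_unit_level_3 by blast

lemma assoc_1_imp_tp_unit:
  assumes "tp_assoc a c (gb 1 0 0)"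
  shows "tp_unit a c"
proof -
  obtain e where e: "tp_unit a e" "c = mulK a e (gb 1 0 0)" using assms tp_assoc_iff by blast
  have "c = e" unfolding e(2) by (rule emb_inj) (simp add: emb_mulK emb_1)
  then show ?thesis using e by simp
qed

section \<open>Counting the classes\<close>

definition LS :: "(int \<times> int \<times> int) set" where
  "LS = {(h, X, Y). listed h X Y ((b - 1) * h - X - Y)}"

definition reps :: "Kel set" where
  "reps = insert (gb 1 0 0) (insert (gb 0 0 1) ((\<lambda>(h, X, Y). el h X Y) ` LS))"

lemma reps_eq: "reps = insert (gb 1 0 0) (L1 a \<union> L2 a)"
proof -
  have "L1 a \<union> L2 a = insert (gb 0 0 1) {el h X Y | h X Y. listed h X Y ((b - 1) * h - X - Y)}"
  proof (intro equalityI subsetI)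
    fix c assume "c \<in> insert (gb 0 0 1) {el h X Y | h X Y. listed h X Y ((b - 1) * h - X - Y)}"
    then consider "c = gb 0 0 1" | h X Y where "c = el h X Y" "listed h X Y ((b - 1) * h - X - Y)" by blast
    then show "c \<in> L1 a \<union> L2 a"
    proof cases
      case (2 h X Y)
      then show ?thesis unfolding L1_eq L2_eq by (cases "h = 3") blast+
    qed (simp add: L1_def)
  qed (use L1_eq L2_eq in blast)
  also have "{el h X Y | h X Y. listed h X Y ((b - 1) * h - X - Y)} = (\<lambda>(h, X, Y). el h X Y) ` LS"
    unfolding LS_def by force
  finally show ?thesis by (simp add: reps_def)
qed

lemma reps_cases:
  assumes "c \<in> reps"
  obtains "c = gb 1 0 0" | "c = gb 0 0 1" | h X Y where "c = el h X Y" "listed h X Y ((b - 1) * h - X - Y)"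
  using assms unfolding reps_eq L1_eq L2_eq by blast

lemma reps_assoc_imp_eq:
  assumes "c \<in> reps" "d \<in> reps" "tp_assoc a c d"
  shows "c = d"
proof -
  have *: "c = d" if cd: "tp_assoc a c d" "c \<in> reps" and d: "d = gb 1 0 0 \<or> d = gb 0 0 1" for c d
  proof -
    have ne: "\<not> tp_assoc a (gb 0 0 1) (gb 1 0 0)" "\<not> tp_assoc a (gb 1 0 0) (gb 0 0 1)"
      using assoc_1_imp_tp_unit tp_assoc_sym not_tp_unit_g3 by blast+
    from cd(2) show ?thesis
    proof (cases rule: reps_cases)
      case (3 h X Y)
      then show ?thesis
        using d cd(1) assoc_1_imp_tp_unit listed_not_tp_unit listed_not_assoc_g3 by metis
    qed (use d cd ne in auto)
  qed
  show ?thesis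
  proof (cases "(c = gb 1 0 0 \<or> c = gb 0 0 1) \<or> (d = gb 1 0 0 \<or> d = gb 0 0 1)")
    case True
    then show ?thesis using *[OF assms(3,1)] *[OF tp_assoc_sym[OF assms(3)] assms(2)] by blast
  next
    case False
    obtain h X Y where "c = el h X Y" "listed h X Y ((b - 1) * h - X - Y)"
      using assms(1) False by (cases rule: reps_cases) auto
    moreover obtain h' X' Y' where "d = el h' X' Y'" "listed h' X' Y' ((b - 1) * h' - X' - Y')"
      using assms(2) False by (cases rule: reps_cases) auto
    ultimately show ?thesis using listed_assoc_imp_eq assms(3) by blast
  qed
qed

lemma indec_iff: "indec a c \<longleftrightarrow> (\<exists>d \<in> insert (gb 1 0 0) (L1 a \<union> L2 a). tp_assoc a c d)"
  using indec_imp_assoc_listed indec_listed indec_assoc by blast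

text \<open>By \<open>indec_iff\<close> and \<open>reps_assoc_imp_eq\<close>, \<open>reps\<close>
  meets every class exactly once.\<close>

lemma card_classes: "card ({c. indec a c} // {(c, d). tp_assoc a c d}) = card reps"
proof -
  define R where "R = {(c, d). tp_assoc a c d}"
  have cls: "R `` {c} = R `` {d} \<longleftrightarrow> tp_assoc a c d" for c d
    unfolding R_def using tp_assoc_refl tp_assoc_sym tp_assoc_trans by blast
  have "{c. indec a c} // R = (\<lambda>d. R `` {d}) ` reps"
  proof (intro equalityI subsetI)
    fix S assume "S \<in> {c. indec a c} // R"
    then obtain c where c: "indec a c" "S = R `` {c}" by (auto elim: quotientE)
    then obtain d where "d \<in> reps" "tp_assoc a c d" using indec_iff reps_eq by metis
    then show "S \<in> (\<lambda>d. R `` {d}) ` reps" using c(2) cls by blast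
  next
    fix S assume "S \<in> (\<lambda>d. R `` {d}) ` reps"
    then obtain d where d: "d \<in> reps" "S = R `` {d}" by blast
    then have "indec a d" using indec_listed reps_eq by simp
    then show "S \<in> {c. indec a c} // R" using d(2) by (auto intro: quotientI)
  qed
  moreover have "inj_on (\<lambda>d. R `` {d}) reps"
    by (rule inj_onI) (use cls reps_assoc_imp_eq in blast)
  ultimately show ?thesis by (simp add: card_image flip: R_def)
qed

end

lemma finite_card_triangle:
  "finite {(x :: int, y :: int). 0 \<le> x \<and> 0 \<le> y \<and> x + y \<le> int n - 1}
   \<and> 2 * card {(x :: int, y :: int). 0 \<le> x \<and> 0 \<le> y \<and> x + y \<le> int n - 1} = n * (n + 1)"
proof (induction n)
  case 0
  have "{(x :: int, y :: int). 0 \<le> x \<and> 0 \<le> y \<and> x + y \<le> int 0 - 1} = {}" by auto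
  then show ?case by (simp only:) simp
next
  case (Suc n)
  let ?A = "{(x :: int, y :: int). 0 \<le> x \<and> 0 \<le> y \<and> x + y \<le> int n - 1}"
  \<comment> \<open>The new diagonal x + y = n.\<close>
  let ?B = "(\<lambda>x. (x, int n - x)) ` {0..int n}"
  have "{(x :: int, y :: int). 0 \<le> x \<and> 0 \<le> y \<and> x + y \<le> int (Suc n) - 1} = ?A \<union> ?B"
    by (force simp: image_iff)
  moreover have "card ?B = n + 1" by (subst card_image) (auto simp: inj_on_def)
  moreover have "card (?A \<union> ?B) = card ?A + card ?B"
    using Suc.IH by (intro card_Un_disjoint) auto
  ultimately show ?case using Suc.IH by simp
qed

context simplest_cubic
begin

text \<open>One triangle and six rows of b points, written as disjoint images for counting.\<close>

lemma LS_eq: "LS = (\<lambda>(X, Y). (1, X, Y)) ` {(X, Y). 0 \<le> X \<and> 0 \<le> Y \<and> X + Y \<le> int (nat b) - 1}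
   \<union> (\<lambda>Y. (2, - 1, Y)) ` {b..2 * b - 1} \<union> (\<lambda>X. (2, X, - 1)) ` {0..b - 1}
   \<union> (\<lambda>X. (2, X, 2 * b - 1 - X)) ` {b..2 * b - 1} \<union> (\<lambda>Y. (3, - 1, Y)) ` {- 1..b - 2}
   \<union> (\<lambda>X. (3, X, - 1)) ` {2 * b..3 * b - 1} \<union> (\<lambda>X. (3, X, 3 * b - 2 - X)) ` {- 1..b - 2}"
    (is "_ = ?R")
proof (intro equalityI subsetI)
  fix t assume "t \<in> LS"
  then obtain h X Y where t: "t = (h, X, Y)" "listed h X Y ((b - 1) * h - X - Y)" by (auto simp: LS_def)
  from t(2) consider "h = 1" "0 \<le> X" "0 \<le> Y" "X + Y \<le> b - 1" | "h = 2" "X = - 1" "b \<le> Y" "Y \<le> 2 * b - 1"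
    | "h = 2" "Y = - 1" "0 \<le> X" "X \<le> b - 1" | "h = 2" "Y = 2 * b - 1 - X" "b \<le> X" "X \<le> 2 * b - 1"
    | "h = 3" "X = - 1" "- 1 \<le> Y" "Y \<le> b - 2" | "h = 3" "Y = - 1" "2 * b \<le> X" "X \<le> 3 * b - 1"
    | "h = 3" "Y = 3 * b - 2 - X" "- 1 \<le> X" "X \<le> b - 2"
    unfolding listed_def listed_chain_def by (elim disjE conjE; simp)
  then show "t \<in> ?R" by cases (use t(1) b_ge in auto)
next
  fix t assume "t \<in> ?R"
  then show "t \<in> LS"
    by (elim UnE imageE) (use b_ge in \<open>simp_all add: LS_def listed_def listed_chain_def split: prod.splits\<close>)
qed

lemma card_LS: "finite LS" "2 * int (card LS) = b * (b + 1) + 12 * b"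
proof -
  have inj: "inj_on (\<lambda>(X, Y). (1 :: int, X :: int, Y :: int)) S" for S by (auto simp: inj_on_def)
  note tri = finite_card_triangle[of "nat b"]
  show "finite LS" unfolding LS_eq using tri by simp
  have "card LS = card {(X, Y). 0 \<le> X \<and> 0 \<le> Y \<and> X + Y \<le> int (nat b) - 1} + 6 * nat b"
    unfolding LS_eq
    by (subst card_Un_disjoint, use tri b_ge in simp, use tri b_ge in simp, use b_ge in force)+
      (simp add: card_image inj inj_on_def)
  moreover have "2 * int (card {(X :: int, Y :: int). 0 \<le> X \<and> 0 \<le> Y \<and> X + Y \<le> int (nat b) - 1}) = b * (b + 1)"
    using arg_cong[OF conjunct2[OF tri], of int] b_ge by (simp add: algebra_simps)
  ultimately show "2 * int (card LS) = b * (b + 1) + 12 * b" using b_ge by simp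
qed

text \<open>The triangle has b (b + 1) / 2 = (a^2 + 3 a) / 18 points and the six rows have 6 b = 2
  a; the last 2 counts 1 and (1 + rho + rho^2) / 3.\<close>

lemma card_reps: "int (card reps) = (a ^ 2 + 3 * a) div 18 + 2 * a + 2"
proof -
  let ?f = "\<lambda>(h, X, Y). el h X Y"
  have "inj_on ?f LS" by (auto simp: inj_on_def el_inj)
  then have c: "card (?f ` LS) = card LS" by (rule card_image)
  have n1: "gb 0 0 1 \<notin> ?f ` LS"
    using listed_not_assoc_g3 tp_assoc_refl by (fastforce simp: LS_def)
  have n2: "gb 1 0 0 \<notin> insert (gb 0 0 1) (?f ` LS)"
    using listed_not_tp_unit tp_unit_1 by (fastforce simp: LS_def gb_inj)
  have "card reps = card LS + 2" unfolding reps_def using n1 n2 card_LS(1) c by simp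
  moreover have "a ^ 2 + 3 * a = 18 * int (card LS) - 108 * b"
    using card_LS(2) by (simp add: a_eq power2_eq_square algebra_simps)
  then have "(a ^ 2 + 3 * a) div 18 = int (card LS) - 6 * b" by simp
  ultimately show ?thesis by (simp add: a_eq)
qed

lemma classification:
  "(\<forall>c. indec a c \<longleftrightarrow> (\<exists>d \<in> insert (gb 1 0 0) (L1 a \<union> L2 a). tp_assoc a c d))
     \<and> (\<forall>c\<in>L2 a. has_min_trace a c 2)
     \<and> (\<forall>c\<in>L1 a. has_min_trace a c 1)
     \<and> int (card ({c. indec a c} // {(c, d). tp_assoc a c d})) = (a ^ 2 + 3 * a) div 18 + 2 * a + 2"
proof (intro conjI allI ballI)
  show "indec a c \<longleftrightarrow> (\<exists>d \<in> insert (gb 1 0 0) (L1 a \<union> L2 a). tp_assoc a c d)" for c by (rule indec_iff)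
  show "has_min_trace a c 2" if "c \<in> L2 a" for c using that has_min_trace_2 unfolding L2_eq by blast
  show "has_min_trace a c 1" if "c \<in> L1 a" for c using trace_1_exists[OF that] has_min_trace_1I by metis
  show "int (card ({c. indec a c} // {(c, d). tp_assoc a c d})) = (a ^ 2 + 3 * a) div 18 + 2 * a + 2"
    unfolding card_classes by (rule card_reps)
qed

end

section \<open>Existence of the roots and conclusion\<close>

lemma largest_root:
  fixes a :: int
  assumes "a > 0"
  obtains r where "r \<in> roots a" "of_int a + 1 < r" "r < of_int a + 2"
proof -
  define f where "f x = x ^ 3 - of_int a * x ^ 2 - (of_int a + 3) * x - 1" for x :: real
  have a: "(of_int a :: real) \<ge> 1" using assms by simp
  have lo: "f (of_int a + 1) = - 2 * of_int a - 3"
    by (simp add: f_def power2_eq_square power3_eq_cube algebra_simps)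
  have hi: "f (of_int a + 2) = of_int a ^ 2 + 3 * of_int a + 1"
    by (simp add: f_def power2_eq_square power3_eq_cube algebra_simps)
  have "continuous_on {of_int a + 1..of_int a + 2} f" unfolding f_def by (intro continuous_intros)
  moreover have "f (of_int a + 1) \<le> 0" "0 \<le> f (of_int a + 2)" using lo hi a by simp_all
  ultimately have "\<exists>r. of_int a + 1 \<le> r \<and> r \<le> of_int a + 2 \<and> f r = 0"
    by (intro IVT') auto
  then obtain r where r: "of_int a + 1 \<le> r" "r \<le> of_int a + 2" "f r = 0" by blast
  have "f (of_int a + 1) \<noteq> 0" using lo a by simp
  moreover have "f (of_int a + 2) \<noteq> 0" using hi a by (smt (verit) zero_le_power2)
  ultimately have "r \<noteq> of_int a + 1" "r \<noteq> of_int a + 2" using r(3) by auto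
  then show ?thesis using that[of r] r by (simp add: roots_def f_def)
qed

theorem theorem1p2:
  fixes a :: int
  assumes "a mod 27 = 3 \<or> a mod 27 = 21"
    and "a > 12"
    and "squarefree ((a^2 + 3*a + 9) div 27)"
  shows "(\<forall>c. indec a c \<longleftrightarrow> (\<exists>b \<in> insert (gb 1 0 0) (L1 a \<union> L2 a). tp_assoc a c b))
     \<and> (\<forall>c\<in>L2 a. has_min_trace a c 2)
     \<and> (\<forall>c\<in>L1 a. has_min_trace a c 1)
     \<and> int (card ({c. indec a c} // {(c, b). tp_assoc a c b})) = (a^2 + 3*a) div 18 + 2*a + 2"
proof -
  define b where "b = a div 3"
  define k where "k = a div 27"
  have "a = 27 * k + a mod 27" by (simp add: k_def)
  then have "a = 3 * (9 * k + 1) \<or> a = 3 * (9 * k + 7)" using assms(1) by auto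
  then have "(a = 3 * b \<and> b = 9 * k + 1) \<or> (a = 3 * b \<and> b = 9 * k + 7)" unfolding b_def by auto
  then have ab: "a = 3 * b" and bm: "b mod 9 = 1 \<or> b mod 9 = 7" by auto
  have b7: "b \<ge> 7" using bm assms(2) ab by presburger
  have "(b ^ 2 + b + 1) mod 3 = 0"
  proof -
    have "b mod 3 = 1" using bm by presburger
    then obtain k where "b = 3 * k + 1" by (metis mult_div_mod_eq)
    then have "b ^ 2 + b + 1 = 3 * (3 * k ^ 2 + 3 * k + 1)" by (simp add: power2_eq_square algebra_simps)
    then show ?thesis by simp
  qed
  then obtain m where m: "b ^ 2 + b + 1 = 3 * m" by auto
  have "a ^ 2 + 3 * a + 9 = 9 * (b ^ 2 + b + 1)" by (simp add: ab power2_eq_square)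
  then have "(a ^ 2 + 3 * a + 9) div 27 = m" unfolding m by simp
  then have sq: "squarefree m" using assms(3) by simp
  obtain r where r: "r \<in> roots a" "of_int a + 1 < r" "r < of_int a + 2" using largest_root[of a] assms(2) by auto
  have rp: "r > 0" using r(2) assms(2) by simp
  \<comment> \<open>The other two roots are the images of r under t -> - (1 + t) / t and its
    inverse.\<close>
  interpret simplest_cubic a b m r "- 1 - 1 / r" "- 1 / (1 + r)"
    by unfold_locales (use ab b7 m bm sq r rp in \<open>auto simp: field_simps\<close>)
  show ?thesis by (rule classification)
qed

end
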